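(* Let $T>0$, $A\ge 0$, and let $b:\mathbb{R}\times(-\infty,T]\to\mathbb{R}$ be a continuous function $b(y,s)$, differentiable in $y$ with $\partial b/\partial y$ continuous in $(y,s)$, satisfying $\sup\{|\partial b(y,s)/\partial y| : y\in\mathbb{R},\ s\le T\}\le A$, and suppose $b(y,s)$ is concave in $y\in\mathbb{R}$ for every $s\le T$. Then for each $t<T$ the function $q(x,y,t)$ is convex in $(x,y)\in\mathbb{R}^2$. Suppose in addition that $b(y,s)$ is twice differentiable in $y$ for $y\in\mathbb{R}$, $s\le T$, and $\partial^2b(y,s)/\partial y^2$ is continuous in $(y,s)$. Then $q(x,y,t)$ is twice differentiable in $(x,y)$ for $(x,y,t)\in U_T=\{(x,y,t):(x,y)\in\mathbb{R}^2,\ t<T,\ y<F(x,t)\}$; the second derivatives of $q$ with respect to $(x,y)$ are continuous in $U_T$ and satisfy $$\frac{\partial^2q}{\partial x^2}>0,\qquad \frac{\partial^2q}{\partial y^2}>0,\qquad \frac{\partial^2q}{\partial x\partial y}<0\qquad\text{on }U_T.$$ Furthermore, if $(x_0,y_0,t_0)\in\partial U_T$ and $t_0<T$, then, with limits taken over $(x,y,t)\in U_T$ (and existing), $$\lim_{(x,y,t)\to(x_0,y_0,t_0)}\frac{\partial^2q(x,y,t)}{\partial x^2}>0,\qquad \lim_{(x,y,t)\to(x_0,y_0,t_0)}\frac{\partial^2q(x,y,t)}{\partial y^2}>0 .$$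
   Context: $q(x,y,t)=\min \tfrac12\int_t^T[\tfrac{dy(s)}{ds}-b(y(s),s)]^2ds$, the minimum being over all functions $y(s)=y+\int_t^s f(s')\,ds'$, $t\le s\le T$, with $f\in L^2[t,T]$ and $y(T)\ge x$. For $x\in\mathbb{R}$, $t\le T$, $F(x,t)=y(t)$ where $y(\cdot)$ solves the terminal value problem $\frac{dy(s)}{ds}=b(y(s),s)$, $s\le T$, $y(T)=x$. *)

theory Defs
  imports "HOL-Analysis.Analysis"
begin

definition square_integrable_on :: "(real \<Rightarrow> real) \<Rightarrow> real set \<Rightarrow> bool" where
  "square_integrable_on f S \<longleftrightarrow>
     f \<in> borel_measurable (lebesgue_on S) \<and> integrable (lebesgue_on S) (\<lambda>s. (f s)\<^sup>2)"

definition path_from :: "real \<Rightarrow> real \<Rightarrow> (real \<Rightarrow> real) \<Rightarrow> real \<Rightarrow> real" where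
  "path_from y t f s = y + (LINT r|lebesgue_on {t..s}. f r)"

text \<open>The velocity of the path \<open>path_from y t f\<close> is \<open>f\<close> almost everywhere.\<close>

definition action :: "(real \<Rightarrow> real \<Rightarrow> real) \<Rightarrow> real \<Rightarrow> real \<Rightarrow> real \<Rightarrow> (real \<Rightarrow> real) \<Rightarrow> real" where
  "action b T y t f =
     1/2 * (LINT s|lebesgue_on {t..T}. (f s - b (path_from y t f s) s)\<^sup>2)"

text \<open>The minimal action, written as an infimum. For continuous \<open>b\<close> and \<open>t < T\<close> the integrand
  of \<open>action\<close> is integrable for every admissible \<open>f\<close>, and the set is nonempty and bounded
  below by \<open>0\<close>; its infimum is its minimum whenever the latter exists.\<close>

definition q :: "(real \<Rightarrow> real \<Rightarrow> real) \<Rightarrow> real \<Rightarrow> real \<Rightarrow> real \<Rightarrow> real \<Rightarrow> real" where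
  "q b T x y t =
     Inf {action b T y t f | f. square_integrable_on f {t..T} \<and> path_from y t f T \<ge> x}"

definition solves_tvp ::
    "(real \<Rightarrow> real \<Rightarrow> real) \<Rightarrow> real \<Rightarrow> real \<Rightarrow> (real \<Rightarrow> real) \<Rightarrow> bool" where
  "solves_tvp b T x u \<longleftrightarrow>
     (\<forall>s\<le>T. (u has_real_derivative b (u s) s) (at s within {..T})) \<and> u T = x"

text \<open>The description is well defined for \<open>t \<le> T\<close> if \<open>b\<close> is continuous and
  uniformly Lipschitz in its first argument: the solution then exists on \<open>{..T}\<close> and is unique there.\<close>

definition F :: "(real \<Rightarrow> real \<Rightarrow> real) \<Rightarrow> real \<Rightarrow> real \<Rightarrow> real \<Rightarrow> real" where
  "F b T x t = (THE v. \<exists>u. solves_tvp b T x u \<and> v = u t)"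

definition U :: "(real \<Rightarrow> real \<Rightarrow> real) \<Rightarrow> real \<Rightarrow> (real \<times> real \<times> real) set" where
  "U b T = {(x, y, t). t < T \<and> y < F b T x t}"

text \<open>Partial derivatives in the first and in the second argument. They carry information only
  where the derivatives exist, so differentiability is always stated separately.\<close>

definition partial1 :: "(real \<Rightarrow> real \<Rightarrow> real) \<Rightarrow> real \<Rightarrow> real \<Rightarrow> real" where
  "partial1 g x y = deriv (\<lambda>u. g u y) x"

definition partial2 :: "(real \<Rightarrow> real \<Rightarrow> real) \<Rightarrow> real \<Rightarrow> real \<Rightarrow> real" where
  "partial2 g x y = deriv (\<lambda>v. g x v) y"

text \<open>Twice Frechet differentiable at a point: differentiable in a neighbourhood, with the
  derivative, as a map into the bounded linear functions, differentiable at the point.\<close>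

definition twice_differentiable_at ::
    "('a::real_normed_vector \<Rightarrow> 'b::real_normed_vector) \<Rightarrow> 'a \<Rightarrow> bool" where
  "twice_differentiable_at g p \<longleftrightarrow>
     (\<exists>g' :: 'a \<Rightarrow> 'a \<Rightarrow>\<^sub>L 'b.
        (\<forall>\<^sub>F z in nhds p. (g has_derivative blinfun_apply (g' z)) (at z)) \<and>
        g' differentiable (at p))"

abbreviation q_xx :: "(real \<Rightarrow> real \<Rightarrow> real) \<Rightarrow> real \<Rightarrow> real \<Rightarrow> real \<Rightarrow> real \<Rightarrow> real" where
  "q_xx b T x y t \<equiv> partial1 (partial1 (\<lambda>x y. q b T x y t)) x y"

abbreviation q_yy :: "(real \<Rightarrow> real \<Rightarrow> real) \<Rightarrow> real \<Rightarrow> real \<Rightarrow> real \<Rightarrow> real \<Rightarrow> real" where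
  "q_yy b T x y t \<equiv> partial2 (partial2 (\<lambda>x y. q b T x y t)) x y"

abbreviation q_xy :: "(real \<Rightarrow> real \<Rightarrow> real) \<Rightarrow> real \<Rightarrow> real \<Rightarrow> real \<Rightarrow> real \<Rightarrow> real" where
  "q_xy b T x y t \<equiv> partial1 (partial2 (\<lambda>x y. q b T x y t)) x y"

abbreviation q_yx :: "(real \<Rightarrow> real \<Rightarrow> real) \<Rightarrow> real \<Rightarrow> real \<Rightarrow> real \<Rightarrow> real \<Rightarrow> real" where
  "q_yx b T x y t \<equiv> partial2 (partial1 (\<lambda>x y. q b T x y t)) x y"

end

theory Submission
  imports Defs
begin

text \<open>
Convexity. Along a convex combination of two controlled paths the residual \<open>y' - b y s\<close> is, by concavity of \<open>b\<close>,
at most the convex combination of the residuals. To square this one-sided bound one passes to the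
positive part of the residual. That is harmless: the path driven by the positive part lies above the
original one, so it still meets the one-sided endpoint constraint (\<open>positive_part_path\<close>). It
exists because subtracting the integral of the positive part leaves an ordinary differential
equation with a continuous, Lipschitz field.

Gradient. With a second derivative of \<open>b\<close>, Hamilton's equations \<open>Y' = b Y + P\<close>, \<open>P' = - b1 Y * P\<close> have unique
solutions for given terminal values \<open>(x, p)\<close>, and \<open>P \<ge> 0\<close> if \<open>p \<ge> 0\<close>. Since \<open>b\<close> is concave and \<open>P\<close> is
nonnegative, such an extremal is a global minimiser, and the same computation bounds the action of
every other path, with arbitrary endpoints, from below by an affine function
(\<open>action_ge_affine\<close>). Hence \<open>(P T, - P t)\<close> is a subgradient of \<open>q\<close> at \<open>(Y T, Y t)\<close>.

Hessian. The difference of two extremals solves a linear system exactly, with mean slopes of \<open>b\<close> and its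
derivative as coefficients (\<open>extremal_difference\<close>). This system is cooperative, thanks to \<open>b2 \<le> 0\<close> and \<open>P \<ge> 0\<close>, which
gives the signs of its fundamental matrix: \<open>Y_x > 0\<close>, \<open>Y_p < 0\<close>, \<open>P_p > 0\<close> before time \<open>T\<close>. Therefore \<open>Y\<close> at time \<open>t\<close> is
strictly decreasing in \<open>p\<close>, every \<open>y \<le> F x t\<close> is reached by exactly one terminal momentum \<open>p \<ge> 0\<close>, and
increments of this momentum have exact secant slopes built from the fundamental matrix. As the
fundamental matrix depends continuously on the pair of extremals, the slopes converge and
\<open>q_xx = - Y_x / Y_p\<close>, \<open>q_xy = 1 / Y_p\<close>, \<open>q_yy = - P_p / Y_p\<close>. All of this remains valid for \<open>p = 0\<close>, that is for
\<open>y = F x t\<close>, so the formulas are continuous and keep their signs up to the part of the boundary with \<open>t < T\<close>.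
\<close>

section \<open>Terminal value problems depending on a parameter\<close>

lemma uniform_limitI_geometric:
  fixes u :: "nat \<Rightarrow> 'a \<Rightarrow> 'b::banach"
  assumes "\<And>n x. x \<in> K \<Longrightarrow> norm (u (Suc n) x - u n x) \<le> B * (1/2) ^ n"
  shows "uniform_limit K u (\<lambda>x. lim (\<lambda>n. u n x)) sequentially"
proof -
  have "summable (\<lambda>n. B * (1/2::real) ^ n)"
    by (intro summable_mult summable_geometric) auto
  then have "uniform_limit K (\<lambda>n x. \<Sum>i<n. u (Suc i) x - u i x) (\<lambda>x. \<Sum>i. u (Suc i) x - u i x) sequentially"
    using assms by (intro Weierstrass_m_test) auto
  then have "uniform_limit K (\<lambda>n x. (\<Sum>i<n. u (Suc i) x - u i x) + u 0 x)
      (\<lambda>x. (\<Sum>i. u (Suc i) x - u i x) + u 0 x) sequentially"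
    by (intro uniform_limit_add uniform_limit_const)
  then have *: "uniform_limit K u (\<lambda>x. (\<Sum>i. u (Suc i) x - u i x) + u 0 x) sequentially"
    by (simp add: sum_lessThan_telescope[of "\<lambda>n. u n x" for x])
  have "lim (\<lambda>n. u n x) = (\<Sum>i. u (Suc i) x - u i x) + u 0 x" if "x \<in> K" for x
    using tendsto_uniform_limitI[OF * that] by (rule limI)
  with * show ?thesis
    by (subst uniform_limit_cong'[where g = u and i = "\<lambda>x. (\<Sum>i. u (Suc i) x - u i x) + u 0 x"]) auto
qed

text \<open>Bounds of the form \<open>C * exp (K * (T - s))\<close> reproduce themselves under integration up to the factor
\<open>1 / K\<close>. With \<open>K\<close> twice the Lipschitz constant, the Picard operator contracts by \<open>1/2\<close> in the
weighted norm on the whole interval.\<close>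
lemma integral_le_exp:
  fixes h :: "real \<Rightarrow> real"
  assumes "h integrable_on {s..T}" "s \<le> T" "K > 0"
    and "\<And>r. r \<in> {s..T} \<Longrightarrow> h r \<le> C * exp (K * (T - r))"
  shows "integral {s..T} h \<le> C / K * (exp (K * (T - s)) - 1)"
proof -
  have "((\<lambda>r. - (C / K) * exp (K * (T - r))) has_real_derivative C * exp (K * (T - r))) (at r within {s..T})" for r
    using \<open>K > 0\<close> by (auto intro!: derivative_eq_intros)
  then have "((\<lambda>r. C * exp (K * (T - r))) has_integral
      (- (C / K) * exp (K * (T - T)) - (- (C / K) * exp (K * (T - s))))) {s..T}"
    using assms(2) by (intro fundamental_theorem_of_calculus)
      (auto simp: has_real_derivative_iff_has_vector_derivative[symmetric])
  moreover from assms(1) have "(h has_integral integral {s..T} h) {s..T}" by blast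
  ultimately have "integral {s..T} h \<le> - (C / K) * exp (K * (T - T)) - (- (C / K) * exp (K * (T - s)))"
    using assms(4) by (metis (no_types, lifting) has_integral_le)
  then show ?thesis by (simp add: algebra_simps)
qed

text \<open>Moving the variable lower limit into the integrand reduces joint continuity in parameter and limit
to continuity of an integral over a fixed interval.\<close>
lemma integral_upper_rescale:
  fixes h :: "real \<Rightarrow> 'a::banach"
  assumes "h integrable_on {s..T}" "s \<le> T"
  shows "integral {s..T} h = (T - s) *\<^sub>R integral {0..1} (\<lambda>\<tau>. h (s + \<tau> * (T - s)))"
proof (cases "s = T")
  case False
  then have "T - s > 0" using assms by simp
  moreover have "(h has_integral integral {s..T} h) (cbox s T)"
    using assms by auto
  ultimately have "((\<lambda>\<tau>. h ((T - s) *\<^sub>R \<tau> + s)) has_integral integral {s..T} h /\<^sub>R (T - s)) {0..1}"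
    using has_integral_affinity'[of h _ s T "T - s" s] by simp
  then have "integral {0..1} (\<lambda>\<tau>. h (s + \<tau> * (T - s))) = integral {s..T} h /\<^sub>R (T - s)"
    by (simp add: algebra_simps integral_unique)
  with False show ?thesis by simp
qed simp

lemma continuous_on_integral_upper:
  fixes h :: "'p::topological_space \<Rightarrow> real \<Rightarrow> 'a::banach"
  assumes "continuous_on (UNIV \<times> {..T}) (\<lambda>(\<theta>, s). h \<theta> s)"
  shows "continuous_on (UNIV \<times> {..T}) (\<lambda>(\<theta>, s). integral {s..T} (h \<theta>))"
proof -
  have "s + \<tau> * (T - s) \<le> T" if "s \<le> T" "\<tau> \<le> 1" for s \<tau>
    using mult_right_mono[OF that(2), of "T - s"] that by simp
  then have "continuous_on ((UNIV \<times> {..T}) \<times> cbox 0 1)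
      (\<lambda>z. (\<lambda>(\<theta>, s). h \<theta> s) (fst (fst z), snd (fst z) + snd z * (T - snd (fst z))))"
    by (intro continuous_on_compose2[OF assms]) (auto intro!: continuous_intros)
  then have "continuous_on (UNIV \<times> {..T})
      (\<lambda>x. integral (cbox 0 1) (\<lambda>\<tau>. h (fst x) (snd x + \<tau> * (T - snd x))))"
    by (intro integral_continuous_on_param) (simp add: case_prod_unfold)
  then have "continuous_on (UNIV \<times> {..T})
      (\<lambda>x. (T - snd x) *\<^sub>R integral {0..1} (\<lambda>\<tau>. h (fst x) (snd x + \<tau> * (T - snd x))))"
    by (auto intro!: continuous_intros)
  then show ?thesis
  proof (rule continuous_on_eq)
    fix x :: "'p \<times> real" assume x: "x \<in> UNIV \<times> {..T}"
    have "continuous_on {snd x..T} (\<lambda>s. (\<lambda>(\<theta>, s). h \<theta> s) (fst x, s))"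
      by (intro continuous_on_compose2[OF assms]) (auto intro!: continuous_intros)
    then have "h (fst x) integrable_on {snd x..T}"
      by (intro integrable_continuous_interval) simp
    with x show "(T - snd x) *\<^sub>R integral {0..1} (\<lambda>\<tau>. h (fst x) (snd x + \<tau> * (T - snd x)))
        = (\<lambda>(\<theta>, s). integral {s..T} (h \<theta>)) x"
      by (auto simp: case_prod_unfold integral_upper_rescale)
  qed
qed

lemma integral_upper_has_vector_derivative:
  fixes h :: "real \<Rightarrow> 'a::banach"
  assumes "continuous_on {..T} h" "s \<le> T"
  shows "((\<lambda>s. integral {s..T} h) has_vector_derivative - h s) (at s within {..T})"
proof -
  have c: "continuous_on {s - 1..T} h"
    using assms by (auto intro: continuous_on_subset)
  have "((\<lambda>r. integral {s - 1..T} h - integral {s - 1..r} h) has_vector_derivative 0 - h s) (at s within {s - 1..T})"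
    using assms by (intro has_vector_derivative_diff integral_has_vector_derivative c) auto
  then have "((\<lambda>r. integral {s - 1..T} h - integral {s - 1..r} h) has_vector_derivative - h s) (at s within {s - 1..T})"
    by simp
  then have "((\<lambda>s. integral {s..T} h) has_vector_derivative - h s) (at s within {s - 1..T})"
  proof (rule has_vector_derivative_transform[rotated 2])
    fix r assume "r \<in> {s - 1..T}"
    then show "integral {r..T} h = integral {s - 1..T} h - integral {s - 1..r} h"
      using Henstock_Kurzweil_Integration.integral_combine[of "s - 1" r T h] c
      by (auto simp: algebra_simps integrable_continuous_interval)
  qed (use assms in auto)
  moreover have "at s within {s - 1..T} = at s within {..T}"
    by (rule at_within_nhd[of _ "{s - 1<..}"]) auto
  ultimately show ?thesis by simp
qed

text \<open>The parameter \<open>\<theta>\<close> serves both for initial data and for coefficients. Linear growth keeps solutions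
bounded on every compact time interval, so that a Lipschitz bound on bounded sets suffices for
global existence; all constants are uniform over bounded parameter sets, which is what yields joint
continuity of the solution in the parameter and the time.\<close>
locale terminal_ode =
  fixes f :: "'p::euclidean_space \<Rightarrow> 'a::euclidean_space \<Rightarrow> real \<Rightarrow> 'a" and T :: real
  assumes cont: "continuous_on (UNIV \<times> UNIV \<times> {..T}) (\<lambda>(\<theta>, z, s). f \<theta> z s)"
    and growth: "\<And>R T0. \<exists>G. \<forall>\<theta> z. \<forall>s\<in>{T0..T}. norm \<theta> \<le> R \<longrightarrow> norm (f \<theta> z s) \<le> G * (1 + norm z)"
    and lipschitz: "\<And>R T0. \<exists>L. \<forall>\<theta> z z'. \<forall>s\<in>{T0..T}. norm \<theta> \<le> R \<longrightarrow> norm z \<le> R \<longrightarrow> norm z' \<le> R \<longrightarrow>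
      norm (f \<theta> z s - f \<theta> z' s) \<le> L * norm (z - z')"
begin

lemma continuous_along:
  assumes "continuous_on (UNIV \<times> {..T}) (\<lambda>(\<theta>, s). u \<theta> s)"
  shows "continuous_on (UNIV \<times> {..T}) (\<lambda>(\<theta>, s). f \<theta> (u \<theta> s) s)"
proof -
  have "continuous_on (UNIV \<times> {..T}) (\<lambda>x. (\<lambda>(\<theta>, z, s). f \<theta> z s) (fst x, (\<lambda>(\<theta>, s). u \<theta> s) x, snd x))"
    by (intro continuous_on_compose2[OF cont]) (auto intro!: continuous_intros assms)
  then show ?thesis by (simp add: case_prod_unfold)
qed

lemma continuous_along_path:
  assumes "continuous_on {t..T} u"
  shows "continuous_on {t..T} (\<lambda>s. f \<theta> (u s) s)"
proof -
  have "continuous_on {t..T} (\<lambda>s. (\<lambda>(\<theta>, z, s). f \<theta> z s) (\<theta>, u s, s))"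
    by (intro continuous_on_compose2[OF cont]) (auto intro!: continuous_intros assms)
  then show ?thesis by simp
qed

fun picard :: "('p \<Rightarrow> 'a) \<Rightarrow> nat \<Rightarrow> 'p \<Rightarrow> real \<Rightarrow> 'a" where
  "picard z 0 \<theta> s = z \<theta>"
| "picard z (Suc n) \<theta> s = z \<theta> - integral {s..T} (\<lambda>r. f \<theta> (picard z n \<theta> r) r)"

lemma continuous_picard:
  assumes "continuous_on UNIV z"
  shows "continuous_on (UNIV \<times> {..T}) (\<lambda>(\<theta>, s). picard z n \<theta> s)"
proof (induction n)
  case 0
  show ?case
    using continuous_on_compose2[OF assms continuous_on_fst[OF continuous_on_id]]
    by (simp add: case_prod_unfold)
next
  case (Suc n)
  have "continuous_on (UNIV \<times> {..T}) (\<lambda>x. z (fst x) - (\<lambda>(\<theta>, s). integral {s..T} (\<lambda>r. f \<theta> (picard z n \<theta> r) r)) x)"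
    by (intro continuous_intros continuous_on_compose2[OF assms]
        continuous_on_integral_upper continuous_along Suc) auto
  then show ?case by (simp add: case_prod_unfold)
qed

lemma continuous_slice:
  assumes "continuous_on (UNIV \<times> {..T}) (\<lambda>(\<theta>, s). u \<theta> s)"
  shows "continuous_on {..T} (u \<theta>)"
proof -
  have "continuous_on {..T} (\<lambda>s. (\<lambda>(\<theta>, s). u \<theta> s) (\<theta>, s))"
    by (intro continuous_on_compose2[OF assms]) (auto intro!: continuous_intros)
  then show ?thesis by simp
qed

text \<open>Both bounds are proved by induction with exponential weights: \<open>1 + norm\<close> of an iterate stays below
\<open>(1 + Z) * exp (G * (T - s))\<close>, where \<open>Z\<close> bounds the terminal data and \<open>G\<close> is the growth constant;
on the bounded set so obtained a Lipschitz constant \<open>L\<close> is available, and the weight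
\<open>exp (2 * L * (T - s))\<close> makes the differences of successive iterates halve.\<close>
lemma picard_geometric:
  assumes z: "continuous_on UNIV z"
  shows "\<exists>B D. \<forall>\<theta> s n. norm \<theta> \<le> R \<longrightarrow> s \<in> {T0..T} \<longrightarrow>
    norm (picard z n \<theta> s) \<le> D \<and>
    norm (picard z (Suc n) \<theta> s - picard z n \<theta> s) \<le> B * (1/2) ^ n"
proof -
  obtain G0 where G0: "\<And>\<theta> z s. s \<in> {T0..T} \<Longrightarrow> norm \<theta> \<le> R \<Longrightarrow> norm (f \<theta> z s) \<le> G0 * (1 + norm z)"
    using growth[where R = R and ?T0.0 = T0] by metis
  define G where "G = max G0 1"
  have G: "norm (f \<theta> z s) \<le> G * (1 + norm z)" if "s \<in> {T0..T}" "norm \<theta> \<le> R" for \<theta> z s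
    using G0[OF that, of z] mult_right_mono[of G0 G "1 + norm z"] by (force simp: G_def)
  have "bounded (z ` cball 0 R)"
    using z by (intro compact_imp_bounded compact_continuous_image) (auto intro: continuous_on_subset)
  then obtain Z where Z: "norm (z \<theta>) \<le> Z" if "norm \<theta> \<le> R" for \<theta>
    unfolding bounded_iff by (metis imageI mem_cball_0)
  define D where "D = \<bar>1 + Z\<bar> * exp (G * \<bar>T - T0\<bar>)"
  have integrable: "(\<lambda>r. f \<theta> (picard z n \<theta> r) r) integrable_on {s..T}" for \<theta> s n
    using continuous_slice[OF continuous_picard[OF z, of n], of \<theta>]
    by (intro integrable_continuous_interval continuous_along_path) (auto intro: continuous_on_subset)
  have cp: "continuous_on {s..T} (picard z n \<theta>)" for n \<theta> s
    using continuous_slice[OF continuous_picard[OF z, of n], of \<theta>] by (auto intro: continuous_on_subset)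
  have bound: "1 + norm (picard z n \<theta> s) \<le> (1 + Z) * exp (G * (T - s))"
    if "norm \<theta> \<le> R" "s \<in> {T0..T}" for \<theta> s n
    using that(2)
  proof (induction n arbitrary: s)
    case 0
    have "1 + norm (z \<theta>) \<le> (1 + Z) * 1" using Z[OF that(1)] by simp
    also have "\<dots> \<le> (1 + Z) * exp (G * (T - s))"
      using 0 Z[OF that(1)] norm_ge_zero[of "z \<theta>"] by (intro mult_left_mono) (auto simp: G_def simp del: norm_ge_zero)
    finally show ?case by simp
  next
    case (Suc n)
    have "norm (integral {s..T} (\<lambda>r. f \<theta> (picard z n \<theta> r) r)) \<le> integral {s..T} (\<lambda>r. G * (1 + norm (picard z n \<theta> r)))"
      using Suc.prems that(1) cp
      by (intro integral_norm_bound_integral integrable G integrable_continuous_interval continuous_intros) auto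
    also have "\<dots> \<le> G * (1 + Z) / G * (exp (G * (T - s)) - 1)"
    proof (rule integral_le_exp)
      fix r assume "r \<in> {s..T}"
      then have "1 + norm (picard z n \<theta> r) \<le> (1 + Z) * exp (G * (T - r))"
        using Suc by auto
      then show "G * (1 + norm (picard z n \<theta> r)) \<le> G * (1 + Z) * exp (G * (T - r))"
        using mult_left_mono[of "1 + norm (picard z n \<theta> r)" _ G] by (simp add: G_def mult.assoc)
    qed (use Suc.prems cp in \<open>auto intro!: integrable_continuous_interval continuous_intros simp: G_def\<close>)
    also have "\<dots> = (1 + Z) * exp (G * (T - s)) - (1 + Z)"
      using G_def by (simp add: right_diff_distrib)
    finally have "norm (integral {s..T} (\<lambda>r. f \<theta> (picard z n \<theta> r) r)) \<le> (1 + Z) * exp (G * (T - s)) - (1 + Z)" .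
    with Z[OF that(1)] show ?case
      using norm_triangle_ineq4[of "z \<theta>" "integral {s..T} (\<lambda>r. f \<theta> (picard z n \<theta> r) r)"] by simp
  qed
  have D: "norm (picard z n \<theta> s) \<le> D" if "norm \<theta> \<le> R" "s \<in> {T0..T}" for \<theta> s n
  proof -
    have "norm (picard z n \<theta> s) \<le> (1 + Z) * exp (G * (T - s))" using bound[OF that, of n] by simp
    also have "\<dots> \<le> D" unfolding D_def using that(2)
      by (intro mult_mono) (auto simp: G_def intro!: mult_left_mono)
    finally show ?thesis .
  qed
  obtain L0 where L0: "\<And>\<theta> z z' s. s \<in> {T0..T} \<Longrightarrow> norm \<theta> \<le> max R D \<Longrightarrow> norm z \<le> max R D \<Longrightarrow> norm z' \<le> max R D
      \<Longrightarrow> norm (f \<theta> z s - f \<theta> z' s) \<le> L0 * norm (z - z')"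
    using lipschitz[where R = "max R D" and ?T0.0 = T0] by metis
  define L where "L = max L0 1"
  have L: "norm (f \<theta> z s - f \<theta> z' s) \<le> L * norm (z - z')"
    if "s \<in> {T0..T}" "norm \<theta> \<le> R" "norm z \<le> D" "norm z' \<le> D" for \<theta> z z' s
    using L0[of s \<theta> z z'] that mult_right_mono[of L0 L "norm (z - z')"] by (force simp: L_def)
  define B where "B = 2 * \<bar>D\<bar> * exp (2 * L * \<bar>T - T0\<bar>)"
  have diff: "norm (picard z (Suc n) \<theta> s - picard z n \<theta> s) \<le> 2 * \<bar>D\<bar> * (1/2) ^ n * exp (2 * L * (T - s))"
    if "norm \<theta> \<le> R" "s \<in> {T0..T}" for \<theta> s n
    using that(2)
  proof (induction n arbitrary: s)
    case 0
    have "norm (picard z (Suc 0) \<theta> s - picard z 0 \<theta> s) \<le> 2 * \<bar>D\<bar> * 1"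
      using D[OF that(1) 0, of 0] D[OF that(1) 0, of "Suc 0"]
        norm_triangle_ineq4[of "picard z (Suc 0) \<theta> s" "picard z 0 \<theta> s"] by (simp del: picard.simps)
    also have "\<dots> \<le> 2 * \<bar>D\<bar> * exp (2 * L * (T - s))"
      using 0 by (intro mult_left_mono) (auto simp: L_def)
    finally show ?case by (simp del: picard.simps)
  next
    case (Suc n)
    let ?p = "\<lambda>n r. picard z n \<theta> r"
    have "norm (?p (Suc (Suc n)) s - ?p (Suc n) s)
        = norm (integral {s..T} (\<lambda>r. f \<theta> (?p n r) r) - integral {s..T} (\<lambda>r. f \<theta> (?p (Suc n) r) r))"
      by simp
    also have "\<dots> = norm (integral {s..T} (\<lambda>r. f \<theta> (?p n r) r - f \<theta> (?p (Suc n) r) r))"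
      by (subst Henstock_Kurzweil_Integration.integral_diff[OF integrable integrable]) simp
    also have "\<dots> \<le> integral {s..T} (\<lambda>r. L * norm (?p n r - ?p (Suc n) r))"
      using Suc.prems that(1) cp
      by (intro integral_norm_bound_integral integrable_diff integrable L D integrable_continuous_interval continuous_intros)
        (auto simp del: picard.simps)
    also have "\<dots> \<le> L * (2 * \<bar>D\<bar> * (1/2) ^ n) / (2 * L) * (exp (2 * L * (T - s)) - 1)"
    proof (rule integral_le_exp)
      fix r assume "r \<in> {s..T}"
      then have "norm (?p n r - ?p (Suc n) r) \<le> 2 * \<bar>D\<bar> * (1/2) ^ n * exp (2 * L * (T - r))"
        using Suc.IH[of r] Suc.prems by (simp add: norm_minus_commute del: picard.simps)
      then show "L * norm (?p n r - ?p (Suc n) r) \<le> L * (2 * \<bar>D\<bar> * (1/2) ^ n) * exp (2 * L * (T - r))"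
        using mult_left_mono[of "norm (?p n r - ?p (Suc n) r)" _ L] by (simp add: L_def mult.assoc del: picard.simps)
    qed (use Suc.prems cp in \<open>auto intro!: integrable_continuous_interval continuous_intros simp: L_def simp del: picard.simps\<close>)
    also have "\<dots> = 2 * \<bar>D\<bar> * (1/2) ^ Suc n * (exp (2 * L * (T - s)) - 1)"
      by (simp add: L_def field_simps)
    also have "\<dots> \<le> 2 * \<bar>D\<bar> * (1/2) ^ Suc n * exp (2 * L * (T - s))"
      by (intro mult_left_mono) auto
    finally show ?case .
  qed
  have "norm (picard z (Suc n) \<theta> s - picard z n \<theta> s) \<le> B * (1/2) ^ n" if "norm \<theta> \<le> R" "s \<in> {T0..T}" for \<theta> s n
  proof -
    have "2 * \<bar>D\<bar> * (1/2) ^ n * exp (2 * L * (T - s)) \<le> 2 * \<bar>D\<bar> * (1/2) ^ n * exp (2 * L * \<bar>T - T0\<bar>)"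
      using that(2) by (intro mult_left_mono) (auto simp: L_def intro!: mult_left_mono)
    with diff[OF that, of n] show ?thesis by (simp add: B_def mult_ac del: picard.simps)
  qed
  with D show ?thesis by blast
qed

text \<open>The iterates are jointly continuous and converge uniformly on compact sets of parameters and times,
so the same limit gives existence and joint continuity.\<close>
theorem flow_exists:
  assumes z: "continuous_on UNIV z"
  shows "\<exists>\<Phi>. continuous_on (UNIV \<times> {..T}) (\<lambda>(\<theta>, s). \<Phi> \<theta> s) \<and>
    (\<forall>\<theta>. \<Phi> \<theta> T = z \<theta> \<and> (\<forall>s\<le>T. (\<Phi> \<theta> has_vector_derivative f \<theta> (\<Phi> \<theta> s) s) (at s within {..T})))"
proof -
  define \<Phi> where "\<Phi> \<theta> s = lim (\<lambda>n. picard z n \<theta> s)" for \<theta> s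
  have unif: "uniform_limit (cball 0 R \<times> {T0..T}) (\<lambda>n (\<theta>, s). picard z n \<theta> s) (\<lambda>(\<theta>, s). \<Phi> \<theta> s) sequentially" for R T0
  proof -
    obtain B where "\<And>\<theta> s n. norm \<theta> \<le> R \<Longrightarrow> s \<in> {T0..T} \<Longrightarrow>
        norm (picard z (Suc n) \<theta> s - picard z n \<theta> s) \<le> B * (1/2) ^ n"
      using picard_geometric[OF z, of R T0] by blast
    then have "uniform_limit (cball 0 R \<times> {T0..T}) (\<lambda>n (\<theta>, s). picard z n \<theta> s)
        (\<lambda>x. lim (\<lambda>n. (\<lambda>(\<theta>, s). picard z n \<theta> s) x)) sequentially"
      by (intro uniform_limitI_geometric[where B = B]) (auto simp del: picard.simps)
    then show ?thesis by (simp add: \<Phi>_def case_prod_unfold)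
  qed
  have c\<Phi>: "continuous_on (UNIV \<times> {..T}) (\<lambda>(\<theta>, s). \<Phi> \<theta> s)"
    unfolding continuous_on_eq_continuous_within
  proof
    fix x :: "'p \<times> real" assume x: "x \<in> UNIV \<times> {..T}"
    define R where "R = norm (fst x) + 1"
    define T0 where "T0 = snd x - 1"
    have "continuous_on (cball 0 R \<times> {T0..T}) (\<lambda>(\<theta>, s). \<Phi> \<theta> s)"
      by (intro uniform_limit_theorem[OF _ unif] always_eventually allI continuous_on_subset[OF continuous_picard[OF z]]) auto
    then have "continuous (at x within cball 0 R \<times> {T0..T}) (\<lambda>(\<theta>, s). \<Phi> \<theta> s)"
      using x by (auto simp: continuous_on_eq_continuous_within R_def T0_def)
    moreover have "at x within cball 0 R \<times> {T0..T} = at x within UNIV \<times> {..T}"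
    proof (rule at_within_nhd)
      show "x \<in> ball 0 R \<times> {T0<..}" by (cases x) (auto simp: R_def T0_def)
    qed (auto intro!: open_Times)
    ultimately show "continuous (at x within UNIV \<times> {..T}) (\<lambda>(\<theta>, s). \<Phi> \<theta> s)" by simp
  qed
  have eq: "\<Phi> \<theta> s = z \<theta> - integral {s..T} (\<lambda>r. f \<theta> (\<Phi> \<theta> r) r)" if "s \<le> T" for \<theta> s
  proof -
    have u1: "uniform_limit {s..T} (\<lambda>n. picard z n \<theta>) (\<Phi> \<theta>) sequentially"
    proof -
      have "{\<theta>} \<times> {s..T} \<subseteq> cball 0 (norm \<theta>) \<times> {s..T}" by auto
      from uniform_limit_on_subset[OF unif this] show ?thesis by (simp add: uniform_limit_iff)
    qed
    obtain D where D: "\<And>r n. r \<in> {s..T} \<Longrightarrow> norm (picard z n \<theta> r) \<le> D"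
      using picard_geometric[OF z, of "norm \<theta>" s] by blast
    have lim: "(\<lambda>n. picard z n \<theta> r) \<longlonglongrightarrow> \<Phi> \<theta> r" if "r \<in> {s..T}" for r
      using tendsto_uniform_limitI[OF u1 that] .
    have D\<Phi>: "norm (\<Phi> \<theta> r) \<le> D" if "r \<in> {s..T}" for r
      using D[OF that] by (intro Lim_norm_ubound[OF _ lim[OF that]]) (auto intro!: always_eventually)
    obtain L0 where L0: "\<And>z z' r. r \<in> {s..T} \<Longrightarrow> norm z \<le> D \<Longrightarrow> norm z' \<le> D
        \<Longrightarrow> norm (f \<theta> z r - f \<theta> z' r) \<le> L0 * norm (z - z')"
      using lipschitz[where R = "max (norm \<theta>) D" and ?T0.0 = s] by (metis max.coboundedI1 max.coboundedI2 order_refl)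
    define L where "L = \<bar>L0\<bar> + 1"
    have L: "norm (f \<theta> z r - f \<theta> z' r) \<le> L * norm (z - z')"
      if "r \<in> {s..T}" "norm z \<le> D" "norm z' \<le> D" for z z' r
      using L0[OF that] mult_right_mono[of L0 L "norm (z - z')"] by (force simp: L_def)
    have u2: "uniform_limit {s..T} (\<lambda>n r. f \<theta> (picard z n \<theta> r) r) (\<lambda>r. f \<theta> (\<Phi> \<theta> r) r) sequentially"
    proof (rule uniform_limitI)
      fix e :: real assume "e > 0"
      then have "e / L > 0" by (simp add: L_def)
      from uniform_limitD[OF u1 this]
      show "\<forall>\<^sub>F n in sequentially. \<forall>r\<in>{s..T}. dist (f \<theta> (picard z n \<theta> r) r) (f \<theta> (\<Phi> \<theta> r) r) < e"
      proof eventually_elim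
        case (elim n)
        show ?case
        proof
          fix r assume r: "r \<in> {s..T}"
          have "L * dist (picard z n \<theta> r) (\<Phi> \<theta> r) < e"
            using elim r by (auto simp: L_def field_simps)
          then show "dist (f \<theta> (picard z n \<theta> r) r) (f \<theta> (\<Phi> \<theta> r) r) < e"
            using L[OF r D[OF r] D\<Phi>[OF r], of n] by (simp add: dist_norm)
        qed
      qed
    qed
    have cn: "continuous_on {s..T} (\<lambda>r. f \<theta> (picard z n \<theta> r) r)" for n
      using continuous_slice[OF continuous_picard[OF z, of n], of \<theta>]
      by (intro continuous_along_path) (auto intro: continuous_on_subset)
    obtain I J where I: "\<And>n. ((\<lambda>r. f \<theta> (picard z n \<theta> r) r) has_integral I n) {s..T}"
      and J: "((\<lambda>r. f \<theta> (\<Phi> \<theta> r) r) has_integral J) {s..T}" and IJ: "I \<longlonglongrightarrow> J"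
      by (rule uniform_limit_integral[OF u2 cn]) auto
    have "(\<lambda>n. picard z (Suc n) \<theta> s) \<longlonglongrightarrow> z \<theta> - J"
      by (simp add: integral_unique[OF I]) (intro tendsto_intros IJ)
    moreover have "(\<lambda>n. picard z (Suc n) \<theta> s) \<longlonglongrightarrow> \<Phi> \<theta> s"
      using lim[of s] that by (intro LIMSEQ_Suc) auto
    ultimately show ?thesis using J by (metis LIMSEQ_unique integral_unique)
  qed
  have "(\<Phi> \<theta> has_vector_derivative f \<theta> (\<Phi> \<theta> s) s) (at s within {..T})" if "s \<le> T" for \<theta> s
  proof -
    have "((\<lambda>s. z \<theta> - integral {s..T} (\<lambda>r. f \<theta> (\<Phi> \<theta> r) r)) has_vector_derivative 0 - - f \<theta> (\<Phi> \<theta> s) s) (at s within {..T})"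
      by (intro has_vector_derivative_diff integral_upper_has_vector_derivative
        continuous_slice[OF continuous_along[OF c\<Phi>]] that) auto
    then show ?thesis
      using that eq by (intro has_vector_derivative_transform[of s _ "\<Phi> \<theta>"]) auto
  qed
  moreover have "\<Phi> \<theta> T = z \<theta>" for \<theta> using eq[of T] by simp
  ultimately show ?thesis using c\<Phi> by blast
qed

text \<open>The maximum of the difference of two solutions in the weight \<open>exp (- 2 * L * (T - r))\<close> is at most
half of itself, hence zero.\<close>
theorem solution_unique:
  assumes u: "\<And>s. s \<in> {t..T} \<Longrightarrow> (u has_vector_derivative f \<theta> (u s) s) (at s within {t..T})"
    and v: "\<And>s. s \<in> {t..T} \<Longrightarrow> (v has_vector_derivative f \<theta> (v s) s) (at s within {t..T})"
    and "u T = v T" "s \<in> {t..T}"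
  shows "u s = v s"
proof -
  have cu: "continuous_on {t..T} u" and cv: "continuous_on {t..T} v"
    using has_vector_derivative_continuous[OF u] has_vector_derivative_continuous[OF v]
    by (auto simp: continuous_on_eq_continuous_within)
  have "bounded (u ` {t..T} \<union> v ` {t..T})"
    using cu cv by (auto intro!: compact_imp_bounded compact_continuous_image)
  then obtain D where D: "\<And>r. r \<in> {t..T} \<Longrightarrow> norm (u r) \<le> D \<and> norm (v r) \<le> D"
    unfolding bounded_iff by (meson UnI1 UnI2 imageI)
  obtain L0 where L0: "\<And>z z' r. r \<in> {t..T} \<Longrightarrow> norm z \<le> D \<Longrightarrow> norm z' \<le> D
      \<Longrightarrow> norm (f \<theta> z r - f \<theta> z' r) \<le> L0 * norm (z - z')"
    using lipschitz[where R = "max (norm \<theta>) D" and ?T0.0 = t] by (metis max.coboundedI1 max.coboundedI2 order_refl)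
  define L where "L = \<bar>L0\<bar> + 1"
  have L: "norm (f \<theta> z r - f \<theta> z' r) \<le> L * norm (z - z')"
    if "r \<in> {t..T}" "norm z \<le> D" "norm z' \<le> D" for z z' r
    using L0[OF that] mult_right_mono[of L0 L "norm (z - z')"] by (force simp: L_def)
  define \<phi> where "\<phi> r = norm (u r - v r) * exp (- (2 * L * (T - r)))" for r
  have "continuous_on {t..T} \<phi>" unfolding \<phi>_def by (intro continuous_intros cu cv)
  then obtain r0 where r0: "r0 \<in> {t..T}" and max: "\<And>r. r \<in> {t..T} \<Longrightarrow> \<phi> r \<le> \<phi> r0"
    using continuous_attains_sup[of "{t..T}" \<phi>] assms(4) by fastforce
  have le: "norm (u r - v r) \<le> \<phi> r0 * exp (2 * L * (T - r))" if "r \<in> {t..T}" for r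
  proof -
    have "norm (u r - v r) = \<phi> r * exp (2 * L * (T - r))" by (simp add: \<phi>_def mult.assoc flip: exp_add)
    with mult_right_mono[OF max[OF that], of "exp (2 * L * (T - r))"] show ?thesis by simp
  qed
  have rep: "(\<lambda>r. f \<theta> (w r) r) integrable_on {r0..T} \<and> integral {r0..T} (\<lambda>r. f \<theta> (w r) r) = w T - w r0"
    if w: "\<And>s. s \<in> {t..T} \<Longrightarrow> (w has_vector_derivative f \<theta> (w s) s) (at s within {t..T})" for w
  proof -
    have "((\<lambda>r. f \<theta> (w r) r) has_integral w T - w r0) {r0..T}"
      using r0 by (intro fundamental_theorem_of_calculus has_vector_derivative_within_subset[OF w]) auto
    then show ?thesis by (auto simp: integral_unique)
  qed
  have "v r0 - u r0 = integral {r0..T} (\<lambda>r. f \<theta> (u r) r - f \<theta> (v r) r)"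
    using rep[OF u] rep[OF v] assms(3) by (simp add: Henstock_Kurzweil_Integration.integral_diff)
  then have "norm (u r0 - v r0) = norm (integral {r0..T} (\<lambda>r. f \<theta> (u r) r - f \<theta> (v r) r))"
    by (metis norm_minus_commute)
  also have "\<dots> \<le> integral {r0..T} (\<lambda>r. L * norm (u r - v r))"
    using rep[OF u] rep[OF v] D r0
    by (intro integral_norm_bound_integral integrable_diff L integrable_continuous_interval continuous_intros continuous_along_path
        continuous_on_subset[OF cu] continuous_on_subset[OF cv]) auto
  also have "\<dots> \<le> L * \<phi> r0 / (2 * L) * (exp (2 * L * (T - r0)) - 1)"
    using le r0
    by (intro integral_le_exp) (auto simp: L_def mult.assoc intro!: mult_left_mono integrable_continuous_interval continuous_intros
        continuous_on_subset[OF cu] continuous_on_subset[OF cv])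
  also have "\<dots> \<le> \<phi> r0 / 2 * exp (2 * L * (T - r0))"
    by (auto simp: L_def \<phi>_def field_simps)
  also have "\<dots> = norm (u r0 - v r0) / 2"
    by (simp add: \<phi>_def exp_minus)
  finally have "\<phi> r0 = 0" by (simp add: \<phi>_def)
  with le[OF assms(4)] show ?thesis by simp
qed

end

section \<open>Square integrable controls\<close>

lemma square_integrable_mult:
  assumes "square_integrable_on f {t..T}" "square_integrable_on g {t..T}"
  shows "integrable (lebesgue_on {t..T}) (\<lambda>s. f s * g s)"
proof (rule Bochner_Integration.integrable_bound)
  show "integrable (lebesgue_on {t..T}) (\<lambda>s. (f s)\<^sup>2 + (g s)\<^sup>2)"
    using assms by (intro Bochner_Integration.integrable_add) (simp_all add: square_integrable_on_def)
  have "norm (x * y) \<le> norm (x\<^sup>2 + y\<^sup>2)" for x y :: real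
  proof -
    have "2 * \<bar>x\<bar> * \<bar>y\<bar> \<le> x\<^sup>2 + y\<^sup>2" using sum_squares_bound[of "\<bar>x\<bar>" "\<bar>y\<bar>"] by simp
    moreover have "0 \<le> \<bar>x\<bar> * \<bar>y\<bar>" by simp
    ultimately show ?thesis unfolding real_norm_def abs_mult by linarith
  qed
  then show "AE s in lebesgue_on {t..T}. norm (f s * g s) \<le> norm ((f s)\<^sup>2 + (g s)\<^sup>2)"
    by (intro AE_I2) blast
  show "(\<lambda>s. f s * g s) \<in> borel_measurable (lebesgue_on {t..T})"
    using assms by (simp add: square_integrable_on_def borel_measurable_times)
qed

lemma square_integrable_continuous:
  "continuous_on {t..T} f \<Longrightarrow> square_integrable_on f {t..T}"
  unfolding square_integrable_on_def
  by (intro conjI continuous_imp_integrable_real continuous_intros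
      borel_measurable_integrable[OF continuous_imp_integrable_real])

lemma square_integrable_imp_integrable:
  assumes "square_integrable_on f {t..T}"
  shows "integrable (lebesgue_on {t..T}) f"
  using square_integrable_mult[OF assms square_integrable_continuous[of t T "\<lambda>_. 1"]] by simp

lemma square_integrable_combination:
  assumes "square_integrable_on f {t..T}" "square_integrable_on g {t..T}"
  shows "square_integrable_on (\<lambda>s. c * f s + d * g s) {t..T}"
proof -
  have "(\<lambda>s. (c * f s + d * g s)\<^sup>2) = (\<lambda>s. c\<^sup>2 * (f s)\<^sup>2 + d\<^sup>2 * (g s)\<^sup>2 + 2 * c * d * (f s * g s))"
    by (auto simp: power2_eq_square algebra_simps)
  with assms square_integrable_mult[OF assms] show ?thesis
    by (auto simp: square_integrable_on_def)
qed

lemma square_integrable_diff: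
  assumes "square_integrable_on f {t..T}" "square_integrable_on g {t..T}"
  shows "square_integrable_on (\<lambda>s. f s - g s) {t..T}"
  using square_integrable_combination[OF assms, of 1 "-1"] by simp

lemma square_integrable_positive_part:
  assumes "square_integrable_on f {t..T}"
  shows "square_integrable_on (\<lambda>s. max 0 (f s)) {t..T}"
proof -
  have m: "(\<lambda>s. max 0 (f s)) \<in> borel_measurable (lebesgue_on {t..T})"
    using assms by (auto simp: square_integrable_on_def)
  have "integrable (lebesgue_on {t..T}) (\<lambda>s. (max 0 (f s))\<^sup>2)"
    by (rule Bochner_Integration.integrable_bound[of _ "\<lambda>s. (f s)\<^sup>2"])
      (use assms m in \<open>auto simp: square_integrable_on_def max_def\<close>)
  with m show ?thesis by (simp add: square_integrable_on_def)
qed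

lemma continuous_path_from:
  assumes "integrable (lebesgue_on {t..T}) f"
  shows "continuous_on {t..T} (path_from y t f)"
  unfolding path_from_def by (intro continuous_intros indefinite_integral_continuous_real assms)

lemma path_from_start [simp]: "path_from y t f t = y"
proof -
  have "(LINT r|lebesgue_on {t..t}. f r) = 0"
    by (rule integral_eq_zero_null_sets) (simp flip: negligible_iff_null_sets)
  then show ?thesis by (simp add: path_from_def)
qed

lemma path_from_diff:
  assumes "integrable (lebesgue_on {t..T}) f" "t \<le> r" "r \<le> s" "s \<le> T"
  shows "path_from y t f s - path_from y t f r = (LINT \<sigma>|lebesgue_on {r..s}. f \<sigma>)"
proof -
  have "integrable (lebesgue_on {t..s}) f"
    using assms by (intro integrable_subinterval[OF assms(1)]) auto
  from integral_combine[OF this assms(2,3)] show ?thesis by (simp add: path_from_def)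
qed

lemma path_from_combination:
  assumes "integrable (lebesgue_on {t..T}) f" "integrable (lebesgue_on {t..T}) g" "s \<in> {t..T}"
  shows "path_from (c * y + d * z) t (\<lambda>s. c * f s + d * g s) s = c * path_from y t f s + d * path_from z t g s"
proof -
  have "integrable (lebesgue_on {t..s}) f" "integrable (lebesgue_on {t..s}) g"
    using assms(3) by (auto intro!: integrable_subinterval[OF assms(1)] integrable_subinterval[OF assms(2)])
  then show ?thesis by (simp add: path_from_def algebra_simps)
qed

lemma path_from_derivative:
  assumes "\<And>s. s \<in> {t..T} \<Longrightarrow> (Y has_real_derivative f s) (at s within {t..T})"
    and "continuous_on {t..T} f" "s \<in> {t..T}"
  shows "path_from (Y t) t f s = Y s"
proof -
  have c: "continuous_on {t..s} f" using assms(2,3) by (auto intro: continuous_on_subset)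
  have "(f has_integral Y s - Y t) {t..s}"
    using assms(3)
    by (intro fundamental_theorem_of_calculus)
      (auto simp: has_real_derivative_iff_has_vector_derivative[symmetric] intro!: DERIV_subset[OF assms(1)])
  then have "(LINT r|lebesgue_on {t..s}. f r) = Y s - Y t"
    by (subst lebesgue_integral_eq_integral) (auto simp: integral_unique continuous_imp_integrable_real[OF c])
  then show ?thesis by (simp add: path_from_def)
qed

section \<open>Initial value problems and comparison\<close>

text \<open>A function that starts nonpositive and, while nonnegative, grows at most at the rate \<open>A\<close> times itself
cannot become positive. The growth condition is an integral inequality because it is applied to
paths whose velocity is only square integrable.\<close>
lemma growth_barrier:
  fixes N :: "real \<Rightarrow> real"
  assumes cont: "continuous_on {t..T} N" and "N t \<le> 0" and "A \<ge> 0"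
    and growth: "\<And>r s. t \<le> r \<Longrightarrow> r \<le> s \<Longrightarrow> s \<le> T \<Longrightarrow> (\<And>\<sigma>. \<sigma> \<in> {r..s} \<Longrightarrow> N \<sigma> \<ge> 0) \<Longrightarrow>
      N s - N r \<le> A * (LINT \<sigma>|lebesgue_on {r..s}. N \<sigma>)"
    and "s \<in> {t..T}"
  shows "N s \<le> 0"
proof (rule ccontr)
  assume neg: "\<not> N s \<le> 0"
  define Z where "Z = {r \<in> {t..s}. N r \<le> 0}"
  have "closed Z"
  proof -
    have "Z = {t..s} \<inter> N -` {..0}" by (auto simp: Z_def)
    moreover have "closed ({t..s} \<inter> N -` {..0})"
      using assms(5) by (intro continuous_closed_preimage continuous_on_subset[OF cont]) auto
    ultimately show ?thesis by simp
  qed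
  moreover have "Z \<noteq> {}" "bdd_above Z" using assms(2,5) by (auto simp: Z_def)
  ultimately have rZ: "Sup Z \<in> Z" and up: "\<And>r. r \<in> Z \<Longrightarrow> r \<le> Sup Z"
    by (auto simp: closed_contains_Sup cSup_upper)
  define r where "r = Sup Z"
  have r: "t \<le> r" "r < s" "N r \<le> 0" using rZ neg by (auto simp: Z_def r_def less_le)
  have pos: "N \<sigma> > 0" if "\<sigma> \<in> {r<..s}" for \<sigma>
    using up[of \<sigma>] that r by (force simp: Z_def r_def)
  have "N r = 0"
  proof (rule ccontr)
    assume "N r \<noteq> 0"
    then have "N r < 0" using r by simp
    moreover have "continuous_on {r..s} N" using r assms(5) by (auto intro: continuous_on_subset[OF cont])
    ultimately obtain \<sigma> where "\<sigma> \<in> {r..s}" "N \<sigma> = N r / 2"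
      using IVT'[of N r "N r / 2" s] r neg by auto
    with pos[of \<sigma>] \<open>N r < 0\<close> show False by (cases "\<sigma> = r") auto
  qed
  \<comment> \<open>On an interval this short, the growth condition gives \<open>N v \<le> N v / 2\<close> at the maximum point \<open>v\<close>.\<close>
  define u where "u = min s (r + 1 / (2 * (A + 1)))"
  have u: "r < u" "u \<le> s" "u - r \<le> 1 / (2 * (A + 1))" using r \<open>A \<ge> 0\<close> by (auto simp: u_def min_def)
  obtain v where v: "v \<in> {r..u}" and vmax: "\<And>\<sigma>. \<sigma> \<in> {r..u} \<Longrightarrow> N \<sigma> \<le> N v"
    using continuous_attains_sup[of "{r..u}" N] u r assms(5) continuous_on_subset[OF cont, of "{r..u}"] by force
  have Nv: "N v > 0" using vmax[of u] pos[of u] u by force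
  have c: "continuous_on {r..v} N" using v u r assms(5) by (auto intro: continuous_on_subset[OF cont])
  have nonneg: "N \<sigma> \<ge> 0" if "\<sigma> \<in> {r..v}" for \<sigma>
    using pos[of \<sigma>] that \<open>N r = 0\<close> v u by (cases "\<sigma> = r") auto
  have "N v - N r \<le> A * (LINT \<sigma>|lebesgue_on {r..v}. N \<sigma>)"
    using v u r assms(5) by (intro growth nonneg) auto
  also have "(LINT \<sigma>|lebesgue_on {r..v}. N \<sigma>) \<le> (LINT \<sigma>|lebesgue_on {r..v}. N v)"
    using v by (intro integral_mono continuous_imp_integrable_real c vmax) auto
  also have "\<dots> = (v - r) * N v" using v by (simp add: measure_restrict_space)
  also have "(v - r) * N v \<le> 1 / (2 * (A + 1)) * N v"
    using v u Nv by (intro mult_right_mono) auto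
  finally have "N v \<le> A * (1 / (2 * (A + 1)) * N v)" using \<open>N r = 0\<close> \<open>A \<ge> 0\<close> by (simp add: mult_left_mono)
  also have "\<dots> < N v" using Nv \<open>A \<ge> 0\<close> by (simp add: divide_simps)
  finally show False by simp
qed

text \<open>Time reversal turns the initial value problem on \<open>{t..T}\<close> into a terminal value problem; before \<open>t\<close>
the reversed field is continued by its value at \<open>t\<close>.\<close>
lemma forward_ode_solution:
  fixes h :: "real \<Rightarrow> real \<Rightarrow> real"
  assumes cont: "continuous_on (UNIV \<times> {t..T}) (\<lambda>(z, s). h z s)"
    and lip: "\<And>z z' s. s \<in> {t..T} \<Longrightarrow> \<bar>h z s - h z' s\<bar> \<le> A * \<bar>z - z'\<bar>" and "t \<le> T"
  shows "\<exists>w. w t = w0 \<and> (\<forall>s\<in>{t..T}. (w has_real_derivative h (w s) s) (at s within {t..T}))"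
proof -
  define \<rho> where "\<rho> s = t + T - max s t" for s
  have \<rho>: "\<rho> s \<in> {t..T}" if "s \<le> T" for s using that \<open>t \<le> T\<close> by (auto simp: \<rho>_def)
  have cont\<rho>: "continuous_on S \<rho>" for S unfolding \<rho>_def by (intro continuous_intros)
  have "continuous_on {t..T} (\<lambda>s. (\<lambda>(z, s). h z s) (0, s))"
    by (intro continuous_on_compose2[OF cont]) (auto intro!: continuous_intros)
  then have "bounded ((\<lambda>s. h 0 s) ` {t..T})"
    by (intro compact_imp_bounded compact_continuous_image) auto
  then obtain H where H: "\<And>s. s \<in> {t..T} \<Longrightarrow> \<bar>h 0 s\<bar> \<le> H"
    unfolding bounded_iff by (metis imageI real_norm_def)
  interpret terminal_ode "\<lambda>(\<theta>::real) z s. - h z (\<rho> s)" T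
  proof
    have "continuous_on (UNIV \<times> UNIV \<times> {..T}) (\<lambda>x::real \<times> real \<times> real. - (\<lambda>(z, s). h z s) (fst (snd x), \<rho> (snd (snd x))))"
      by (intro continuous_intros continuous_on_compose2[OF cont] continuous_on_compose2[OF cont\<rho>[of UNIV]])
        (auto intro!: \<rho>[simplified])
    then show "continuous_on (UNIV \<times> UNIV \<times> {..T}) (\<lambda>(\<theta>::real, z, s). - h z (\<rho> s))"
      by (simp add: case_prod_unfold)
  next
    fix R T0 :: real
    have "norm (- h z (\<rho> s)) \<le> (\<bar>A\<bar> + \<bar>H\<bar>) * (1 + norm z)" if "s \<in> {T0..T}" for z s
    proof -
      have "\<bar>h z (\<rho> s)\<bar> \<le> \<bar>h 0 (\<rho> s)\<bar> + A * \<bar>z\<bar>"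
        using lip[OF \<rho>, of s z 0] that by auto
      also have "\<dots> \<le> \<bar>H\<bar> + \<bar>A\<bar> * \<bar>z\<bar>"
        using H[OF \<rho>, of s] that by (intro add_mono mult_right_mono) auto
      also have "\<dots> \<le> (\<bar>A\<bar> + \<bar>H\<bar>) * (1 + \<bar>z\<bar>)" by (simp add: algebra_simps)
      finally show ?thesis by simp
    qed
    then show "\<exists>G. \<forall>\<theta>::real. \<forall>z. \<forall>s\<in>{T0..T}. norm \<theta> \<le> R \<longrightarrow> norm (- h z (\<rho> s)) \<le> G * (1 + norm z)"
      by blast
    show "\<exists>L. \<forall>\<theta>::real. \<forall>z z'. \<forall>s\<in>{T0..T}. norm \<theta> \<le> R \<longrightarrow> norm z \<le> R \<longrightarrow> norm z' \<le> R \<longrightarrow>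
        norm (- h z (\<rho> s) - - h z' (\<rho> s)) \<le> L * norm (z - z')"
      using lip[OF \<rho>] by (intro exI[of _ A]) (auto simp: abs_minus_commute)
  qed
  obtain \<Phi> :: "real \<Rightarrow> real \<Rightarrow> real" where \<Phi>T: "\<Phi> 0 T = w0"
    and \<Phi>: "\<And>s. s \<le> T \<Longrightarrow> (\<Phi> 0 has_vector_derivative - h (\<Phi> 0 s) (\<rho> s)) (at s within {..T})"
    using flow_exists[of "\<lambda>_. w0"] by auto
  define w where "w s = \<Phi> 0 (t + T - s)" for s
  have "(w has_real_derivative h (w s) s) (at s within {t..T})" if "s \<in> {t..T}" for s
  proof -
    have "(\<Phi> 0 has_real_derivative - h (\<Phi> 0 (t + T - s)) (\<rho> (t + T - s))) (at (t + T - s) within (\<lambda>s. t + T - s) ` {t..T})"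
      using \<Phi>[of "t + T - s"] that
      by (auto simp: has_real_derivative_iff_has_vector_derivative intro: has_vector_derivative_within_subset)
    moreover have "((\<lambda>s. t + T - s) has_real_derivative -1) (at s within {t..T})"
      by (auto intro!: derivative_eq_intros)
    ultimately have "(\<Phi> 0 \<circ> (\<lambda>s. t + T - s) has_real_derivative - h (\<Phi> 0 (t + T - s)) (\<rho> (t + T - s)) * -1) (at s within {t..T})"
      by (rule DERIV_image_chain)
    with that show ?thesis by (simp add: w_def[abs_def] o_def \<rho>_def)
  qed
  moreover have "w t = w0" using \<Phi>T by (simp add: w_def)
  ultimately show ?thesis by blast
qed

section \<open>Convexity of the minimal action\<close>

lemma square_convex_combination_le:
  fixes u v x y :: real
  assumes "u \<ge> 0" "v \<ge> 0" "u + v = 1"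
  shows "(u * x + v * y)\<^sup>2 \<le> u * x\<^sup>2 + v * y\<^sup>2"
proof -
  have v: "v = 1 - u" using assms by simp
  have "u * x\<^sup>2 + v * y\<^sup>2 - (u * x + v * y)\<^sup>2 = u * v * (x - y)\<^sup>2"
    unfolding v by (simp add: power2_eq_square algebra_simps)
  moreover have "u * v * (x - y)\<^sup>2 \<ge> 0" using assms by simp
  ultimately show ?thesis by linarith
qed

locale concave_drift =
  fixes b b1 :: "real \<Rightarrow> real \<Rightarrow> real" and T A :: real
  assumes cont_b: "continuous_on (UNIV \<times> {..T}) (\<lambda>(y, s). b y s)"
    and deriv_b: "\<And>y s. s \<le> T \<Longrightarrow> ((\<lambda>y. b y s) has_real_derivative b1 y s) (at y)"
    and cont_b1: "continuous_on (UNIV \<times> {..T}) (\<lambda>(y, s). b1 y s)"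
    and bound_b1: "\<And>y s. s \<le> T \<Longrightarrow> \<bar>b1 y s\<bar> \<le> A"
    and concave_b: "\<And>s. s \<le> T \<Longrightarrow> concave_on UNIV (\<lambda>y. b y s)"
begin

lemma A_nonneg: "A \<ge> 0"
  using bound_b1[of T 0] by simp

lemma b_lipschitz:
  assumes "s \<le> T"
  shows "\<bar>b y s - b z s\<bar> \<le> A * \<bar>y - z\<bar>"
proof -
  have "norm (b y s - b z s) \<le> A * norm (y - z)"
    by (rule field_differentiable_bound[of UNIV "\<lambda>y. b y s" "\<lambda>y. b1 y s"])
      (use assms deriv_b bound_b1 in auto)
  then show ?thesis by simp
qed

lemma b_tangent:
  assumes "s \<le> T"
  shows "b y s \<le> b z s + b1 z s * (y - z)"
proof -
  have "- b1 z s * (y - z) \<le> - b y s - - b z s"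
    using concave_b[OF assms] deriv_b[OF assms, of z]
    by (intro convex_on_imp_above_tangent[where A = UNIV]) (auto simp: concave_on_def intro!: derivative_intros)
  then show ?thesis by simp
qed

lemma continuous_b_along:
  assumes "continuous_on {t..T} Y"
  shows "continuous_on {t..T} (\<lambda>s. b (Y s) s)"
proof -
  have "continuous_on {t..T} (\<lambda>s. (\<lambda>(y, s). b y s) (Y s, s))"
    by (intro continuous_on_compose2[OF cont_b]) (auto intro!: continuous_intros assms)
  then show ?thesis by simp
qed

lemma square_integrable_residual:
  assumes "square_integrable_on f {t..T}"
  shows "square_integrable_on (\<lambda>s. f s - b (path_from y t f s) s) {t..T}"
  by (intro square_integrable_diff assms square_integrable_continuous continuous_b_along
      continuous_path_from square_integrable_imp_integrable)

text \<open>Replacing the residual \<open>f - b\<close> of a path by its positive part does not lower the endpoint. The new path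
is \<open>w + G\<close>, where \<open>G\<close> is the integral of the positive part \<open>g\<close>, so that \<open>w\<close> solves an ordinary
differential equation with a continuous field although \<open>g\<close> is merely square integrable. The new
path stays above the old one since the drift is Lipschitz.\<close>
lemma positive_part_path:
  assumes f: "square_integrable_on f {t..T}" and "t \<le> T"
  shows "\<exists>k. square_integrable_on k {t..T} \<and> path_from y t k T \<ge> path_from y t f T \<and>
    action b T y t k = 1/2 * (LINT s|lebesgue_on {t..T}. (max 0 (f s - b (path_from y t f s) s))\<^sup>2)"
proof -
  define Y where "Y = path_from y t f"
  define g where "g s = max 0 (f s - b (Y s) s)" for s
  have g: "square_integrable_on g {t..T}"
    unfolding g_def Y_def by (intro square_integrable_positive_part square_integrable_residual f)
  have fi: "integrable (lebesgue_on {t..T}) f" and gi: "integrable (lebesgue_on {t..T}) g"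
    using f g by (auto intro: square_integrable_imp_integrable)
  define G where "G = path_from 0 t g"
  have cG: "continuous_on {t..T} G" unfolding G_def using gi by (rule continuous_path_from)
  have "continuous_on (UNIV \<times> {t..T}) (\<lambda>(z, s). b (z + G s) s)"
  proof -
    have "continuous_on (UNIV \<times> {t..T}) (\<lambda>x. (\<lambda>(y, s). b y s) (fst x + G (snd x), snd x))"
      by (intro continuous_on_compose2[OF cont_b])
        (auto intro!: continuous_intros continuous_on_compose2[OF cG])
    then show ?thesis by (simp add: case_prod_unfold)
  qed
  moreover have "\<bar>b (z + G s) s - b (z' + G s) s\<bar> \<le> A * \<bar>z - z'\<bar>" if "s \<in> {t..T}" for z z' s
    using b_lipschitz[of s "z + G s" "z' + G s"] that by simp
  ultimately have "\<exists>w. w t = y \<and> (\<forall>s\<in>{t..T}. (w has_real_derivative b (w s + G s) s) (at s within {t..T}))"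
    using \<open>t \<le> T\<close> by (rule forward_ode_solution)
  then obtain w where w0: "w t = y"
    and w: "\<And>s. s \<in> {t..T} \<Longrightarrow> (w has_real_derivative b (w s + G s) s) (at s within {t..T})"
    by blast
  have cw: "continuous_on {t..T} w" using w by (rule DERIV_continuous_on)
  define Z where "Z s = w s + G s" for s
  have cZ: "continuous_on {t..T} Z" unfolding Z_def by (intro continuous_intros cw cG)
  have cbZ: "continuous_on {t..T} (\<lambda>s. b (Z s) s)" by (rule continuous_b_along[OF cZ])
  define k where "k s = b (Z s) s + g s" for s
  have k: "square_integrable_on k {t..T}"
    using square_integrable_combination[OF square_integrable_continuous[OF cbZ] g, of 1 1]
    by (simp add: k_def[abs_def])
  have ki: "integrable (lebesgue_on {t..T}) k" using k by (rule square_integrable_imp_integrable)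
  have path_k: "path_from y t k s = Z s" if "s \<in> {t..T}" for s
  proof -
    have "path_from y t k s = path_from y t (\<lambda>s. b (Z s) s) s + G s"
      using path_from_combination[OF continuous_imp_integrable_real[OF cbZ] gi that, of 1 y 1 0]
      by (simp add: k_def[abs_def] G_def)
    also have "path_from y t (\<lambda>s. b (Z s) s) s = w s"
      using path_from_derivative[of t T w "\<lambda>s. b (Z s) s" s] w cbZ that by (simp add: w0 Z_def)
    finally show ?thesis by (simp add: Z_def)
  qed
  have cY: "continuous_on {t..T} Y" unfolding Y_def using fi by (rule continuous_path_from)
  have "Y s - Z s \<le> 0" if "s \<in> {t..T}" for s
  proof (rule growth_barrier[where A = A and N = "\<lambda>s. Y s - Z s"])
    show "continuous_on {t..T} (\<lambda>s. Y s - Z s)" by (intro continuous_intros cY cZ)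
    show "Y t - Z t \<le> 0" using path_k[of t] \<open>t \<le> T\<close> by (simp add: Y_def)
  next
    fix r s assume rs: "t \<le> r" "r \<le> s" "s \<le> T" and pos: "\<And>\<sigma>. \<sigma> \<in> {r..s} \<Longrightarrow> 0 \<le> Y \<sigma> - Z \<sigma>"
    have sub: "integrable (lebesgue_on {r..s}) f" "integrable (lebesgue_on {r..s}) k"
      using rs by (auto intro!: integrable_subinterval[OF fi] integrable_subinterval[OF ki])
    have "Y s - Z s - (Y r - Z r) = (Y s - Y r) - (path_from y t k s - path_from y t k r)"
      using rs by (simp add: path_k)
    also have "\<dots> = (LINT \<sigma>|lebesgue_on {r..s}. f \<sigma> - k \<sigma>)"
      using rs sub by (simp add: Y_def path_from_diff[OF fi] path_from_diff[OF ki])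
    also have "\<dots> \<le> (LINT \<sigma>|lebesgue_on {r..s}. A * (Y \<sigma> - Z \<sigma>))"
    proof (rule integral_mono)
      show "integrable (lebesgue_on {r..s}) (\<lambda>\<sigma>. A * (Y \<sigma> - Z \<sigma>))"
        using rs by (intro continuous_imp_integrable_real continuous_intros continuous_on_subset[OF cY]
          continuous_on_subset[OF cZ]) auto
    next
      fix \<sigma> assume "\<sigma> \<in> space (lebesgue_on {r..s})"
      then have \<sigma>: "\<sigma> \<in> {r..s}" by simp
      have "f \<sigma> - k \<sigma> \<le> b (Y \<sigma>) \<sigma> - b (Z \<sigma>) \<sigma>" by (simp add: k_def g_def)
      also have "\<dots> \<le> A * \<bar>Y \<sigma> - Z \<sigma>\<bar>"
        using b_lipschitz[of \<sigma> "Y \<sigma>" "Z \<sigma>"] \<sigma> rs by simp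
      finally show "f \<sigma> - k \<sigma> \<le> A * (Y \<sigma> - Z \<sigma>)" using pos[OF \<sigma>] by simp
    qed (use sub in auto)
    finally show "Y s - Z s - (Y r - Z r) \<le> A * (LINT \<sigma>|lebesgue_on {r..s}. Y \<sigma> - Z \<sigma>)" by simp
  qed (use A_nonneg that in auto)
  then have "path_from y t k T \<ge> path_from y t f T"
    using path_k[of T] \<open>t \<le> T\<close> by (auto simp: Y_def)
  moreover have "action b T y t k = 1/2 * (LINT s|lebesgue_on {t..T}. (g s)\<^sup>2)"
    unfolding action_def
    by (intro arg_cong2[where f = "(*)"] refl Bochner_Integration.integral_cong) (auto simp: path_k k_def)
  ultimately show ?thesis using k by (auto simp: g_def Y_def)
qed

definition admissible :: "real \<Rightarrow> real \<Rightarrow> real \<Rightarrow> (real \<Rightarrow> real) \<Rightarrow> bool" where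
  "admissible x y t f \<longleftrightarrow> square_integrable_on f {t..T} \<and> path_from y t f T \<ge> x"

lemma q_eq: "q b T x y t = Inf {action b T y t f | f. admissible x y t f}"
  by (simp add: q_def admissible_def)

lemma action_nonneg: "action b T y t f \<ge> 0"
  by (simp add: action_def)

lemma q_le_action:
  assumes "admissible x y t f"
  shows "q b T x y t \<le> action b T y t f"
  unfolding q_eq using assms action_nonneg by (intro cInf_lower bdd_belowI[of _ 0]) auto

lemma admissible_exists:
  assumes "t < T"
  shows "\<exists>f. admissible x y t f"
proof -
  have "path_from (y :: real) t (\<lambda>_. (x - y) / (T - t)) T = x"
    using assms by (simp add: path_from_def measure_restrict_space)
  then show ?thesis
    using square_integrable_continuous[of t T "\<lambda>_. (x - y) / (T - t)"] by (force simp: admissible_def)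
qed

lemma q_greatest:
  assumes "t < T" "\<And>f. admissible x y t f \<Longrightarrow> c \<le> action b T y t f"
  shows "c \<le> q b T x y t"
  unfolding q_eq using admissible_exists[OF assms(1)] assms(2) by (intro cInf_greatest) blast+

lemma action_less_q_plus:
  assumes "t < T" "e > 0"
  shows "\<exists>f. admissible x y t f \<and> action b T y t f < q b T x y t + e"
proof (rule ccontr)
  assume "\<not> ?thesis"
  then have "q b T x y t + e \<le> q b T x y t"
    by (intro q_greatest assms) force
  with assms show False by simp
qed

text \<open>By concavity of \<open>b\<close>, the residual of the averaged path is at most the average of the residuals. This
one-sided bound survives squaring only for the positive part, and that loses nothing because
the endpoint constraint is one-sided too.\<close>
lemma q_combination_le_action:
  assumes "t < T" and f1: "admissible x1 y1 t f1" and f2: "admissible x2 y2 t f2"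
    and uv: "u \<ge> 0" "v \<ge> 0" "u + v = 1"
  shows "q b T (u * x1 + v * x2) (u * y1 + v * y2) t \<le> u * action b T y1 t f1 + v * action b T y2 t f2"
proof -
  define f where "f s = u * f1 s + v * f2 s" for s
  have sq: "square_integrable_on f1 {t..T}" "square_integrable_on f2 {t..T}"
    using f1 f2 by (auto simp: admissible_def)
  have f: "square_integrable_on f {t..T}"
    unfolding f_def by (intro square_integrable_combination sq)
  define Y1 where "Y1 = path_from y1 t f1"
  define Y2 where "Y2 = path_from y2 t f2"
  define Y where "Y = path_from (u * y1 + v * y2) t f"
  have Y: "Y s = u * Y1 s + v * Y2 s" if "s \<in> {t..T}" for s
    unfolding Y_def Y1_def Y2_def f_def
    by (rule path_from_combination[OF sq[THEN square_integrable_imp_integrable] that])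
  obtain k where k: "square_integrable_on k {t..T}" "path_from (u * y1 + v * y2) t k T \<ge> Y T"
    and act: "action b T (u * y1 + v * y2) t k = 1/2 * (LINT s|lebesgue_on {t..T}. (max 0 (f s - b (Y s) s))\<^sup>2)"
    using positive_part_path[OF f, of "u * y1 + v * y2"] \<open>t < T\<close> by (auto simp: Y_def)
  have "Y T \<ge> u * x1 + v * x2"
    using Y[of T] f1 f2 uv \<open>t < T\<close>
    by (auto simp: admissible_def Y1_def Y2_def intro!: add_mono mult_left_mono)
  with k have "q b T (u * x1 + v * x2) (u * y1 + v * y2) t \<le> action b T (u * y1 + v * y2) t k"
    by (intro q_le_action) (auto simp: admissible_def)
  also have "\<dots> = 1/2 * (LINT s|lebesgue_on {t..T}. (max 0 (f s - b (Y s) s))\<^sup>2)" by (rule act)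
  also have "\<dots> \<le> 1/2 * (LINT s|lebesgue_on {t..T}. u * (f1 s - b (Y1 s) s)\<^sup>2 + v * (f2 s - b (Y2 s) s)\<^sup>2)"
  proof (intro mult_left_mono integral_mono)
    show "integrable (lebesgue_on {t..T}) (\<lambda>s. (max 0 (f s - b (Y s) s))\<^sup>2)"
      using square_integrable_positive_part[OF square_integrable_residual[OF f]]
      by (simp add: square_integrable_on_def Y_def)
    show "integrable (lebesgue_on {t..T}) (\<lambda>s. u * (f1 s - b (Y1 s) s)\<^sup>2 + v * (f2 s - b (Y2 s) s)\<^sup>2)"
      using square_integrable_residual[OF sq(1)] square_integrable_residual[OF sq(2)]
      by (simp add: square_integrable_on_def Y1_def Y2_def)
  next
    fix s assume "s \<in> space (lebesgue_on {t..T})"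
    then have s: "s \<in> {t..T}" by simp
    define r1 where "r1 = f1 s - b (Y1 s) s"
    define r2 where "r2 = f2 s - b (Y2 s) s"
    have "u * b (Y1 s) s + v * b (Y2 s) s \<le> b (Y s) s"
    proof -
      have "b ((1 - v) *\<^sub>R Y1 s + v *\<^sub>R Y2 s) s \<ge> (1 - v) * b (Y1 s) s + v * b (Y2 s) s"
        using concave_onD[OF concave_b[of s], of v "Y1 s" "Y2 s"] s uv by auto
      moreover have "u = 1 - v" using uv by simp
      ultimately show ?thesis using Y[OF s] by simp
    qed
    then have "f s - b (Y s) s \<le> u * r1 + v * r2"
      by (simp add: f_def r1_def r2_def algebra_simps)
    then have "(max 0 (f s - b (Y s) s))\<^sup>2 \<le> (u * r1 + v * r2)\<^sup>2"
      by (cases "f s - b (Y s) s \<ge> 0") (auto intro!: power_mono simp: max_def)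
    also have "\<dots> \<le> u * r1\<^sup>2 + v * r2\<^sup>2" by (rule square_convex_combination_le[OF uv])
    finally show "(max 0 (f s - b (Y s) s))\<^sup>2 \<le> u * (f1 s - b (Y1 s) s)\<^sup>2 + v * (f2 s - b (Y2 s) s)\<^sup>2"
      by (simp add: r1_def r2_def)
  qed simp
  also have "\<dots> = u * action b T y1 t f1 + v * action b T y2 t f2"
    using square_integrable_residual[OF sq(1), of y1] square_integrable_residual[OF sq(2), of y2]
    by (simp add: action_def square_integrable_on_def Y1_def Y2_def algebra_simps)
  finally show ?thesis .
qed

theorem q_convex:
  assumes "t < T"
  shows "convex_on UNIV (\<lambda>(x, y). q b T x y t)"
proof -
  have "q b T (u * x1 + v * x2) (u * y1 + v * y2) t \<le> u * q b T x1 y1 t + v * q b T x2 y2 t"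
    if uv: "u \<ge> 0" "v \<ge> 0" "u + v = 1" for u v x1 x2 y1 y2
  proof (rule field_le_epsilon)
    fix e :: real assume "e > 0"
    obtain f1 where f1: "admissible x1 y1 t f1" "action b T y1 t f1 < q b T x1 y1 t + e"
      using action_less_q_plus[OF \<open>t < T\<close> \<open>e > 0\<close>] by blast
    obtain f2 where f2: "admissible x2 y2 t f2" "action b T y2 t f2 < q b T x2 y2 t + e"
      using action_less_q_plus[OF \<open>t < T\<close> \<open>e > 0\<close>] by blast
    have "q b T (u * x1 + v * x2) (u * y1 + v * y2) t \<le> u * action b T y1 t f1 + v * action b T y2 t f2"
      by (rule q_combination_le_action[OF \<open>t < T\<close> f1(1) f2(1) uv])
    also have "\<dots> \<le> u * (q b T x1 y1 t + e) + v * (q b T x2 y2 t + e)"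
      using f1(2) f2(2) uv by (intro add_mono mult_left_mono) auto
    also have "\<dots> = u * q b T x1 y1 t + v * q b T x2 y2 t + (u + v) * e" by (simp add: algebra_simps)
    finally show "q b T (u * x1 + v * x2) (u * y1 + v * y2) t \<le> u * q b T x1 y1 t + v * q b T x2 y2 t + e"
      using uv by simp
  qed
  then show ?thesis by (auto simp: convex_on_def)
qed

end

section \<open>Mean slopes, barriers and cooperative linear systems\<close>

text \<open>The difference quotient of a function with derivative \<open>g'\<close>, in a form that is continuous across the
diagonal \<open>y = z\<close>.\<close>
definition mean_slope :: "(real \<Rightarrow> real \<Rightarrow> real) \<Rightarrow> real \<Rightarrow> real \<Rightarrow> real \<Rightarrow> real" where
  "mean_slope g' y z s = integral {0..1} (\<lambda>\<tau>. g' (z + \<tau> * (y - z)) s)"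

lemma continuous_mean_slope:
  fixes g' :: "real \<Rightarrow> real \<Rightarrow> real"
  assumes "continuous_on (UNIV \<times> {..T}) (\<lambda>(y, s). g' y s)"
  shows "continuous_on (UNIV \<times> UNIV \<times> {..T}) (\<lambda>(y, z, s). mean_slope g' y z s)"
proof -
  have "continuous_on ((UNIV \<times> UNIV \<times> {..T}) \<times> cbox 0 1)
      (\<lambda>x. (\<lambda>(y, s). g' y s) (fst (snd (fst x)) + snd x * (fst (fst x) - fst (snd (fst x))), snd (snd (fst x))))"
    by (intro continuous_on_compose2[OF assms]) (auto intro!: continuous_intros)
  then have "continuous_on (UNIV \<times> UNIV \<times> {..T})
      (\<lambda>x. integral (cbox 0 1) (\<lambda>\<tau>. g' (fst (snd x) + \<tau> * (fst x - fst (snd x))) (snd (snd x))))"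
    by (intro integral_continuous_on_param) (simp add: case_prod_unfold)
  then show ?thesis by (simp add: mean_slope_def case_prod_unfold)
qed

lemma mean_slope_integrable:
  fixes g' :: "real \<Rightarrow> real \<Rightarrow> real"
  assumes "continuous_on (UNIV \<times> {..T}) (\<lambda>(y, s). g' y s)" "s \<le> T"
  shows "(\<lambda>\<tau>. g' (z + \<tau> * (y - z)) s) integrable_on {0..1}"
proof -
  have "continuous_on {0..1} (\<lambda>\<tau>. (\<lambda>(y, s). g' y s) (z + \<tau> * (y - z), s))"
    using assms(2) by (intro continuous_on_compose2[OF assms(1)] continuous_intros) auto
  then show ?thesis by (intro integrable_continuous_interval) simp
qed

lemma mean_slope_le:
  fixes g' :: "real \<Rightarrow> real \<Rightarrow> real"
  assumes "continuous_on (UNIV \<times> {..T}) (\<lambda>(y, s). g' y s)" "s \<le> T" "\<And>y. g' y s \<le> c"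
  shows "mean_slope g' y z s \<le> c"
proof -
  have "mean_slope g' y z s \<le> integral {0..1::real} (\<lambda>_. c)"
    unfolding mean_slope_def by (intro integral_le mean_slope_integrable[OF assms(1,2)] assms(3)) auto
  then show ?thesis by simp
qed

lemma mean_slope_ge:
  fixes g' :: "real \<Rightarrow> real \<Rightarrow> real"
  assumes "continuous_on (UNIV \<times> {..T}) (\<lambda>(y, s). g' y s)" "s \<le> T" "\<And>y. c \<le> g' y s"
  shows "c \<le> mean_slope g' y z s"
proof -
  have "integral {0..1::real} (\<lambda>_. c) \<le> mean_slope g' y z s"
    unfolding mean_slope_def by (intro integral_le mean_slope_integrable[OF assms(1,2)] assms(3)) auto
  then show ?thesis by simp
qed

lemma difference_eq_mean_slope:
  fixes g g' :: "real \<Rightarrow> real \<Rightarrow> real"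
  assumes "continuous_on (UNIV \<times> {..T}) (\<lambda>(y, s). g' y s)" "s \<le> T"
    and "\<And>y. ((\<lambda>y. g y s) has_real_derivative g' y s) (at y)"
  shows "g y s - g z s = mean_slope g' y z s * (y - z)"
proof -
  have "((\<lambda>\<tau>. g (z + \<tau> * (y - z)) s) has_real_derivative g' (z + \<tau> * (y - z)) s * (y - z)) (at \<tau> within {0..1})" for \<tau>
    by (rule DERIV_chain2[OF assms(3)]) (auto intro!: derivative_eq_intros)
  then have "((\<lambda>\<tau>. g' (z + \<tau> * (y - z)) s * (y - z)) has_integral g (z + 1 * (y - z)) s - g (z + 0 * (y - z)) s) {0..1}"
    by (intro fundamental_theorem_of_calculus) (auto simp: has_real_derivative_iff_has_vector_derivative[symmetric])
  moreover have "((\<lambda>\<tau>. g' (z + \<tau> * (y - z)) s * (y - z)) has_integral mean_slope g' y z s * (y - z)) {0..1}"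
    unfolding mean_slope_def by (intro has_integral_mult_left integrable_integral mean_slope_integrable[OF assms(1,2)])
  ultimately show ?thesis by (simp add: has_integral_unique)
qed

lemma nonpos_derivative_imp_decrease:
  fixes f :: "real \<Rightarrow> real"
  assumes "\<And>s. s \<in> {r..T} \<Longrightarrow> (f has_real_derivative f' s) (at s within {r..T})"
    and "\<And>s. s \<in> {r..T} \<Longrightarrow> f' s \<le> 0" and "r \<le> T"
  shows "f T \<le> f r"
proof -
  have c: "continuous_on {r..T} f" using assms(1) by (rule DERIV_continuous_on)
  show ?thesis
  proof (rule DERIV_nonpos_imp_decreasing_open[OF \<open>r \<le> T\<close> _ c])
    fix s assume "r < s" "s < T"
    with assms(1)[of s] assms(2)[of s] have "(f has_real_derivative f' s) (at s) \<and> f' s \<le> 0"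
      by (simp add: at_within_Icc_at)
    then show "\<exists>y. (f has_real_derivative y) (at s) \<and> y \<le> 0" ..
  qed
qed

text \<open>Seen backwards from \<open>T\<close>, a negative value of \<open>z\<close> can at most grow in modulus at the rate \<open>K\<close>, so that
\<open>z * exp (K * s)\<close> is monotone on an interval where \<open>z\<close> is negative. Hence \<open>z\<close> cannot leave zero downwards.\<close>
lemma terminal_barrier:
  fixes z :: "real \<Rightarrow> real"
  assumes der: "\<And>s. s \<in> {t..T} \<Longrightarrow> (z has_real_derivative z' s) (at s within {t..T})"
    and neg: "\<And>s. s \<in> {t..T} \<Longrightarrow> z s < 0 \<Longrightarrow> z' s \<le> - K * z s"
    and "z T \<ge> 0" "s \<in> {t..T}"
  shows "z s \<ge> 0"
proof (rule ccontr)
  assume s: "\<not> z s \<ge> 0"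
  have cz: "continuous_on {t..T} z" using der by (rule DERIV_continuous_on)
  define Z where "Z = {r \<in> {s..T}. z r \<ge> 0}"
  have "Z = {s..T} \<inter> z -` {0..}" by (auto simp: Z_def)
  moreover have "closed ({s..T} \<inter> z -` {0..})"
    using assms(4) by (intro continuous_closed_preimage continuous_on_subset[OF cz]) auto
  ultimately have "closed Z" by simp
  moreover have "Z \<noteq> {}" "bdd_below Z" using assms(3,4) by (auto simp: Z_def)
  ultimately have rZ: "Inf Z \<in> Z" and low: "\<And>r. r \<in> Z \<Longrightarrow> Inf Z \<le> r"
    by (auto simp: closed_contains_Inf cInf_lower)
  define r where "r = Inf Z"
  have r: "s < r" "r \<le> T" "z r \<ge> 0" using rZ s by (auto simp: Z_def r_def less_le)
  have before: "z \<sigma> < 0" if "\<sigma> \<in> {s..<r}" for \<sigma>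
    using low[of \<sigma>] that r by (force simp: Z_def r_def)
  have "z r = 0"
  proof (rule ccontr)
    assume "z r \<noteq> 0"
    then have "z r > 0" using r by simp
    moreover have "continuous_on {s..r} z" using r assms(4) by (auto intro: continuous_on_subset[OF cz])
    ultimately obtain \<sigma> where "\<sigma> \<in> {s..r}" "z \<sigma> = z r / 2"
      using IVT'[of z s "z r / 2" r] r s by auto
    with before[of \<sigma>] \<open>z r > 0\<close> show False by (cases "\<sigma> = r") auto
  qed
  define \<psi> where "\<psi> \<sigma> = z \<sigma> * exp (K * \<sigma>)" for \<sigma>
  have "\<psi> r \<le> \<psi> s"
  proof -
    have c: "continuous_on {s..r} \<psi>" unfolding \<psi>_def using r assms(4)
      by (intro continuous_intros continuous_on_subset[OF cz]) auto
    show ?thesis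
    proof (rule DERIV_nonpos_imp_decreasing_open[OF less_imp_le[OF r(1)] _ c])
      fix \<sigma> assume \<sigma>: "s < \<sigma>" "\<sigma> < r"
      have "(z has_real_derivative z' \<sigma>) (at \<sigma>)"
        using der[of \<sigma>] \<sigma> r assms(4) by (simp add: at_within_Icc_at)
      then have "(\<psi> has_real_derivative z' \<sigma> * exp (K * \<sigma>) + exp (K * \<sigma>) * K * z \<sigma>) (at \<sigma>)"
        unfolding \<psi>_def by (auto intro!: derivative_eq_intros)
      moreover have "z' \<sigma> * exp (K * \<sigma>) + exp (K * \<sigma>) * K * z \<sigma> = (z' \<sigma> + K * z \<sigma>) * exp (K * \<sigma>)"
        by (simp add: algebra_simps)
      moreover have "(z' \<sigma> + K * z \<sigma>) * exp (K * \<sigma>) \<le> 0"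
        using neg[of \<sigma>] before[of \<sigma>] \<sigma> r assms(4) by (simp add: mult_le_0_iff)
      ultimately show "\<exists>y. (\<psi> has_real_derivative y) (at \<sigma>) \<and> y \<le> 0" by auto
    qed
  qed
  moreover have "\<psi> s < 0" using s by (simp add: \<psi>_def mult_neg_pos)
  ultimately show False using \<open>z r = 0\<close> by (simp add: \<psi>_def)
qed

text \<open>Seen backwards from \<open>T\<close>, each component feeds the other with a nonnegative coefficient, which
preserves the nonnegative quadrant. As long as \<open>u\<close> is nonnegative, so is \<open>v\<close>, and then \<open>u\<close> decays
at most exponentially; so \<open>u\<close> has no last zero.\<close>
lemma cooperative_system:
  fixes u v :: "real \<Rightarrow> real"
  assumes d1: "\<And>s. s \<in> {t..T} \<Longrightarrow> (u has_real_derivative - (\<alpha> s * u s + \<kappa> s * v s)) (at s within {t..T})"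
    and d2: "\<And>s. s \<in> {t..T} \<Longrightarrow> (v has_real_derivative - (\<beta> s * v s + \<gamma> s * u s)) (at s within {t..T})"
    and bounds: "\<And>s. s \<in> {t..T} \<Longrightarrow> \<bar>\<alpha> s\<bar> \<le> K \<and> \<bar>\<beta> s\<bar> \<le> K \<and> \<kappa> s \<ge> 0 \<and> \<gamma> s \<ge> 0"
    and T: "u T > 0" "v T \<ge> 0" and s: "s \<in> {t..T}"
  shows "u s \<ge> u T * exp (- (K * (T - s)))" "v s \<ge> 0"
proof -
  have sub: "{r..T} \<subseteq> {t..T}" if "r \<in> {t..T}" for r using that by auto
  have v: "v \<sigma> \<ge> 0" if r: "r \<in> {t..T}" and pos: "\<And>\<sigma>. \<sigma> \<in> {r..T} \<Longrightarrow> u \<sigma> \<ge> 0" and "\<sigma> \<in> {r..T}" for r \<sigma>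
  proof (rule terminal_barrier[where z = v and t = r and T = T and K = K])
    fix \<sigma> assume \<sigma>: "\<sigma> \<in> {r..T}"
    show "(v has_real_derivative - (\<beta> \<sigma> * v \<sigma> + \<gamma> \<sigma> * u \<sigma>)) (at \<sigma> within {r..T})"
      using \<sigma> r by (intro DERIV_subset[OF d2 sub]) auto
    assume neg: "v \<sigma> < 0"
    have "\<gamma> \<sigma> * u \<sigma> \<ge> 0" using bounds[of \<sigma>] pos[OF \<sigma>] \<sigma> r by simp
    moreover have "K * v \<sigma> \<le> \<beta> \<sigma> * v \<sigma>"
      using bounds[of \<sigma>] \<sigma> r neg by (intro mult_right_mono_neg) auto
    ultimately show "- (\<beta> \<sigma> * v \<sigma> + \<gamma> \<sigma> * u \<sigma>) \<le> - K * v \<sigma>" by simp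
  qed (use T that in auto)
  have u: "u r \<ge> u T * exp (- (K * (T - r)))" if r: "r \<in> {t..T}" and pos: "\<And>\<sigma>. \<sigma> \<in> {r..T} \<Longrightarrow> u \<sigma> \<ge> 0" for r
  proof -
    \<comment> \<open>The factor absorbs the worst possible decay caused by the diagonal coefficient.\<close>
    define w where "w \<sigma> = u \<sigma> * exp (K * (T - \<sigma>))" for \<sigma>
    have "w T \<le> w r"
    proof (rule nonpos_derivative_imp_decrease[where f = w])
      fix \<sigma> assume \<sigma>: "\<sigma> \<in> {r..T}"
      have "(u has_real_derivative - (\<alpha> \<sigma> * u \<sigma> + \<kappa> \<sigma> * v \<sigma>)) (at \<sigma> within {r..T})"
        using \<sigma> r by (intro DERIV_subset[OF d1 sub]) auto
      then show "(w has_real_derivative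
          - ((\<alpha> \<sigma> + K) * u \<sigma> + \<kappa> \<sigma> * v \<sigma>) * exp (K * (T - \<sigma>))) (at \<sigma> within {r..T})"
        unfolding w_def by (auto intro!: derivative_eq_intros simp: algebra_simps)
      have "0 \<le> (\<alpha> \<sigma> + K) * u \<sigma>" using bounds[of \<sigma>] pos[OF \<sigma>] \<sigma> r by (intro mult_nonneg_nonneg) auto
      moreover have "0 \<le> \<kappa> \<sigma> * v \<sigma>" using bounds[of \<sigma>] v[OF r pos \<sigma>] \<sigma> r by (intro mult_nonneg_nonneg) auto
      ultimately show "- ((\<alpha> \<sigma> + K) * u \<sigma> + \<kappa> \<sigma> * v \<sigma>) * exp (K * (T - \<sigma>)) \<le> 0"
        by (simp add: mult_le_0_iff)
    qed (use r in auto)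
    then have "u T * exp (- (K * (T - r))) \<le> u r * exp (K * (T - r)) * exp (- (K * (T - r)))"
      by (intro mult_right_mono) (auto simp: w_def)
    then show ?thesis by (simp add: mult.assoc flip: exp_add)
  qed
  have pos: "u s > 0" if s: "s \<in> {t..T}" for s
  proof (rule ccontr)
    assume "\<not> u s > 0"
    define Z where "Z = {r \<in> {s..T}. u r \<le> 0}"
    have cz: "continuous_on {t..T} u" using d1 by (rule DERIV_continuous_on)
    have "Z = {s..T} \<inter> u -` {..0}" by (auto simp: Z_def)
    moreover have "closed ({s..T} \<inter> u -` {..0})"
      using s by (intro continuous_closed_preimage continuous_on_subset[OF cz]) auto
    ultimately have "closed Z" by simp
    moreover have "Z \<noteq> {}" "bdd_above Z" using s \<open>\<not> u s > 0\<close> by (auto simp: Z_def)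
    ultimately have rZ: "Sup Z \<in> Z" and up: "\<And>r. r \<in> Z \<Longrightarrow> r \<le> Sup Z"
      by (auto simp: closed_contains_Sup cSup_upper)
    define r where "r = Sup Z"
    have r: "r \<in> {t..T}" "s \<le> r" "u r \<le> 0" using rZ s by (auto simp: Z_def r_def)
    have after: "u \<sigma> > 0" if "\<sigma> \<in> {r<..T}" for \<sigma>
      using up[of \<sigma>] that r by (force simp: Z_def r_def)
    have "u r = 0"
    proof (rule ccontr)
      assume "u r \<noteq> 0"
      then have "u r < 0" using r by simp
      moreover have "continuous_on {r..T} u" using r by (auto intro: continuous_on_subset[OF cz])
      ultimately obtain \<sigma> where "\<sigma> \<in> {r..T}" "u \<sigma> = u r / 2"
        using IVT'[of u r "u r / 2" T] r T by auto
      with after[of \<sigma>] \<open>u r < 0\<close> show False by (cases "\<sigma> = r") auto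
    qed
    have "u \<sigma> \<ge> 0" if "\<sigma> \<in> {r..T}" for \<sigma>
      using after[of \<sigma>] that \<open>u r = 0\<close> by (cases "\<sigma> = r") auto
    from u[OF r(1) this] have "u T * exp (- (K * (T - r))) \<le> 0" using \<open>u r = 0\<close> by simp
    with T show False by (simp add: mult_le_0_iff)
  qed
  show "u s \<ge> u T * exp (- (K * (T - s)))"
    using s pos by (intro u) (auto simp: less_imp_le)
  show "v s \<ge> 0"
    by (rule v[OF s]) (use s pos in \<open>auto simp: less_imp_le\<close>)
qed

lemma bounded_on_slab:
  fixes g :: "'p::euclidean_space \<Rightarrow> real \<Rightarrow> real"
  assumes "continuous_on (UNIV \<times> {..T}) (\<lambda>(\<theta>, s). g \<theta> s)"
  shows "\<exists>C\<ge>0. \<forall>\<theta> s. norm \<theta> \<le> R \<longrightarrow> s \<in> {T0..T} \<longrightarrow> \<bar>g \<theta> s\<bar> \<le> C"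
proof -
  have "bounded ((\<lambda>(\<theta>, s). g \<theta> s) ` (cball 0 R \<times> {T0..T}))"
    by (intro compact_imp_bounded compact_continuous_image compact_Times continuous_on_subset[OF assms]) auto
  then obtain C where C: "\<And>x. x \<in> cball 0 R \<times> {T0..T} \<Longrightarrow> norm ((\<lambda>(\<theta>, s). g \<theta> s) x) \<le> C"
    unfolding bounded_iff by blast
  then have "\<bar>g \<theta> s\<bar> \<le> \<bar>C\<bar>" if "norm \<theta> \<le> R" "s \<in> {T0..T}" for \<theta> s
    using C[of "(\<theta>, s)"] that by force
  then show ?thesis by (intro exI[of _ "\<bar>C\<bar>"]) auto
qed

lemma abs_components_le_norm:
  fixes z :: "real \<times> real"
  shows "\<bar>fst z\<bar> \<le> norm z" "\<bar>snd z\<bar> \<le> norm z"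
  using norm_fst_le[of "fst z" "snd z"] norm_snd_le[of "snd z" "fst z"] by simp_all

lemma linear_terminal_ode:
  fixes a \<beta> \<gamma> :: "'p::euclidean_space \<Rightarrow> real \<Rightarrow> real"
  assumes a: "continuous_on (UNIV \<times> {..T}) (\<lambda>(\<theta>, s). a \<theta> s)"
    and \<beta>: "continuous_on (UNIV \<times> {..T}) (\<lambda>(\<theta>, s). \<beta> \<theta> s)"
    and \<gamma>: "continuous_on (UNIV \<times> {..T}) (\<lambda>(\<theta>, s). \<gamma> \<theta> s)"
  shows "terminal_ode (\<lambda>\<theta> z s. (a \<theta> s * fst z + snd z, \<gamma> \<theta> s * fst z - \<beta> \<theta> s * snd z)) T"
proof
  have *: "continuous_on (UNIV \<times> (UNIV :: (real \<times> real) set) \<times> {..T}) (\<lambda>x. (\<lambda>(\<theta>, s). g \<theta> s) (fst x, snd (snd x)))"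
    if "continuous_on (UNIV \<times> {..T}) (\<lambda>(\<theta>, s). g \<theta> s)" for g :: "'p \<Rightarrow> real \<Rightarrow> real"
    by (intro continuous_on_compose2[OF that]) (auto intro!: continuous_intros)
  show "continuous_on (UNIV \<times> UNIV \<times> {..T})
      (\<lambda>(\<theta>, z, s). (a \<theta> s * fst z + snd z, \<gamma> \<theta> s * fst z - \<beta> \<theta> s * snd z))"
    using *[OF a] *[OF \<beta>] *[OF \<gamma>] by (auto simp: case_prod_unfold intro!: continuous_intros)
next
  fix R T0 :: real
  let ?f = "\<lambda>\<theta> z s. (a \<theta> s * fst z + snd z, \<gamma> \<theta> s * fst z - \<beta> \<theta> s * snd z)"
  obtain Ca where Ca: "Ca \<ge> 0" "\<And>\<theta> s. norm \<theta> \<le> R \<Longrightarrow> s \<in> {T0..T} \<Longrightarrow> \<bar>a \<theta> s\<bar> \<le> Ca"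
    using bounded_on_slab[OF a, of R T0] by blast
  obtain Cb where Cb: "Cb \<ge> 0" "\<And>\<theta> s. norm \<theta> \<le> R \<Longrightarrow> s \<in> {T0..T} \<Longrightarrow> \<bar>\<beta> \<theta> s\<bar> \<le> Cb"
    using bounded_on_slab[OF \<beta>, of R T0] by blast
  obtain Cg where Cg: "Cg \<ge> 0" "\<And>\<theta> s. norm \<theta> \<le> R \<Longrightarrow> s \<in> {T0..T} \<Longrightarrow> \<bar>\<gamma> \<theta> s\<bar> \<le> Cg"
    using bounded_on_slab[OF \<gamma>, of R T0] by blast
  define C where "C = Ca + 1 + Cg + Cb"
  have bound: "norm (?f \<theta> z s) \<le> C * norm z" if "norm \<theta> \<le> R" "s \<in> {T0..T}" for \<theta> z s
  proof -
    note z = abs_components_le_norm[of z]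
    have "norm (?f \<theta> z s) \<le> \<bar>a \<theta> s * fst z + snd z\<bar> + \<bar>\<gamma> \<theta> s * fst z - \<beta> \<theta> s * snd z\<bar>"
      using norm_Pair_le[of "a \<theta> s * fst z + snd z" "\<gamma> \<theta> s * fst z - \<beta> \<theta> s * snd z"] by simp
    also have "\<dots> \<le> \<bar>a \<theta> s\<bar> * \<bar>fst z\<bar> + \<bar>snd z\<bar> + (\<bar>\<gamma> \<theta> s\<bar> * \<bar>fst z\<bar> + \<bar>\<beta> \<theta> s\<bar> * \<bar>snd z\<bar>)"
      by (intro add_mono order.trans[OF abs_triangle_ineq] order.trans[OF abs_triangle_ineq4]) (auto simp: abs_mult)
    also have "\<dots> \<le> Ca * norm z + norm z + (Cg * norm z + Cb * norm z)"
      using that z Ca Cb Cg by (intro add_mono mult_mono) auto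
    finally show ?thesis by (simp add: C_def algebra_simps)
  qed
  have C: "C \<ge> 0" using Ca Cb Cg by (simp add: C_def)
  have "norm (?f \<theta> z s) \<le> C * (1 + norm z)" if "norm \<theta> \<le> R" "s \<in> {T0..T}" for \<theta> z s
    using bound[OF that, of z] C by (simp add: distrib_left)
  then show "\<exists>G. \<forall>\<theta> z. \<forall>s\<in>{T0..T}. norm \<theta> \<le> R \<longrightarrow> norm (?f \<theta> z s) \<le> G * (1 + norm z)" by blast
  have "?f \<theta> z s - ?f \<theta> z' s = ?f \<theta> (z - z') s" for \<theta> z z' s
    by (simp add: algebra_simps)
  then have "norm (?f \<theta> z s - ?f \<theta> z' s) \<le> C * norm (z - z')" if "norm \<theta> \<le> R" "s \<in> {T0..T}" for \<theta> z z' s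
    using bound[OF that, of "z - z'"] by (metis (no_types, lifting))
  then show "\<exists>L. \<forall>\<theta> z z'. \<forall>s\<in>{T0..T}. norm \<theta> \<le> R \<longrightarrow> norm z \<le> R \<longrightarrow> norm z' \<le> R \<longrightarrow>
      norm (?f \<theta> z s - ?f \<theta> z' s) \<le> L * norm (z - z')" by blast
qed

section \<open>Extremals\<close>

text \<open>Continuity of the second derivative makes \<open>b1\<close> locally Lipschitz in its first argument, and this makes the
extremals unique.\<close>
locale smooth_concave_drift = concave_drift +
  fixes b2 :: "real \<Rightarrow> real \<Rightarrow> real"
  assumes deriv_b1: "\<And>y s. s \<le> T \<Longrightarrow> ((\<lambda>y. b1 y s) has_real_derivative b2 y s) (at y)"
    and cont_b2: "continuous_on (UNIV \<times> {..T}) (\<lambda>(y, s). b2 y s)"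
begin

lemma b2_nonpos:
  assumes "s \<le> T"
  shows "b2 y s \<le> 0"
proof -
  have "mono_on UNIV (\<lambda>y. - b1 y s)"
  proof (rule mono_onI)
    fix y z :: real assume "y \<le> z"
    have "0 \<le> (b1 y s - b1 z s) * (z - y)"
      using b_tangent[OF assms, of y z] b_tangent[OF assms, of z y] by (simp add: algebra_simps)
    with \<open>y \<le> z\<close> show "- b1 y s \<le> - b1 z s"
      by (cases "y = z") (auto simp: zero_le_mult_iff)
  qed
  then have "- b2 y s \<ge> 0"
    by (rule mono_on_imp_deriv_nonneg) (auto intro!: derivative_intros deriv_b1 assms)
  then show ?thesis by simp
qed

text \<open>Hamilton's equations for the Lagrangian \<open>(y' - b y s)\<^sup>2 / 2\<close>: the first component of \<open>z\<close> is the path, the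
second the momentum \<open>p = y' - b y s\<close>. The argument \<open>\<theta>\<close> is the terminal datum that parametrises the flow.\<close>
abbreviation hamiltonian_field :: "real \<times> real \<Rightarrow> real \<times> real \<Rightarrow> real \<Rightarrow> real \<times> real" where
  "hamiltonian_field \<theta> z s \<equiv> (b (fst z) s + snd z, - (b1 (fst z) s * snd z))"

lemma terminal_ode_hamiltonian: "terminal_ode hamiltonian_field T"
proof
  have *: "continuous_on ((UNIV :: (real \<times> real) set) \<times> (UNIV :: (real \<times> real) set) \<times> {..T}) (\<lambda>x. (\<lambda>(y, s). g y s) (fst (fst (snd x)), snd (snd x)))"
    if "continuous_on (UNIV \<times> {..T}) (\<lambda>(y, s). g y s)" for g :: "real \<Rightarrow> real \<Rightarrow> real"
    by (intro continuous_on_compose2[OF that]) (auto intro!: continuous_intros)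
  show "continuous_on (UNIV \<times> UNIV \<times> {..T}) (\<lambda>(\<theta>, z, s). hamiltonian_field \<theta> z s)"
    using *[OF cont_b] *[OF cont_b1] by (auto simp: case_prod_unfold intro!: continuous_intros)
next
  fix R T0 :: real
  obtain H where H: "H \<ge> 0" "\<And>y s. norm y \<le> 0 \<Longrightarrow> s \<in> {T0..T} \<Longrightarrow> \<bar>b y s\<bar> \<le> H"
    using bounded_on_slab[OF cont_b, of 0 T0] by blast
  have "norm (hamiltonian_field \<theta> z s) \<le> (H + 2 * A + 1) * (1 + norm z)" if s: "s \<in> {T0..T}" for \<theta> z :: "real \<times> real" and s
  proof -
    note z = abs_components_le_norm[of z]
    have "\<bar>b (fst z) s\<bar> \<le> H + A * \<bar>fst z\<bar>"
      using b_lipschitz[of s "fst z" 0] H(2)[of 0 s] s by auto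
    moreover have "norm (hamiltonian_field \<theta> z s) \<le> \<bar>b (fst z) s + snd z\<bar> + \<bar>b1 (fst z) s * snd z\<bar>"
      using norm_Pair_le[of "b (fst z) s + snd z" "- (b1 (fst z) s * snd z)"] by simp
    moreover have "\<bar>b1 (fst z) s * snd z\<bar> \<le> A * \<bar>snd z\<bar>"
      using bound_b1[of s "fst z"] s by (simp add: abs_mult mult_right_mono)
    moreover have "A * \<bar>fst z\<bar> \<le> A * norm z" "A * \<bar>snd z\<bar> \<le> A * norm z"
      using z A_nonneg by (auto intro: mult_left_mono)
    ultimately have "norm (hamiltonian_field \<theta> z s) \<le> H + 2 * (A * norm z) + norm z"
      using z by linarith
    also have "\<dots> \<le> (H + 2 * A + 1) * (1 + norm z)"
      using H(1) A_nonneg by (simp add: algebra_simps)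
    finally show ?thesis .
  qed
  then show "\<exists>G. \<forall>\<theta> z. \<forall>s\<in>{T0..T}. norm (\<theta> :: real \<times> real) \<le> R \<longrightarrow> norm (hamiltonian_field \<theta> z s) \<le> G * (1 + norm z)"
    by blast
  obtain C where C: "C \<ge> 0" "\<And>y s. norm y \<le> R \<Longrightarrow> s \<in> {T0..T} \<Longrightarrow> \<bar>b2 y s\<bar> \<le> C"
    using bounded_on_slab[OF cont_b2, of R T0] by blast
  have "norm (hamiltonian_field \<theta> z s - hamiltonian_field \<theta> z' s) \<le> (2 * A + 1 + C * R) * norm (z - z')"
    if s: "s \<in> {T0..T}" and zR: "norm z \<le> R" "norm z' \<le> R" for \<theta> z z' :: "real \<times> real" and s
  proof -
    have d: "\<bar>fst z - fst z'\<bar> \<le> norm (z - z')" "\<bar>snd z - snd z'\<bar> \<le> norm (z - z')"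
      using abs_components_le_norm[of "z - z'"] by simp_all
    have zb: "\<bar>fst z\<bar> \<le> R" "\<bar>fst z'\<bar> \<le> R" "\<bar>snd z\<bar> \<le> R"
      using abs_components_le_norm[of z] abs_components_le_norm[of z'] zR by linarith+
    have "norm (b1 (fst z) s - b1 (fst z') s) \<le> C * norm (fst z - fst z')"
      using s zb C(2)
      by (intro field_differentiable_bound[of "cball 0 R" "\<lambda>y. b1 y s" "\<lambda>y. b2 y s"])
        (auto intro: has_field_derivative_at_within deriv_b1)
    then have "\<bar>b1 (fst z) s - b1 (fst z') s\<bar> \<le> C * norm (z - z')"
      using mult_left_mono[OF d(1) C(1)] by simp
    then have "\<bar>b1 (fst z) s - b1 (fst z') s\<bar> * \<bar>snd z\<bar> \<le> C * norm (z - z') * R"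
      using zb C(1) by (intro mult_mono) auto
    moreover have "\<bar>b1 (fst z') s\<bar> * \<bar>snd z - snd z'\<bar> \<le> A * norm (z - z')"
      using bound_b1[of s "fst z'"] s d A_nonneg by (intro mult_mono) auto
    moreover have "b1 (fst z) s * snd z - b1 (fst z') s * snd z'
        = (b1 (fst z) s - b1 (fst z') s) * snd z + b1 (fst z') s * (snd z - snd z')"
      by (simp add: algebra_simps)
    then have "\<bar>b1 (fst z) s * snd z - b1 (fst z') s * snd z'\<bar>
        \<le> \<bar>b1 (fst z) s - b1 (fst z') s\<bar> * \<bar>snd z\<bar> + \<bar>b1 (fst z') s\<bar> * \<bar>snd z - snd z'\<bar>"
      using abs_triangle_ineq[of "(b1 (fst z) s - b1 (fst z') s) * snd z" "b1 (fst z') s * (snd z - snd z')"]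
      by (simp add: abs_mult)
    moreover have "\<bar>b (fst z) s - b (fst z') s\<bar> \<le> A * norm (z - z')"
      using b_lipschitz[of s "fst z" "fst z'"] s mult_left_mono[OF d(1) A_nonneg] by auto
    moreover have "norm (hamiltonian_field \<theta> z s - hamiltonian_field \<theta> z' s)
        \<le> \<bar>(b (fst z) s - b (fst z') s) + (snd z - snd z')\<bar> + \<bar>b1 (fst z) s * snd z - b1 (fst z') s * snd z'\<bar>"
      using norm_Pair_le[of "(b (fst z) s - b (fst z') s) + (snd z - snd z')" "- (b1 (fst z) s * snd z - b1 (fst z') s * snd z')"]
      by (simp add: algebra_simps)
    ultimately have "norm (hamiltonian_field \<theta> z s - hamiltonian_field \<theta> z' s)
        \<le> A * norm (z - z') + norm (z - z') + (C * norm (z - z') * R + A * norm (z - z'))"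
      using d by linarith
    then show ?thesis by (simp add: algebra_simps)
  qed
  then show "\<exists>L. \<forall>\<theta> z z'. \<forall>s\<in>{T0..T}. norm (\<theta> :: real \<times> real) \<le> R \<longrightarrow> norm z \<le> R \<longrightarrow> norm z' \<le> R \<longrightarrow>
      norm (hamiltonian_field \<theta> z s - hamiltonian_field \<theta> z' s) \<le> L * norm (z - z')" by blast
qed

definition extremal :: "real \<times> real \<Rightarrow> real \<Rightarrow> real \<times> real" where
  "extremal = (SOME \<Phi>. continuous_on (UNIV \<times> {..T}) (\<lambda>(\<theta>, s). \<Phi> \<theta> s) \<and>
    (\<forall>\<theta>. \<Phi> \<theta> T = \<theta> \<and> (\<forall>s\<le>T. (\<Phi> \<theta> has_vector_derivative hamiltonian_field \<theta> (\<Phi> \<theta> s) s) (at s within {..T}))))"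

lemma extremal:
  shows continuous_extremal: "continuous_on (UNIV \<times> {..T}) (\<lambda>(\<theta>, s). extremal \<theta> s)"
    and extremal_end [simp]: "extremal \<theta> T = \<theta>"
    and extremal_ode: "s \<le> T \<Longrightarrow> (extremal \<theta> has_vector_derivative hamiltonian_field \<theta> (extremal \<theta> s) s) (at s within {..T})"
  using someI_ex[OF terminal_ode.flow_exists[OF terminal_ode_hamiltonian continuous_on_id]]
  unfolding extremal_def[symmetric] by blast+

lemma extremal_unique:
  assumes "\<And>s. s \<in> {t..T} \<Longrightarrow> (u has_vector_derivative hamiltonian_field \<theta> (u s) s) (at s within {t..T})"
    and "s \<in> {t..T}" "u T = \<theta>"
  shows "u s = extremal \<theta> s"
proof (rule terminal_ode.solution_unique[OF terminal_ode_hamiltonian, where t = t and u = u and v = "extremal \<theta>"])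
  fix s assume "s \<in> {t..T}"
  then show "(extremal \<theta> has_vector_derivative hamiltonian_field \<theta> (extremal \<theta> s) s) (at s within {t..T})"
    by (intro has_vector_derivative_within_subset[OF extremal_ode]) auto
qed (use assms in auto)

text \<open>Path and momentum of the extremal with terminal point \<open>fst \<theta>\<close> and terminal momentum \<open>snd \<theta>\<close>.\<close>
definition Y :: "real \<times> real \<Rightarrow> real \<Rightarrow> real" where "Y \<theta> s = fst (extremal \<theta> s)"
definition P :: "real \<times> real \<Rightarrow> real \<Rightarrow> real" where "P \<theta> s = snd (extremal \<theta> s)"

lemma Y_end [simp]: "Y \<theta> T = fst \<theta>" and P_end [simp]: "P \<theta> T = snd \<theta>"
  by (simp_all add: Y_def P_def)

lemma continuous_Y: "continuous_on (UNIV \<times> {..T}) (\<lambda>(\<theta>, s). Y \<theta> s)"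
  and continuous_P: "continuous_on (UNIV \<times> {..T}) (\<lambda>(\<theta>, s). P \<theta> s)"
  using continuous_on_fst[OF continuous_extremal] continuous_on_snd[OF continuous_extremal]
  by (simp_all add: Y_def P_def case_prod_unfold)

lemma Y_ode: "s \<le> T \<Longrightarrow> (Y \<theta> has_real_derivative b (Y \<theta> s) s + P \<theta> s) (at s within {..T})"
  and P_ode: "s \<le> T \<Longrightarrow> (P \<theta> has_real_derivative - (b1 (Y \<theta> s) s * P \<theta> s)) (at s within {..T})"
  using bounded_linear.has_vector_derivative[OF bounded_linear_fst extremal_ode[of s \<theta>]]
    bounded_linear.has_vector_derivative[OF bounded_linear_snd extremal_ode[of s \<theta>]]
  by (simp_all add: Y_def[abs_def] P_def[abs_def] has_real_derivative_iff_has_vector_derivative)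

lemma Y_ode': "s \<in> {t..T} \<Longrightarrow> (Y \<theta> has_real_derivative b (Y \<theta> s) s + P \<theta> s) (at s within {t..T})"
  and P_ode': "s \<in> {t..T} \<Longrightarrow> (P \<theta> has_real_derivative - (b1 (Y \<theta> s) s * P \<theta> s)) (at s within {t..T})"
  by (auto intro!: DERIV_subset[OF Y_ode] DERIV_subset[OF P_ode])

text \<open>The momentum solves a linear homogeneous equation, so it cannot change sign.\<close>
lemma P_nonneg:
  assumes "snd \<theta> \<ge> 0" "s \<le> T"
  shows "P \<theta> s \<ge> 0"
proof (rule terminal_barrier[OF P_ode'[of _ s], where K = A])
  fix \<sigma> assume "\<sigma> \<in> {s..T}" "P \<theta> \<sigma> < 0"
  then have "A * P \<theta> \<sigma> \<le> b1 (Y \<theta> \<sigma>) \<sigma> * P \<theta> \<sigma>"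
    using bound_b1[of \<sigma> "Y \<theta> \<sigma>"] by (intro mult_right_mono_neg) auto
  then show "- (b1 (Y \<theta> \<sigma>) \<sigma> * P \<theta> \<sigma>) \<le> - A * P \<theta> \<sigma>" by simp
qed (use assms in auto)

text \<open>An extremal with zero terminal momentum has no momentum at all, and then its path follows the drift.\<close>
lemma solves_tvp_iff:
  "solves_tvp b T x u \<longleftrightarrow> u T = x \<and> (\<forall>s\<le>T. u s = Y (x, 0) s)"
proof -
  have P0: "P (x, 0) s = 0" if "s \<le> T" for s
  proof -
    have "P (x, 0) s \<ge> 0" using that by (intro P_nonneg) auto
    moreover have "- P (x, 0) s \<ge> 0"
    proof (rule terminal_barrier[where z = "\<lambda>s. - P (x, 0) s" and K = A and t = s])
      fix \<sigma> assume \<sigma>: "\<sigma> \<in> {s..T}"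
      show "((\<lambda>s. - P (x, 0) s) has_real_derivative b1 (Y (x, 0) \<sigma>) \<sigma> * P (x, 0) \<sigma>) (at \<sigma> within {s..T})"
        using DERIV_minus[OF P_ode'[OF \<sigma>]] by simp
      assume "- P (x, 0) \<sigma> < 0"
      then have "b1 (Y (x, 0) \<sigma>) \<sigma> * P (x, 0) \<sigma> \<le> A * P (x, 0) \<sigma>"
        using bound_b1[of \<sigma> "Y (x, 0) \<sigma>"] \<sigma> by (intro mult_right_mono) auto
      then show "b1 (Y (x, 0) \<sigma>) \<sigma> * P (x, 0) \<sigma> \<le> - A * - P (x, 0) \<sigma>" by simp
    qed (use that in auto)
    ultimately show ?thesis by simp
  qed
  show ?thesis
  proof (intro iffI conjI allI impI)
    assume u: "solves_tvp b T x u"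
    then show "u T = x" by (simp add: solves_tvp_def)
    fix s assume "s \<le> T"
    have "(\<lambda>s. (u s, 0)) s = extremal (x, 0) s"
    proof (rule extremal_unique[where t = s])
      fix \<sigma> assume "\<sigma> \<in> {s..T}"
      then have "(u has_real_derivative b (u \<sigma>) \<sigma>) (at \<sigma> within {s..T})"
        using u unfolding solves_tvp_def by (auto intro!: DERIV_subset[where s = "{..T}" and t = "{s..T}" and f = u])
      then have "(u has_vector_derivative b (u \<sigma>) \<sigma>) (at \<sigma> within {s..T})"
        by (simp add: has_real_derivative_iff_has_vector_derivative)
      then have "((\<lambda>s. (u s, 0 :: real)) has_vector_derivative (b (u \<sigma>) \<sigma>, 0)) (at \<sigma> within {s..T})"
        by (intro derivative_intros)
      then show "((\<lambda>s. (u s, 0)) has_vector_derivative hamiltonian_field (x, 0) (u \<sigma>, 0) \<sigma>) (at \<sigma> within {s..T})"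
        by simp
    qed (use u \<open>s \<le> T\<close> in \<open>simp_all add: solves_tvp_def\<close>)
    then show "u s = Y (x, 0) s" unfolding Y_def by (metis fst_conv)
  next
    assume u: "u T = x \<and> (\<forall>s\<le>T. u s = Y (x, 0) s)"
    then have eq: "u s = Y (x, 0) s" if "s \<le> T" for s using that by blast
    have "(u has_real_derivative b (u s) s) (at s within {..T})" if "s \<le> T" for s
    proof -
      have "(Y (x, 0) has_real_derivative b (u s) s) (at s within {..T})"
        using Y_ode[OF that, of "(x, 0)"] by (simp add: P0[OF that] eq[OF that])
      then show ?thesis
        by (rule has_field_derivative_transform_within[where d = 1]) (simp_all add: eq that)
    qed
    then show "solves_tvp b T x u" using u unfolding solves_tvp_def by blast
  qed
qed

lemma F_eq:
  assumes "t \<le> T"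
  shows "F b T x t = Y (x, 0) t"
  unfolding F_def
proof (rule the_equality)
  show "\<exists>u. solves_tvp b T x u \<and> Y (x, 0) t = u t"
    by (rule exI[of _ "Y (x, 0)"]) (simp add: solves_tvp_iff)
next
  fix v assume "\<exists>u. solves_tvp b T x u \<and> v = u t"
  with assms show "v = Y (x, 0) t" by (auto simp: solves_tvp_iff)
qed

section \<open>Differences of extremals\<close>

text \<open>The parameter is a pair of terminal data; the difference of the two extremals satisfies a linear system
whose coefficients are mean slopes along the pair. The system is exact, not a linearisation, and on
the diagonal it becomes the variational equation of a single extremal.\<close>
definition secant_b :: "(real \<times> real) \<times> (real \<times> real) \<Rightarrow> real \<Rightarrow> real" where
  "secant_b \<theta> s = mean_slope b1 (Y (fst \<theta>) s) (Y (snd \<theta>) s) s"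

definition secant_b1 :: "(real \<times> real) \<times> (real \<times> real) \<Rightarrow> real \<Rightarrow> real" where
  "secant_b1 \<theta> s = mean_slope b2 (Y (fst \<theta>) s) (Y (snd \<theta>) s) s"

abbreviation secant_field :: "(real \<times> real) \<times> (real \<times> real) \<Rightarrow> real \<times> real \<Rightarrow> real \<Rightarrow> real \<times> real" where
  "secant_field \<theta> z s \<equiv>
    (secant_b \<theta> s * fst z + snd z, - (secant_b1 \<theta> s * P (snd \<theta>) s) * fst z - b1 (Y (fst \<theta>) s) s * snd z)"

lemma continuous_pair_component:
  assumes "continuous_on (UNIV \<times> {..T}) (\<lambda>(\<theta>, s). g \<theta> s)"
  shows "continuous_on (UNIV \<times> {..T}) (\<lambda>x :: ((real \<times> real) \<times> (real \<times> real)) \<times> real. g (fst (fst x)) (snd x))"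
    and "continuous_on (UNIV \<times> {..T}) (\<lambda>x :: ((real \<times> real) \<times> (real \<times> real)) \<times> real. g (snd (fst x)) (snd x))"
proof -
  have "continuous_on (UNIV \<times> {..T}) (\<lambda>x :: ((real \<times> real) \<times> (real \<times> real)) \<times> real. (\<lambda>(\<theta>, s). g \<theta> s) (fst (fst x), snd x))"
    by (rule continuous_on_compose2[OF assms]) (auto intro!: continuous_intros)
  moreover have "continuous_on (UNIV \<times> {..T}) (\<lambda>x :: ((real \<times> real) \<times> (real \<times> real)) \<times> real. (\<lambda>(\<theta>, s). g \<theta> s) (snd (fst x), snd x))"
    by (rule continuous_on_compose2[OF assms]) (auto intro!: continuous_intros)
  ultimately show "continuous_on (UNIV \<times> {..T}) (\<lambda>x :: ((real \<times> real) \<times> (real \<times> real)) \<times> real. g (fst (fst x)) (snd x))"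
    "continuous_on (UNIV \<times> {..T}) (\<lambda>x :: ((real \<times> real) \<times> (real \<times> real)) \<times> real. g (snd (fst x)) (snd x))"
    by simp_all
qed

lemma continuous_secant:
  assumes "continuous_on (UNIV \<times> {..T}) (\<lambda>(y, s). g' y s)"
  shows "continuous_on (UNIV \<times> {..T}) (\<lambda>(\<theta>, s). mean_slope g' (Y (fst \<theta>) s) (Y (snd \<theta>) s) s)"
proof -
  have "continuous_on (UNIV \<times> {..T}) (\<lambda>x. (\<lambda>(y, z, s). mean_slope g' y z s)
      (Y (fst (fst x)) (snd x), Y (snd (fst x)) (snd x), snd x))"
    by (rule continuous_on_compose2[OF continuous_mean_slope[OF assms]])
      (auto intro!: continuous_intros continuous_pair_component[OF continuous_Y])
  then show ?thesis by (simp add: case_prod_unfold)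
qed

lemma terminal_ode_secant: "terminal_ode secant_field T"
proof (rule linear_terminal_ode)
  show "continuous_on (UNIV \<times> {..T}) (\<lambda>(\<theta>, s). secant_b \<theta> s)"
    unfolding secant_b_def by (rule continuous_secant[OF cont_b1])
  have "continuous_on (UNIV \<times> {..T}) (\<lambda>x :: ((real \<times> real) \<times> (real \<times> real)) \<times> real. (\<lambda>(y, s). b1 y s) (Y (fst (fst x)) (snd x), snd x))"
    by (rule continuous_on_compose2[OF cont_b1])
      (auto intro!: continuous_intros continuous_pair_component[OF continuous_Y])
  then show "continuous_on (UNIV \<times> {..T}) (\<lambda>(\<theta> :: (real \<times> real) \<times> (real \<times> real), s). b1 (Y (fst \<theta>) s) s)"
    by (simp add: case_prod_unfold)
  have "continuous_on (UNIV \<times> {..T}) (\<lambda>x. - ((\<lambda>(\<theta>, s). secant_b1 \<theta> s) x * P (snd (fst x)) (snd x)))"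
    unfolding secant_b1_def
    by (intro continuous_intros continuous_secant[OF cont_b2] continuous_pair_component[OF continuous_P])
  then show "continuous_on (UNIV \<times> {..T}) (\<lambda>(\<theta>, s). - (secant_b1 \<theta> s * P (snd \<theta>) s))"
    by (simp add: case_prod_unfold)
qed

definition sensitivity :: "real \<times> real \<Rightarrow> (real \<times> real) \<times> (real \<times> real) \<Rightarrow> real \<Rightarrow> real \<times> real" where
  "sensitivity e = (SOME \<Phi>. continuous_on (UNIV \<times> {..T}) (\<lambda>(\<theta>, s). \<Phi> \<theta> s) \<and>
    (\<forall>\<theta>. \<Phi> \<theta> T = e \<and> (\<forall>s\<le>T. (\<Phi> \<theta> has_vector_derivative secant_field \<theta> (\<Phi> \<theta> s) s) (at s within {..T}))))"

lemma sensitivity: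
  shows continuous_sensitivity: "continuous_on (UNIV \<times> {..T}) (\<lambda>(\<theta>, s). sensitivity e \<theta> s)"
    and sensitivity_end [simp]: "sensitivity e \<theta> T = e"
    and sensitivity_ode: "s \<le> T \<Longrightarrow> (sensitivity e \<theta> has_vector_derivative secant_field \<theta> (sensitivity e \<theta> s) s) (at s within {..T})"
  using someI_ex[OF terminal_ode.flow_exists[OF terminal_ode_secant continuous_on_const[of UNIV e]]]
  unfolding sensitivity_def[symmetric] by blast+

text \<open>The fundamental matrix of the secant system. On the diagonal its entries are the partial derivatives of
path and momentum in the terminal point (index \<open>x\<close>) and the terminal momentum (index \<open>p\<close>).\<close>
definition Y_x where "Y_x \<theta> s = fst (sensitivity (1, 0) \<theta> s)"
definition P_x where "P_x \<theta> s = snd (sensitivity (1, 0) \<theta> s)"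
definition Y_p where "Y_p \<theta> s = fst (sensitivity (0, 1) \<theta> s)"
definition P_p where "P_p \<theta> s = snd (sensitivity (0, 1) \<theta> s)"

lemma continuous_sensitivities:
  shows "continuous_on (UNIV \<times> {..T}) (\<lambda>(\<theta>, s). Y_x \<theta> s)"
    and "continuous_on (UNIV \<times> {..T}) (\<lambda>(\<theta>, s). P_x \<theta> s)"
    and "continuous_on (UNIV \<times> {..T}) (\<lambda>(\<theta>, s). Y_p \<theta> s)"
    and "continuous_on (UNIV \<times> {..T}) (\<lambda>(\<theta>, s). P_p \<theta> s)"
  using continuous_on_fst[OF continuous_sensitivity] continuous_on_snd[OF continuous_sensitivity]
  by (simp_all add: Y_x_def P_x_def Y_p_def P_p_def case_prod_unfold)

lemma sensitivity_components:
  assumes "s \<in> {t..T}"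
  shows "((\<lambda>s. fst (sensitivity e \<theta> s)) has_real_derivative
      secant_b \<theta> s * fst (sensitivity e \<theta> s) + snd (sensitivity e \<theta> s)) (at s within {t..T})"
    and "((\<lambda>s. snd (sensitivity e \<theta> s)) has_real_derivative
      - (secant_b1 \<theta> s * P (snd \<theta>) s) * fst (sensitivity e \<theta> s) - b1 (Y (fst \<theta>) s) s * snd (sensitivity e \<theta> s)) (at s within {t..T})"
proof -
  have "(sensitivity e \<theta> has_vector_derivative secant_field \<theta> (sensitivity e \<theta> s) s) (at s within {t..T})"
    using assms by (intro has_vector_derivative_within_subset[OF sensitivity_ode]) auto
  from bounded_linear.has_vector_derivative[OF bounded_linear_fst this]
    bounded_linear.has_vector_derivative[OF bounded_linear_snd this]
  show "((\<lambda>s. fst (sensitivity e \<theta> s)) has_real_derivative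
      secant_b \<theta> s * fst (sensitivity e \<theta> s) + snd (sensitivity e \<theta> s)) (at s within {t..T})"
    "((\<lambda>s. snd (sensitivity e \<theta> s)) has_real_derivative
      - (secant_b1 \<theta> s * P (snd \<theta>) s) * fst (sensitivity e \<theta> s) - b1 (Y (fst \<theta>) s) s * snd (sensitivity e \<theta> s)) (at s within {t..T})"
    by (simp_all add: has_real_derivative_iff_has_vector_derivative)
qed

text \<open>Both sides solve the secant system of the pair and agree at time \<open>T\<close>.\<close>
lemma extremal_difference:
  assumes "s \<le> T"
  shows "extremal \<theta>1 s - extremal \<theta>2 s =
    (fst \<theta>1 - fst \<theta>2) *\<^sub>R sensitivity (1, 0) (\<theta>1, \<theta>2) s + (snd \<theta>1 - snd \<theta>2) *\<^sub>R sensitivity (0, 1) (\<theta>1, \<theta>2) s"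
proof -
  let ?S1 = "sensitivity (1, 0) (\<theta>1, \<theta>2)" and ?S2 = "sensitivity (0, 1) (\<theta>1, \<theta>2)"
  let ?c = "fst \<theta>1 - fst \<theta>2" and ?d = "snd \<theta>1 - snd \<theta>2"
  have "(\<lambda>s. extremal \<theta>1 s - extremal \<theta>2 s) s = (\<lambda>s. ?c *\<^sub>R ?S1 s + ?d *\<^sub>R ?S2 s) s"
  proof (rule terminal_ode.solution_unique[OF terminal_ode_secant, where t = s and \<theta> = "(\<theta>1, \<theta>2)"])
    fix \<sigma> assume "\<sigma> \<in> {s..T}"
    then have \<sigma>: "\<sigma> \<le> T" by simp
    have d: "((\<lambda>s. extremal \<theta>1 s - extremal \<theta>2 s) has_vector_derivative
        hamiltonian_field \<theta>1 (extremal \<theta>1 \<sigma>) \<sigma> - hamiltonian_field \<theta>2 (extremal \<theta>2 \<sigma>) \<sigma>) (at \<sigma> within {..T})"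
      by (intro has_vector_derivative_diff extremal_ode \<sigma>)
    have eq: "hamiltonian_field \<theta>1 (extremal \<theta>1 \<sigma>) \<sigma> - hamiltonian_field \<theta>2 (extremal \<theta>2 \<sigma>) \<sigma> =
        secant_field (\<theta>1, \<theta>2) (extremal \<theta>1 \<sigma> - extremal \<theta>2 \<sigma>) \<sigma>"
    proof -
      have "b (Y \<theta>1 \<sigma>) \<sigma> - b (Y \<theta>2 \<sigma>) \<sigma> = secant_b (\<theta>1, \<theta>2) \<sigma> * (Y \<theta>1 \<sigma> - Y \<theta>2 \<sigma>)"
        using difference_eq_mean_slope[OF cont_b1 \<sigma>, where g = b] deriv_b[OF \<sigma>] by (simp add: secant_b_def)
      moreover have "b1 (Y \<theta>1 \<sigma>) \<sigma> - b1 (Y \<theta>2 \<sigma>) \<sigma> = secant_b1 (\<theta>1, \<theta>2) \<sigma> * (Y \<theta>1 \<sigma> - Y \<theta>2 \<sigma>)"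
        using difference_eq_mean_slope[OF cont_b2 \<sigma>, where g = b1] deriv_b1[OF \<sigma>] by (simp add: secant_b1_def)
      then have "secant_b1 (\<theta>1, \<theta>2) \<sigma> * P \<theta>2 \<sigma> * (Y \<theta>1 \<sigma> - Y \<theta>2 \<sigma>) = (b1 (Y \<theta>1 \<sigma>) \<sigma> - b1 (Y \<theta>2 \<sigma>) \<sigma>) * P \<theta>2 \<sigma>"
        by (simp add: mult_ac)
      ultimately show ?thesis
        unfolding Y_def P_def by (simp add: algebra_simps)
    qed
    show "((\<lambda>s. extremal \<theta>1 s - extremal \<theta>2 s) has_vector_derivative
        secant_field (\<theta>1, \<theta>2) (extremal \<theta>1 \<sigma> - extremal \<theta>2 \<sigma>) \<sigma>) (at \<sigma> within {s..T})"
      by (rule has_vector_derivative_within_subset[OF d[unfolded eq]]) auto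
    have d: "((\<lambda>s. ?c *\<^sub>R ?S1 s + ?d *\<^sub>R ?S2 s) has_vector_derivative
        ?c *\<^sub>R secant_field (\<theta>1, \<theta>2) (?S1 \<sigma>) \<sigma> + ?d *\<^sub>R secant_field (\<theta>1, \<theta>2) (?S2 \<sigma>) \<sigma>) (at \<sigma> within {..T})"
      by (intro has_vector_derivative_add bounded_linear.has_vector_derivative[OF bounded_linear_scaleR_right] sensitivity_ode \<sigma>)
    have eq: "?c *\<^sub>R secant_field (\<theta>1, \<theta>2) (?S1 \<sigma>) \<sigma> + ?d *\<^sub>R secant_field (\<theta>1, \<theta>2) (?S2 \<sigma>) \<sigma>
        = secant_field (\<theta>1, \<theta>2) (?c *\<^sub>R ?S1 \<sigma> + ?d *\<^sub>R ?S2 \<sigma>) \<sigma>"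
      by (simp add: algebra_simps)
    show "((\<lambda>s. ?c *\<^sub>R ?S1 s + ?d *\<^sub>R ?S2 s) has_vector_derivative
        secant_field (\<theta>1, \<theta>2) (?c *\<^sub>R ?S1 \<sigma> + ?d *\<^sub>R ?S2 \<sigma>) \<sigma>) (at \<sigma> within {s..T})"
      by (rule has_vector_derivative_within_subset[OF d[unfolded eq]]) auto
  next
    show "extremal \<theta>1 T - extremal \<theta>2 T = ?c *\<^sub>R ?S1 T + ?d *\<^sub>R ?S2 T"
      by (simp add: prod_eq_iff)
  qed (use assms in auto)
  then show ?thesis by simp
qed

lemma Y_difference:
  assumes "s \<le> T"
  shows "Y \<theta>1 s - Y \<theta>2 s = Y_x (\<theta>1, \<theta>2) s * (fst \<theta>1 - fst \<theta>2) + Y_p (\<theta>1, \<theta>2) s * (snd \<theta>1 - snd \<theta>2)"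
  and P_difference: "P \<theta>1 s - P \<theta>2 s = P_x (\<theta>1, \<theta>2) s * (fst \<theta>1 - fst \<theta>2) + P_p (\<theta>1, \<theta>2) s * (snd \<theta>1 - snd \<theta>2)"
  using arg_cong[OF extremal_difference[OF assms, of \<theta>1 \<theta>2], of fst] arg_cong[OF extremal_difference[OF assms, of \<theta>1 \<theta>2], of snd]
  by (simp_all add: Y_def P_def Y_x_def Y_p_def P_x_def P_p_def mult.commute)

text \<open>The last bound is where concavity enters the second-order theory: the mean slope of \<open>b1\<close> is nonpositive, so
with a nonnegative momentum the coupling from path to momentum has the sign required for a cooperative system.\<close>
lemma secant_bounds:
  assumes "s \<le> T" "snd (snd \<theta>) \<ge> 0"
  shows "\<bar>secant_b \<theta> s\<bar> \<le> A" "\<bar>b1 (Y (fst \<theta>) s) s\<bar> \<le> A" "- (secant_b1 \<theta> s * P (snd \<theta>) s) \<ge> 0"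
proof -
  have "- A \<le> b1 y s" "b1 y s \<le> A" for y using bound_b1[OF assms(1), of y] by auto
  then show "\<bar>secant_b \<theta> s\<bar> \<le> A"
    unfolding secant_b_def abs_le_iff
    using mean_slope_le[OF cont_b1 assms(1), of A] mean_slope_ge[OF cont_b1 assms(1), of "- A"]
    by (metis minus_le_iff)
  have "secant_b1 \<theta> s \<le> 0"
    unfolding secant_b1_def by (rule mean_slope_le[OF cont_b2 assms(1) b2_nonpos[OF assms(1)]])
  then show "- (secant_b1 \<theta> s * P (snd \<theta>) s) \<ge> 0"
    using P_nonneg[OF assms(2,1)] by (simp add: mult_nonpos_nonneg)
qed (use bound_b1 assms in auto)

text \<open>In the variables path and negative momentum the secant system is cooperative, and the first column starts
at \<open>(1, 0)\<close>.\<close>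
lemma Y_x_pos:
  assumes "t \<le> T" "snd (snd \<theta>) \<ge> 0"
  shows "Y_x \<theta> t > 0"
proof -
  let ?S = "sensitivity (1, 0) \<theta>"
  have "fst (?S t) \<ge> fst (?S T) * exp (- (A * (T - t)))"
  proof (rule cooperative_system(1)[where t = t and v = "\<lambda>s. - snd (?S s)" and \<kappa> = "\<lambda>_. 1"
        and \<alpha> = "\<lambda>s. - secant_b \<theta> s" and \<beta> = "\<lambda>s. b1 (Y (fst \<theta>) s) s" and \<gamma> = "\<lambda>s. - (secant_b1 \<theta> s * P (snd \<theta>) s)"])
    fix s assume s: "s \<in> {t..T}"
    show "((\<lambda>s. fst (?S s)) has_real_derivative - (- secant_b \<theta> s * fst (?S s) + 1 * - snd (?S s))) (at s within {t..T})"
      using sensitivity_components(1)[OF s, of "(1, 0)" \<theta>] by (simp add: add.commute)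
    show "((\<lambda>s. - snd (?S s)) has_real_derivative
        - (b1 (Y (fst \<theta>) s) s * - snd (?S s) + - (secant_b1 \<theta> s * P (snd \<theta>) s) * fst (?S s))) (at s within {t..T})"
      using DERIV_minus[OF sensitivity_components(2)[OF s, of "(1, 0)" \<theta>]] by (simp add: algebra_simps)
    show "\<bar>- secant_b \<theta> s\<bar> \<le> A \<and> \<bar>b1 (Y (fst \<theta>) s) s\<bar> \<le> A \<and> 0 \<le> (1 :: real) \<and> 0 \<le> - (secant_b1 \<theta> s * P (snd \<theta>) s)"
      using secant_bounds[of s \<theta>] s assms by simp
  qed (use assms in auto)
  then have "exp (- (A * (T - t))) \<le> Y_x \<theta> t" by (simp add: Y_x_def)
  then show ?thesis using exp_gt_zero[of "- (A * (T - t))"] by linarith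
qed

text \<open>In the variables momentum and negative path the secant system is cooperative, and the second column starts
at \<open>(1, 0)\<close>.\<close>
lemma P_p_ge_Y_p_nonpos:
  assumes "t \<le> T" "snd (snd \<theta>) \<ge> 0"
  shows "P_p \<theta> t \<ge> exp (- (A * (T - t)))"
    and "Y_p \<theta> t \<le> 0"
proof -
  let ?S = "sensitivity (0, 1) \<theta>"
  have d1: "((\<lambda>s. snd (?S s)) has_real_derivative
      - (b1 (Y (fst \<theta>) s) s * snd (?S s) + - (secant_b1 \<theta> s * P (snd \<theta>) s) * - fst (?S s))) (at s within {t..T})"
    and d2: "((\<lambda>s. - fst (?S s)) has_real_derivative - (- secant_b \<theta> s * - fst (?S s) + 1 * snd (?S s))) (at s within {t..T})"
    if s: "s \<in> {t..T}" for s
    by (rule DERIV_cong[OF sensitivity_components(2)[OF s]], simp add: algebra_simps)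
      (rule DERIV_cong[OF DERIV_minus[OF sensitivity_components(1)[OF s]]], simp add: algebra_simps)
  have bounds: "\<bar>b1 (Y (fst \<theta>) s) s\<bar> \<le> A \<and> \<bar>- secant_b \<theta> s\<bar> \<le> A \<and> 0 \<le> - (secant_b1 \<theta> s * P (snd \<theta>) s) \<and> 0 \<le> (1 :: real)"
    if s: "s \<in> {t..T}" for s
    using secant_bounds[of s \<theta>] s assms by simp
  have "snd (?S t) \<ge> snd (?S T) * exp (- (A * (T - t)))"
    by (rule cooperative_system(1)[OF d1 d2 bounds]) (use assms in auto)
  then show "P_p \<theta> t \<ge> exp (- (A * (T - t)))" by (simp add: P_p_def)
  have "- fst (?S t) \<ge> 0"
    by (rule cooperative_system(2)[OF d1 d2 bounds]) (use assms in auto)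
  then show "Y_p \<theta> t \<le> 0" by (simp add: Y_p_def)
qed

text \<open>The momentum entry is bounded below and drives the path entry away from zero as soon as \<open>t < T\<close>. The bound
does not depend on the pair of terminal data, so it also shows that the path of an extremal tends to minus
infinity as its terminal momentum grows.\<close>
lemma Y_p_le:
  assumes "t \<le> T" "snd (snd \<theta>) \<ge> 0"
  shows "Y_p \<theta> t \<le> - ((T - t) * exp (- (2 * A * (T - t))))"
proof -
  define m where "m = exp (- (A * (T - t)))"
  define w where "w s = - Y_p \<theta> s * exp (A * (T - s)) - m * (T - s)" for s
  have "w T \<le> w t"
  proof (rule nonpos_derivative_imp_decrease[where f = w])
    fix s assume s: "s \<in> {t..T}"
    have "(Y_p \<theta> has_real_derivative secant_b \<theta> s * Y_p \<theta> s + P_p \<theta> s) (at s within {t..T})"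
      using sensitivity_components(1)[OF s, of "(0, 1)" \<theta>] by (simp add: Y_p_def[abs_def] P_p_def)
    then show "(w has_real_derivative
        - (P_p \<theta> s + (secant_b \<theta> s - A) * Y_p \<theta> s) * exp (A * (T - s)) + m) (at s within {t..T})"
      unfolding w_def by (auto intro!: derivative_eq_intros simp: algebra_simps)
    have "m \<le> exp (- (A * (T - s)))"
      using s A_nonneg by (auto simp: m_def intro!: mult_left_mono)
    also have "\<dots> \<le> P_p \<theta> s" using s assms by (intro P_p_ge_Y_p_nonpos) auto
    finally have "m \<le> P_p \<theta> s" .
    moreover have "0 \<le> (secant_b \<theta> s - A) * Y_p \<theta> s"
      using secant_bounds(1)[of s \<theta>] P_p_ge_Y_p_nonpos(2)[of s \<theta>] s assms by (intro mult_nonpos_nonpos) auto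
    ultimately have le: "m \<le> P_p \<theta> s + (secant_b \<theta> s - A) * Y_p \<theta> s" by simp
    have "m > 0" by (simp add: m_def)
    with le have "m * 1 \<le> (P_p \<theta> s + (secant_b \<theta> s - A) * Y_p \<theta> s) * exp (A * (T - s))"
      using s A_nonneg by (intro mult_mono) auto
    then show "- (P_p \<theta> s + (secant_b \<theta> s - A) * Y_p \<theta> s) * exp (A * (T - s)) + m \<le> 0" by linarith
  qed (use assms in auto)
  then have "m * (T - t) * m \<le> - Y_p \<theta> t * exp (A * (T - t)) * m"
    by (intro mult_right_mono) (auto simp: w_def Y_p_def m_def)
  also have "\<dots> = - Y_p \<theta> t" by (simp add: m_def mult.assoc flip: exp_add)
  also have "m * (T - t) * m = (T - t) * (m * m)" by simp
  also have "m * m = exp (- (2 * A * (T - t)))" by (simp add: m_def flip: exp_add)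
  finally show ?thesis by simp
qed

lemma Y_p_neg:
  assumes "t < T" "snd (snd \<theta>) \<ge> 0"
  shows "Y_p \<theta> t < 0"
  using order.strict_trans1[OF Y_p_le[of t \<theta>], of 0] assms by simp

end

section \<open>Extremals are minimisers\<close>

text \<open>The path is only absolutely continuous, so the classical rule does not apply. Instead, the order of the two
integrations in the integral of \<open>p' s * h r\<close> over \<open>r \<le> s\<close> is exchanged.\<close>
lemma path_from_by_parts:
  fixes p p' h :: "real \<Rightarrow> real"
  assumes der: "\<And>s. s \<in> {t..T} \<Longrightarrow> (p has_real_derivative p' s) (at s within {t..T})"
    and cont: "continuous_on {t..T} p'" and h: "integrable (lebesgue_on {t..T}) h" and "t \<le> T"
  shows "(LINT s|lebesgue_on {t..T}. p s * h s + p' s * path_from z t h s) = p T * path_from z t h T - p t * z"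
proof -
  define M where "M = lebesgue_on {t..T}"
  have "finite_measure M"
    using finite_measure_lebesgue_on[of "{t..T}"] lmeasurable_cbox[of t T] by (simp add: M_def)
  then interpret finite_measure M .
  interpret pair_sigma_finite M M
    by (simp add: pair_sigma_finite_def sigma_finite_measure_axioms)
  have hM: "integrable M h" using h by (simp add: M_def)
  have pM: "integrable M p'" using continuous_imp_integrable_real[OF cont] by (simp add: M_def)
  have idM: "integrable M (\<lambda>s. s)"
    unfolding M_def by (intro continuous_imp_integrable_real continuous_intros)
  have [measurable]: "h \<in> borel_measurable M" "p' \<in> borel_measurable M" "(\<lambda>s. s) \<in> borel_measurable M"
    using hM pM idM by auto
  have p: "continuous_on {t..T} p" using der by (rule DERIV_continuous_on)
  have "bounded (p' ` {t..T})" using cont by (intro compact_imp_bounded compact_continuous_image) auto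
  then obtain K where K: "\<And>s. s \<in> {t..T} \<Longrightarrow> \<bar>p' s\<bar> \<le> K"
    unfolding bounded_iff by (metis imageI real_norm_def)
  let ?f = "\<lambda>(s, r). p' s * (if r \<le> s then h r else 0)"
  have "integrable (M \<Otimes>\<^sub>M M) (\<lambda>x. h (snd x))"
    by (rule Fubini_integrable) (use hM in auto)
  then have "integrable (M \<Otimes>\<^sub>M M) (\<lambda>x. K * h (snd x))" by simp
  then have int: "integrable (M \<Otimes>\<^sub>M M) ?f"
  proof (rule Bochner_Integration.integrable_bound)
    show "?f \<in> borel_measurable (M \<Otimes>\<^sub>M M)" by measurable
    show "AE x in M \<Otimes>\<^sub>M M. norm (?f x) \<le> norm (K * h (snd x))"
    proof (rule AE_I2)
      fix x assume "x \<in> space (M \<Otimes>\<^sub>M M)"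
      then have "\<bar>p' (fst x)\<bar> \<le> \<bar>K\<bar>" using K[of "fst x"] by (force simp: M_def space_pair_measure)
      then show "norm (?f x) \<le> norm (K * h (snd x))"
        by (auto simp: case_prod_unfold abs_mult intro!: mult_right_mono)
    qed
  qed
  have inner1: "(\<integral>r. p' s * (if r \<le> s then h r else 0) \<partial>M) = p' s * (path_from z t h s - z)" if "s \<in> {t..T}" for s
  proof -
    have "(\<integral>r. (if r \<le> s then h r else 0) \<partial>M) = (\<integral>r. (if r \<in> {t..s} then h r else 0) \<partial>M)"
      by (intro Bochner_Integration.integral_cong) (auto simp: M_def)
    also have "\<dots> = (LINT r|lebesgue_on {t..s}. h r)"
      unfolding M_def using that by (intro integral_restrict) auto
    finally show ?thesis by (simp add: path_from_def)
  qed
  have inner2: "(\<integral>s. p' s * (if r \<le> s then h r else 0) \<partial>M) = (p T - p r) * h r" if r: "r \<in> {t..T}" for r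
  proof -
    have "(\<integral>s. p' s * (if r \<le> s then h r else 0) \<partial>M) = (\<integral>s. (if s \<in> {r..T} then p' s * h r else 0) \<partial>M)"
      by (intro Bochner_Integration.integral_cong) (auto simp: M_def)
    also have "\<dots> = (LINT s|lebesgue_on {r..T}. p' s * h r)"
      unfolding M_def using r by (intro integral_restrict) auto
    also have "\<dots> = (LINT s|lebesgue_on {r..T}. p' s) * h r" by simp
    also have "(LINT s|lebesgue_on {r..T}. p' s) = p T - p r"
    proof -
      have "continuous_on {r..T} p'" using r by (intro continuous_on_subset[OF cont]) auto
      moreover have "(p has_real_derivative p' s) (at s within {r..T})" if "s \<in> {r..T}" for s
        using that r by (intro DERIV_subset[OF der, where t = "{r..T}"]) auto
      ultimately have "path_from (p r) r p' T = p T" using r by (intro path_from_derivative[where t = r and T = T]) auto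
      then show ?thesis by (simp add: path_from_def)
    qed
    finally show ?thesis .
  qed
  have "(\<integral>s. p' s * (path_from z t h s - z) \<partial>M) = (\<integral>s. (\<integral>r. p' s * (if r \<le> s then h r else 0) \<partial>M) \<partial>M)"
    by (intro Bochner_Integration.integral_cong refl inner1[symmetric]) (simp add: M_def)
  also have "\<dots> = (\<integral>r. (\<integral>s. p' s * (if r \<le> s then h r else 0) \<partial>M) \<partial>M)"
    using Fubini_integral[OF int] by simp
  also have "\<dots> = (\<integral>r. (p T - p r) * h r \<partial>M)"
    by (intro Bochner_Integration.integral_cong refl inner2) (simp add: M_def)
  finally have fub: "(\<integral>s. p' s * (path_from z t h s - z) \<partial>M) = (\<integral>r. (p T - p r) * h r \<partial>M)" .
  have prod: "integrable M (\<lambda>s. g s * h s)" if "continuous_on {t..T} g" for g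
  proof -
    have "bounded (g ` {t..T})" using that by (intro compact_imp_bounded compact_continuous_image) auto
    then obtain C where C: "\<And>s. s \<in> {t..T} \<Longrightarrow> \<bar>g s\<bar> \<le> C"
      unfolding bounded_iff by (metis imageI real_norm_def)
    have "integrable M (\<lambda>s. \<bar>C\<bar> * h s)" using hM by simp
    then show ?thesis
    proof (rule Bochner_Integration.integrable_bound)
      have "g \<in> borel_measurable M"
        using continuous_imp_integrable_real[OF that] by (auto simp: M_def)
      then show "(\<lambda>s. g s * h s) \<in> borel_measurable M" by measurable
      show "AE s in M. norm (g s * h s) \<le> norm (\<bar>C\<bar> * h s)"
      proof (rule AE_I2)
        fix s assume "s \<in> space M"
        then have "\<bar>g s\<bar> \<le> \<bar>C\<bar>" using C[of s] by (auto simp: M_def)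
        then show "norm (g s * h s) \<le> norm (\<bar>C\<bar> * h s)" by (simp add: abs_mult mult_right_mono)
      qed
    qed
  qed
  have path: "integrable M (\<lambda>s. p' s * path_from z t h s)"
    unfolding M_def by (intro continuous_imp_integrable_real continuous_intros cont continuous_path_from h)
  have "(\<integral>s. p' s * path_from z t h s \<partial>M) = (\<integral>s. p' s * (path_from z t h s - z) \<partial>M) + (\<integral>s. p' s \<partial>M) * z"
    using path pM by (simp add: right_diff_distrib)
  also have "(\<integral>s. p' s \<partial>M) = p T - p t"
    using path_from_derivative[OF der cont, of T] \<open>t \<le> T\<close> by (simp add: path_from_def M_def)
  also have "(\<integral>s. p' s * (path_from z t h s - z) \<partial>M) = p T * (path_from z t h T - z) - (\<integral>s. p s * h s \<partial>M)"
    unfolding fub using hM prod[OF p] by (simp add: left_diff_distrib path_from_def M_def)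
  finally have "(\<integral>s. p' s * path_from z t h s \<partial>M) + (\<integral>s. p s * h s \<partial>M) = p T * path_from z t h T - p t * z"
    by (simp add: algebra_simps)
  then show ?thesis
    using path prod[OF p] by (simp add: M_def)
qed

context smooth_concave_drift
begin

lemma continuous_extremal_slice:
  shows "continuous_on {t..T} (Y \<theta>)" "continuous_on {t..T} (P \<theta>)"
    "continuous_on {t..T} (\<lambda>s. b (Y \<theta> s) s)" "continuous_on {t..T} (\<lambda>s. b1 (Y \<theta> s) s)"
proof -
  show Y: "continuous_on {t..T} (Y \<theta>)" using Y_ode' by (rule DERIV_continuous_on)
  show "continuous_on {t..T} (P \<theta>)" using P_ode' by (rule DERIV_continuous_on)
  show "continuous_on {t..T} (\<lambda>s. b (Y \<theta> s) s)" by (rule continuous_b_along[OF Y])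
  have "continuous_on {t..T} (\<lambda>s. (\<lambda>(y, s). b1 y s) (Y \<theta> s, s))"
    by (intro continuous_on_compose2[OF cont_b1]) (auto intro!: continuous_intros Y)
  then show "continuous_on {t..T} (\<lambda>s. b1 (Y \<theta> s) s)" by simp
qed

text \<open>The action of the extremal on \<open>{t..T}\<close>, whose residual is its momentum.\<close>
definition min_value :: "real \<times> real \<Rightarrow> real \<Rightarrow> real" where
  "min_value \<theta> t = 1/2 * (LINT s|lebesgue_on {t..T}. (P \<theta> s)\<^sup>2)"

text \<open>The verification argument. For every residual \<open>r\<close> and momentum \<open>p\<close> one has \<open>r\<^sup>2 / 2 \<ge> p * r - p\<^sup>2 / 2\<close>. As
\<open>p \<ge> 0\<close>, concavity allows to replace the drift along the competing path by its tangent at the extremal, and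
by Hamilton's equations the remaining first-order terms are the derivative of the product \<open>p * W\<close> with the
difference \<open>W\<close> of the two paths. Integrated, they leave boundary terms only.\<close>
lemma action_ge_affine:
  assumes "t < T" "snd \<theta> \<ge> 0" and f: "admissible x y t f"
  shows "min_value \<theta> t + snd \<theta> * (x - fst \<theta>) - P \<theta> t * (y - Y \<theta> t) \<le> action b T y t f"
proof -
  define k where "k s = b (Y \<theta> s) s + P \<theta> s" for s
  define Z where "Z = path_from y t f"
  define h where "h s = f s - k s" for s
  have sq: "square_integrable_on f {t..T}" and endpoint: "Z T \<ge> x" using f by (auto simp: admissible_def Z_def)
  have ck: "continuous_on {t..T} k"
    unfolding k_def by (intro continuous_intros continuous_extremal_slice)
  have sk: "square_integrable_on k {t..T}" by (rule square_integrable_continuous[OF ck])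
  have sh: "square_integrable_on h {t..T}" unfolding h_def by (rule square_integrable_diff[OF sq sk])
  have sr: "square_integrable_on (\<lambda>s. f s - b (Z s) s) {t..T}"
    unfolding Z_def by (rule square_integrable_residual[OF sq])
  have sP: "square_integrable_on (P \<theta>) {t..T}" by (rule square_integrable_continuous[OF continuous_extremal_slice(2)])
  have Zh: "path_from (y - Y \<theta> t) t h s = Z s - Y \<theta> s" if s: "s \<in> {t..T}" for s
  proof -
    have "path_from (1 * y + (-1) * Y \<theta> t) t (\<lambda>s. 1 * f s + (-1) * k s) s
        = 1 * path_from y t f s + (-1) * path_from (Y \<theta> t) t k s"
      by (rule path_from_combination[OF square_integrable_imp_integrable[OF sq] square_integrable_imp_integrable[OF sk] s])
    moreover have "path_from (Y \<theta> t) t k s = Y \<theta> s"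
      by (rule path_from_derivative[OF _ ck s]) (simp add: k_def Y_ode')
    ultimately show ?thesis by (simp add: h_def[abs_def] Z_def)
  qed
  define W where "W = path_from (y - Y \<theta> t) t h"
  have cW: "continuous_on {t..T} W"
    unfolding W_def by (rule continuous_path_from[OF square_integrable_imp_integrable[OF sh]])
  have parts: "(LINT s|lebesgue_on {t..T}. P \<theta> s * h s + - (b1 (Y \<theta> s) s * P \<theta> s) * W s)
      = snd \<theta> * W T - P \<theta> t * (y - Y \<theta> t)"
    using path_from_by_parts[OF P_ode' _ square_integrable_imp_integrable[OF sh], of \<theta> "y - Y \<theta> t"] \<open>t < T\<close>
    by (simp add: W_def continuous_intros continuous_extremal_slice)
  have int1: "integrable (lebesgue_on {t..T}) (\<lambda>s. P \<theta> s * h s + - (b1 (Y \<theta> s) s * P \<theta> s) * W s)"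
    by (intro Bochner_Integration.integrable_add square_integrable_mult[OF sP sh]
        continuous_imp_integrable_real continuous_intros continuous_extremal_slice cW)
  have int2: "integrable (lebesgue_on {t..T}) (\<lambda>s. 1/2 * (P \<theta> s)\<^sup>2)"
    using sP by (simp add: square_integrable_on_def)
  have "min_value \<theta> t + snd \<theta> * (x - fst \<theta>) \<le> min_value \<theta> t + snd \<theta> * W T"
    using assms(1,2) endpoint Zh[of T] by (auto simp: W_def intro!: mult_left_mono)
  then have "min_value \<theta> t + snd \<theta> * (x - fst \<theta>) - P \<theta> t * (y - Y \<theta> t)
      \<le> (LINT s|lebesgue_on {t..T}. 1/2 * (P \<theta> s)\<^sup>2 + (P \<theta> s * h s + - (b1 (Y \<theta> s) s * P \<theta> s) * W s))"
    using int1 int2 parts by (simp add: min_value_def)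
  also have "\<dots> \<le> (LINT s|lebesgue_on {t..T}. 1/2 * (f s - b (Z s) s)\<^sup>2)"
  proof (rule integral_mono)
    fix s assume "s \<in> space (lebesgue_on {t..T})"
    then have s: "s \<in> {t..T}" by simp
    have "P \<theta> s * b (Z s) s \<le> P \<theta> s * (b (Y \<theta> s) s + b1 (Y \<theta> s) s * (Z s - Y \<theta> s))"
      using s P_nonneg[OF assms(2), of s] b_tangent[of s "Z s" "Y \<theta> s"] by (intro mult_left_mono) auto
    moreover have "P \<theta> s * (f s - b (Z s) s) - 1/2 * (P \<theta> s)\<^sup>2 \<le> 1/2 * (f s - b (Z s) s)\<^sup>2"
      using zero_le_power2[of "P \<theta> s - (f s - b (Z s) s)"] by (simp add: power2_eq_square algebra_simps)
    moreover have W: "W s = Z s - Y \<theta> s" using Zh[OF s] by (simp add: W_def)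
    ultimately show "1/2 * (P \<theta> s)\<^sup>2 + (P \<theta> s * h s + - (b1 (Y \<theta> s) s * P \<theta> s) * W s) \<le> 1/2 * (f s - b (Z s) s)\<^sup>2"
      by (simp add: W h_def k_def power2_eq_square algebra_simps)
  next
    show "integrable (lebesgue_on {t..T}) (\<lambda>s. 1/2 * (f s - b (Z s) s)\<^sup>2)"
      using sr by (simp add: square_integrable_on_def)
  qed (intro Bochner_Integration.integrable_add int1 int2)
  also have "\<dots> = action b T y t f" by (simp add: action_def Z_def)
  finally show ?thesis .
qed

lemma q_extremal:
  assumes "t < T" "snd \<theta> \<ge> 0"
  shows "q b T (fst \<theta>) (Y \<theta> t) t = min_value \<theta> t"
proof (rule antisym)
  define k where "k s = b (Y \<theta> s) s + P \<theta> s" for s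
  have ck: "continuous_on {t..T} k"
    unfolding k_def by (intro continuous_intros continuous_extremal_slice)
  have path: "path_from (Y \<theta> t) t k s = Y \<theta> s" if "s \<in> {t..T}" for s
    by (rule path_from_derivative[OF _ ck that]) (simp add: k_def Y_ode')
  have "admissible (fst \<theta>) (Y \<theta> t) t k"
    using path[of T] assms(1) square_integrable_continuous[OF ck] by (simp add: admissible_def)
  then have "q b T (fst \<theta>) (Y \<theta> t) t \<le> action b T (Y \<theta> t) t k" by (rule q_le_action)
  also have "\<dots> = min_value \<theta> t"
    unfolding action_def min_value_def
    by (intro arg_cong2[where f = "(*)"] refl Bochner_Integration.integral_cong) (auto simp: path k_def)
  finally show "q b T (fst \<theta>) (Y \<theta> t) t \<le> min_value \<theta> t" .
  show "min_value \<theta> t \<le> q b T (fst \<theta>) (Y \<theta> t) t"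
    using action_ge_affine[OF assms, of "fst \<theta>" "Y \<theta> t"] by (intro q_greatest assms(1)) simp
qed

text \<open>The affine bound is uniform over all controls and attained by the extremal, so the pair of terminal and
negative initial momentum is a subgradient of the minimal action.\<close>
lemma q_subgradient:
  assumes "t < T" "snd \<theta> \<ge> 0"
  shows "q b T (fst \<theta>) (Y \<theta> t) t + snd \<theta> * (x - fst \<theta>) - P \<theta> t * (y - Y \<theta> t) \<le> q b T x y t"
  unfolding q_extremal[OF assms] by (rule q_greatest[OF assms(1) action_ge_affine[OF assms]])

end

section \<open>Derivatives from secant slopes\<close>

lemma has_derivative_of_error_bound:
  fixes g :: "real \<times> real \<Rightarrow> real"
  assumes bound: "\<forall>\<^sub>F z in at z0. \<bar>g z - g z0 - (a * (fst z - fst z0) + d * (snd z - snd z0))\<bar> \<le> \<epsilon> z * norm (z - z0)"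
    and \<epsilon>: "(\<epsilon> \<longlongrightarrow> 0) (at z0)"
  shows "(g has_derivative (\<lambda>h. a * fst h + d * snd h)) (at z0)"
  unfolding has_derivative_within
proof
  show "bounded_linear (\<lambda>h :: real \<times> real. a * fst h + d * snd h)"
    by (intro bounded_linear_add bounded_linear_const_mult bounded_linear_fst bounded_linear_snd)
  show "((\<lambda>z. (1 / norm (z - z0)) *\<^sub>R (g z - (g z0 + (a * fst (z - z0) + d * snd (z - z0))))) \<longlongrightarrow> 0) (at z0)"
  proof (rule Lim_null_comparison[OF _ \<epsilon>])
    have "\<forall>\<^sub>F z in at z0. z \<noteq> z0" by (auto simp: eventually_at_filter)
    with bound show "\<forall>\<^sub>F z in at z0. norm ((1 / norm (z - z0)) *\<^sub>R (g z - (g z0 + (a * fst (z - z0) + d * snd (z - z0))))) \<le> \<epsilon> z"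
    proof eventually_elim
      case (elim z)
      then have "norm (z - z0) > 0" by simp
      moreover have "\<bar>g z - (g z0 + (a * fst (z - z0) + d * snd (z - z0)))\<bar> \<le> \<epsilon> z * norm (z - z0)"
        using elim by (simp add: algebra_simps)
      ultimately show ?case by (simp add: divide_le_eq)
    qed
  qed
qed

text \<open>Differentiability in the sense of Caratheodory: an exact secant representation with slopes that have limits.\<close>
lemma has_derivative_of_secant_slopes:
  fixes g :: "real \<times> real \<Rightarrow> real"
  assumes eq: "\<forall>\<^sub>F z in at z0. g z - g z0 = \<alpha> z * (fst z - fst z0) + \<beta> z * (snd z - snd z0)"
    and \<alpha>: "(\<alpha> \<longlongrightarrow> a) (at z0)" and \<beta>: "(\<beta> \<longlongrightarrow> d) (at z0)"
  shows "(g has_derivative (\<lambda>h. a * fst h + d * snd h)) (at z0)"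
proof (rule has_derivative_of_error_bound)
  show "\<forall>\<^sub>F z in at z0. \<bar>g z - g z0 - (a * (fst z - fst z0) + d * (snd z - snd z0))\<bar>
      \<le> (\<bar>\<alpha> z - a\<bar> + \<bar>\<beta> z - d\<bar>) * norm (z - z0)"
    using eq
  proof eventually_elim
    case (elim z)
    have "g z - g z0 - (a * (fst z - fst z0) + d * (snd z - snd z0))
        = (\<alpha> z - a) * (fst z - fst z0) + (\<beta> z - d) * (snd z - snd z0)"
      using elim by (simp add: algebra_simps)
    also have "\<bar>\<dots>\<bar> \<le> \<bar>\<alpha> z - a\<bar> * \<bar>fst z - fst z0\<bar> + \<bar>\<beta> z - d\<bar> * \<bar>snd z - snd z0\<bar>"
      by (rule order.trans[OF abs_triangle_ineq]) (simp add: abs_mult)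
    also have "\<dots> \<le> \<bar>\<alpha> z - a\<bar> * norm (z - z0) + \<bar>\<beta> z - d\<bar> * norm (z - z0)"
      using abs_components_le_norm[of "z - z0"] by (intro add_mono mult_left_mono) auto
    finally show ?case by (simp add: algebra_simps)
  qed
  have "((\<lambda>z. \<bar>\<alpha> z - a\<bar> + \<bar>\<beta> z - d\<bar>) \<longlongrightarrow> \<bar>a - a\<bar> + \<bar>d - d\<bar>) (at z0)"
    by (intro tendsto_intros \<alpha> \<beta>)
  then show "((\<lambda>z. \<bar>\<alpha> z - a\<bar> + \<bar>\<beta> z - d\<bar>) \<longlongrightarrow> 0) (at z0)" by simp
qed

lemma partial_derivatives_of_has_derivative:
  fixes g :: "real \<times> real \<Rightarrow> real"
  assumes "(g has_derivative (\<lambda>h. a * fst h + d * snd h)) (at (x, y))"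
  shows "((\<lambda>u. g (u, y)) has_real_derivative a) (at x)"
    and "((\<lambda>v. g (x, v)) has_real_derivative d) (at y)"
proof -
  have "((\<lambda>u. (u, y)) has_derivative (\<lambda>h. (h, 0))) (at x)"
    "((\<lambda>v. (x, v)) has_derivative (\<lambda>h. (0, h))) (at y)"
    by (auto intro!: derivative_eq_intros)
  from has_derivative_compose[OF this(1) assms] has_derivative_compose[OF this(2) assms]
  show "((\<lambda>u. g (u, y)) has_real_derivative a) (at x)"
    "((\<lambda>v. g (x, v)) has_real_derivative d) (at y)"
    by (simp_all add: has_field_derivative_def)
qed

section \<open>The Hessian of the minimal action\<close>

context smooth_concave_drift
begin

text \<open>Besides \<open>U\<close> the region contains the points with \<open>y = F x t\<close>, which correspond to zero terminal momentum.
Working on this larger set makes the limits at the boundary of \<open>U\<close> a matter of continuity.\<close>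
definition region :: "(real \<times> real \<times> real) set" where
  "region = {(x, y, t). t < T \<and> y \<le> Y (x, 0) t}"

text \<open>The terminal momentum of the extremal that joins \<open>y\<close> at time \<open>t\<close> to \<open>x\<close> at time \<open>T\<close>. It is also the
Lagrange multiplier of the endpoint constraint.\<close>
definition multiplier :: "real \<times> real \<times> real \<Rightarrow> real" where
  "multiplier c = (SOME p. p \<ge> 0 \<and> Y (fst c, p) (snd (snd c)) = fst (snd c))"

lemma Y_strict_antimono:
  assumes "t < T" "0 \<le> p" "p < p'"
  shows "Y (x, p') t < Y (x, p) t"
  using Y_difference[of t "(x, p')" "(x, p)"] Y_p_neg[of t "((x, p'), (x, p))"] assms
    mult_neg_pos[of "Y_p ((x, p'), (x, p)) t" "p' - p"] by simp

lemma multiplier_exists: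
  assumes "t < T" "y \<le> Y (x, 0) t"
  shows "\<exists>p\<ge>0. Y (x, p) t = y"
proof -
  define \<kappa> where "\<kappa> = (T - t) * exp (- (2 * A * (T - t)))"
  have \<kappa>: "\<kappa> > 0" using assms(1) by (simp add: \<kappa>_def)
  \<comment> \<open>Since \<open>Y\<close> falls in \<open>p\<close> at least at the rate \<open>\<kappa>\<close>, this momentum brings it down to \<open>y\<close>.\<close>
  define p where "p = (Y (x, 0) t - y) / \<kappa>"
  have p: "p \<ge> 0" using assms(2) \<kappa> by (simp add: p_def)
  have "Y (x, p) t - Y (x, 0) t = Y_p ((x, p), (x, 0)) t * p"
    using Y_difference[of t "(x, p)" "(x, 0)"] assms(1) by simp
  also have "\<dots> \<le> - \<kappa> * p"
    using Y_p_le[of t "((x, p), (x, 0))"] assms(1) p by (intro mult_right_mono) (auto simp: \<kappa>_def)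
  also have "\<dots> = y - Y (x, 0) t" using \<kappa> by (simp add: p_def)
  finally have "Y (x, p) t \<le> y" by simp
  moreover have "continuous_on {0..p} (\<lambda>p. Y (x, p) t)"
  proof -
    have "continuous_on {0..p} (\<lambda>p. (\<lambda>(\<theta>, s). Y \<theta> s) ((x, p), t))"
      by (rule continuous_on_compose2[OF continuous_Y]) (use assms(1) in \<open>auto intro!: continuous_intros\<close>)
    then show ?thesis by simp
  qed
  ultimately show ?thesis
    using IVT2'[of "\<lambda>p. Y (x, p) t" p y 0] assms(2) p by auto
qed

lemma multiplier:
  assumes "(x, y, t) \<in> region"
  shows "multiplier (x, y, t) \<ge> 0" "Y (x, multiplier (x, y, t)) t = y"
  using someI_ex[OF multiplier_exists[of t y x, unfolded Bex_def]] assms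
  unfolding multiplier_def region_def by auto

lemma continuous_Y_compose:
  assumes "continuous_on S g" "continuous_on S \<tau>" "\<And>c. c \<in> S \<Longrightarrow> \<tau> c \<le> T"
  shows "continuous_on S (\<lambda>c. Y (g c) (\<tau> c))" "continuous_on S (\<lambda>c. P (g c) (\<tau> c))"
proof -
  have "continuous_on S (\<lambda>c. (\<lambda>(\<theta>, s). Y \<theta> s) (g c, \<tau> c))"
    by (rule continuous_on_compose2[OF continuous_Y]) (auto intro!: continuous_intros assms)
  then show "continuous_on S (\<lambda>c. Y (g c) (\<tau> c))" by simp
  have "continuous_on S (\<lambda>c. (\<lambda>(\<theta>, s). P \<theta> s) (g c, \<tau> c))"
    by (rule continuous_on_compose2[OF continuous_P]) (auto intro!: continuous_intros assms)
  then show "continuous_on S (\<lambda>c. P (g c) (\<tau> c))" by simp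
qed

text \<open>The multiplier is the level at which the continuous function \<open>Y (x, _) t\<close>, strictly decreasing on the
nonnegative axis, takes the value \<open>y\<close>. Such a level depends continuously on all data, also at
multiplier \<open>0\<close>, where only one side has to be controlled.\<close>
lemma continuous_multiplier: "continuous_on region multiplier"
  unfolding continuous_on_def
proof
  fix c0 assume c0: "c0 \<in> region"
  obtain x0 y0 t0 where c0_eq: "c0 = (x0, y0, t0)" by (cases c0)
  have t0: "t0 < T" using c0 by (simp add: c0_eq region_def)
  have gap: "((\<lambda>c. Y (fst c, a) (snd (snd c)) - fst (snd c)) \<longlongrightarrow> Y (x0, a) t0 - y0) (at c0 within region)" for a
  proof -
    have "continuous_on region (\<lambda>c. Y (fst c, a) (snd (snd c)) - fst (snd c))"
      by (intro continuous_intros continuous_Y_compose) (auto simp: region_def)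
    then show ?thesis using c0 by (auto simp: continuous_on_def c0_eq)
  qed
  have ev: "\<forall>\<^sub>F c in at c0 within region. c \<in> region" by (auto simp: eventually_at_filter)
  have m0: "multiplier c0 \<ge> 0" "Y (x0, multiplier c0) t0 = y0"
    using multiplier[of x0 y0 t0] c0 by (auto simp: c0_eq)
  show "(multiplier \<longlongrightarrow> multiplier c0) (at c0 within region)"
  proof (rule order_tendstoI)
    fix a assume a: "multiplier c0 < a"
    then have "Y (x0, a) t0 - y0 < 0" using Y_strict_antimono[OF t0 m0(1) a, of x0] m0 by simp
    from order_tendstoD(2)[OF gap this] ev
    show "\<forall>\<^sub>F c in at c0 within region. multiplier c < a"
    proof eventually_elim
      case (elim c)
      obtain x y t where c: "c = (x, y, t)" by (cases c)
      have t: "t < T" using elim by (simp add: c region_def)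
      have "Y (x, a) t < Y (x, multiplier c) t" using elim multiplier(2)[of x y t] by (simp add: c)
      then show ?case
        using Y_strict_antimono[OF t, of a "multiplier c" x] a m0 by (cases "multiplier c" a rule: linorder_cases) auto
    qed
  next
    fix a assume a: "a < multiplier c0"
    show "\<forall>\<^sub>F c in at c0 within region. a < multiplier c"
    proof (cases "a < 0")
      case True
      have "a < multiplier c" if "c \<in> region" for c
        using multiplier(1)[of "fst c" "fst (snd c)" "snd (snd c)"] that True by simp
      with ev show ?thesis by (rule eventually_mono)
    next
      case False
      then have "Y (x0, a) t0 - y0 > 0" using Y_strict_antimono[OF t0 _ a, of x0] m0 by simp
      from order_tendstoD(1)[OF gap this] ev
      show ?thesis
      proof eventually_elim
        case (elim c)
        obtain x y t where c: "c = (x, y, t)" by (cases c)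
        have t: "t < T" using elim by (simp add: c region_def)
        have m: "multiplier c \<ge> 0" using elim multiplier(1)[of x y t] by (simp add: c)
        have "Y (x, multiplier c) t < Y (x, a) t" using elim multiplier(2)[of x y t] by (simp add: c)
        then show ?case
          using Y_strict_antimono[OF t m, of a x] by (cases "multiplier c" a rule: linorder_cases) auto
      qed
    qed
  qed
qed

abbreviation final_state :: "real \<times> real \<times> real \<Rightarrow> real \<times> real" where
  "final_state c \<equiv> (fst c, multiplier c)"

lemma continuous_at_final_states:
  assumes g: "continuous_on (UNIV \<times> {..T}) (\<lambda>(\<theta>, s). g \<theta> s)"
    and "continuous_on S u" "continuous_on S v" "continuous_on S \<tau>"
    and "\<And>c. c \<in> S \<Longrightarrow> u c \<in> region" "\<And>c. c \<in> S \<Longrightarrow> v c \<in> region" "\<And>c. c \<in> S \<Longrightarrow> \<tau> c \<le> T"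
  shows "continuous_on S (\<lambda>c. g (final_state (u c), final_state (v c)) (\<tau> c))"
proof -
  have "continuous_on S (\<lambda>c. (\<lambda>(\<theta>, s). g \<theta> s) ((final_state (u c), final_state (v c)), \<tau> c))"
    by (rule continuous_on_compose2[OF g])
      (use assms in \<open>auto intro!: continuous_intros continuous_on_compose2[OF continuous_multiplier]\<close>)
  then show ?thesis by simp
qed

text \<open>The derivatives obtained by solving \<open>Y (x, multiplier (x, y, t)) t = y\<close> for the multiplier with the implicit
function rule. They make sense on the whole region, since \<open>Y_p\<close> vanishes at time \<open>T\<close> only.\<close>
definition hess_xx where
  "hess_xx c = - (Y_x (final_state c, final_state c) (snd (snd c)) / Y_p (final_state c, final_state c) (snd (snd c)))"
definition hess_xy where
  "hess_xy c = 1 / Y_p (final_state c, final_state c) (snd (snd c))"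
definition hess_yy where
  "hess_yy c = - (P_p (final_state c, final_state c) (snd (snd c)) * hess_xy c)"

lemma hess_continuous:
  "continuous_on region hess_xx" "continuous_on region hess_xy" "continuous_on region hess_yy"
proof -
  have c: "continuous_on region (\<lambda>c. g (final_state c, final_state c) (snd (snd c)))"
    if "continuous_on (UNIV \<times> {..T}) (\<lambda>(\<theta>, s). g \<theta> s)" for g :: "_ \<Rightarrow> real \<Rightarrow> real"
    by (rule continuous_at_final_states[OF that]) (auto intro!: continuous_intros simp: region_def)
  have nz: "Y_p (final_state c, final_state c) (snd (snd c)) \<noteq> 0" if "c \<in> region" for c
    using Y_p_neg[of "snd (snd c)" "(final_state c, final_state c)"]
      multiplier(1)[of "fst c" "fst (snd c)" "snd (snd c)"] that by (auto simp: region_def)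
  show xx: "continuous_on region hess_xx" and xy: "continuous_on region hess_xy"
    unfolding hess_xx_def hess_xy_def by (intro continuous_intros c continuous_sensitivities ballI nz; assumption)+
  show "continuous_on region hess_yy"
    unfolding hess_yy_def by (intro continuous_intros c continuous_sensitivities xy)
qed

text \<open>On the diagonal the secant system is Hamiltonian: its matrix has trace zero, so the determinant of the
fundamental matrix is constant.\<close>
lemma wronskian:
  assumes "t \<le> T"
  shows "Y_x (\<theta>, \<theta>) t * P_p (\<theta>, \<theta>) t - P_x (\<theta>, \<theta>) t * Y_p (\<theta>, \<theta>) t = 1"
proof -
  define w where "w s = Y_x (\<theta>, \<theta>) s * P_p (\<theta>, \<theta>) s - P_x (\<theta>, \<theta>) s * Y_p (\<theta>, \<theta>) s" for s
  have "(w has_vector_derivative 0) (at s within {t..T})" if s: "s \<in> {t..T}" for s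
  proof -
    note d = sensitivity_components[OF s, of "(1, 0)" "(\<theta>, \<theta>)"] sensitivity_components[OF s, of "(0, 1)" "(\<theta>, \<theta>)"]
    have "secant_b (\<theta>, \<theta>) s = b1 (Y \<theta> s) s" by (simp add: secant_b_def mean_slope_def)
    then have "(w has_real_derivative 0) (at s within {t..T})"
      unfolding w_def Y_x_def P_x_def Y_p_def P_p_def
      by (auto intro!: derivative_eq_intros d simp: algebra_simps)
    then show ?thesis by (simp add: has_real_derivative_iff_has_vector_derivative)
  qed
  then obtain c where "\<And>s. s \<in> {t..T} \<Longrightarrow> w s = c"
    using has_vector_derivative_zero_constant[of "{t..T}" w] by auto
  then have "w t = w T" using assms by simp
  then show ?thesis by (simp add: w_def Y_x_def P_x_def Y_p_def P_p_def)
qed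

text \<open>The symmetry of the mixed derivatives, in the guise of the Wronskian identity. It transfers the sign of
the derivative of the multiplier in \<open>y\<close> to that of the negative initial momentum in \<open>x\<close>.\<close>
lemma hess_symmetric:
  assumes "c \<in> region"
  shows "- (P_x (final_state c, final_state c) (snd (snd c))
    + P_p (final_state c, final_state c) (snd (snd c)) * hess_xx c) = hess_xy c"
proof -
  obtain x y t where c: "c = (x, y, t)" by (cases c)
  have t: "t < T" and m: "multiplier c \<ge> 0" using assms multiplier(1)[of x y t] by (auto simp: c region_def)
  let ?\<theta> = "(final_state c, final_state c)"
  have "Y_p ?\<theta> t \<noteq> 0" using Y_p_neg[of t ?\<theta>] t m by auto
  moreover have "Y_x ?\<theta> t * P_p ?\<theta> t = 1 + P_x ?\<theta> t * Y_p ?\<theta> t"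
    using wronskian[of t "final_state c"] t by simp
  moreover have "snd (snd c) = t" by (simp add: c)
  ultimately show ?thesis by (simp add: hess_xx_def hess_xy_def field_simps)
qed

lemma hess_signs:
  assumes "c \<in> region"
  shows "hess_xx c > 0" "hess_xy c < 0" "hess_yy c > 0"
proof -
  obtain x y t where c: "c = (x, y, t)" by (cases c)
  have t: "t < T" and m: "multiplier c \<ge> 0" using assms multiplier(1)[of x y t] by (auto simp: c region_def)
  let ?\<theta> = "(final_state c, final_state c)"
  have Yp: "Y_p ?\<theta> t < 0" using t m by (intro Y_p_neg) auto
  have Yx: "Y_x ?\<theta> t > 0" using t m by (intro Y_x_pos) auto
  have "exp (- (A * (T - t))) \<le> P_p ?\<theta> t" using t m by (intro P_p_ge_Y_p_nonpos) auto
  then have Pp: "P_p ?\<theta> t > 0" using exp_gt_zero[of "- (A * (T - t))"] by linarith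
  have tc: "snd (snd c) = t" by (simp add: c)
  show "hess_xx c > 0" using Yp Yx by (simp add: hess_xx_def tc divide_pos_neg)
  show xy: "hess_xy c < 0" using Yp by (simp add: hess_xy_def tc)
  show "hess_yy c > 0" using Pp xy by (simp add: hess_yy_def tc mult_pos_neg)
qed

text \<open>The points \<open>(x, y)\<close> of \<open>U\<close> at a time \<open>t < T\<close>.\<close>
definition slice :: "real \<Rightarrow> (real \<times> real) set" where
  "slice t = {z. snd z < Y (fst z, 0) t}"

abbreviation lift :: "real \<Rightarrow> real \<times> real \<Rightarrow> real \<times> real \<times> real" where
  "lift t z \<equiv> (fst z, snd z, t)"

lemma open_slice:
  assumes "t < T"
  shows "open (slice t)"
  unfolding slice_def using assms
  by (intro open_Collect_less continuous_Y_compose continuous_intros) auto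

lemma lift_slice: "t < T \<Longrightarrow> z \<in> slice t \<Longrightarrow> lift t z \<in> region"
  by (auto simp: slice_def region_def)

lemma slice_tendsto:
  assumes "t < T" "z0 \<in> slice t" and g: "continuous_on (UNIV \<times> {..T}) (\<lambda>(\<theta>, s). g \<theta> s)"
  shows "((\<lambda>z. g (final_state (lift t z), final_state (lift t z0)) t) \<longlongrightarrow> g (final_state (lift t z0), final_state (lift t z0)) t) (at z0)"
proof -
  have "continuous_on (slice t) (\<lambda>z. g (final_state (lift t z), final_state (lift t z0)) t)"
    by (rule continuous_at_final_states[OF g, where u = "lift t" and v = "\<lambda>_. lift t z0"])
      (use assms lift_slice in \<open>auto intro!: continuous_intros\<close>)
  then have "isCont (\<lambda>z. g (final_state (lift t z), final_state (lift t z0)) t) z0"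
    using open_slice[OF assms(1)] assms(2) by (simp add: continuous_on_eq_continuous_at)
  then show ?thesis by (simp add: isCont_def)
qed

text \<open>Solving the exact difference formula of the paths for the difference of the terminal momenta gives
slopes that are explicit in the fundamental matrix.\<close>
lemma multiplier_secant:
  assumes "t < T" "z \<in> slice t" "z0 \<in> slice t"
  defines "\<theta> \<equiv> (final_state (lift t z), final_state (lift t z0))"
  shows "multiplier (lift t z) - multiplier (lift t z0)
    = - (Y_x \<theta> t / Y_p \<theta> t) * (fst z - fst z0) + 1 / Y_p \<theta> t * (snd z - snd z0)"
proof -
  have m: "Y (final_state (lift t z)) t = snd z" "Y (final_state (lift t z0)) t = snd z0" "multiplier (lift t z0) \<ge> 0"
    using multiplier[of "fst z" "snd z" t] multiplier[of "fst z0" "snd z0" t] lift_slice assms(1-3) by auto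
  have nz: "Y_p \<theta> t \<noteq> 0" using Y_p_neg[of t \<theta>] assms(1) m(3) by (simp add: \<theta>_def)
  have eq: "snd z - snd z0 = Y_x \<theta> t * (fst z - fst z0) + Y_p \<theta> t * (multiplier (lift t z) - multiplier (lift t z0))"
    using Y_difference[of t "final_state (lift t z)" "final_state (lift t z0)"] assms(1) m by (simp add: \<theta>_def)
  show ?thesis unfolding eq using nz by (simp add: field_simps)
qed

lemma multiplier_derivative:
  assumes "t < T" "z0 \<in> slice t"
  shows "((\<lambda>z. multiplier (lift t z)) has_derivative
    (\<lambda>h. hess_xx (lift t z0) * fst h + hess_xy (lift t z0) * snd h)) (at z0)"
proof (rule has_derivative_of_secant_slopes)
  let ?\<theta> = "\<lambda>z. (final_state (lift t z), final_state (lift t z0))"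
  have "\<forall>\<^sub>F z in at z0. z \<in> slice t"
    using eventually_at_topological open_slice[OF assms(1)] assms(2) by blast
  then show "\<forall>\<^sub>F z in at z0. multiplier (lift t z) - multiplier (lift t z0)
      = - (Y_x (?\<theta> z) t / Y_p (?\<theta> z) t) * (fst z - fst z0) + 1 / Y_p (?\<theta> z) t * (snd z - snd z0)"
    by (rule eventually_mono) (rule multiplier_secant[OF assms(1) _ assms(2)])
  have nz: "Y_p (?\<theta> z0) t \<noteq> 0"
    using Y_p_neg[of t "?\<theta> z0"] multiplier(1) lift_slice[OF assms] assms(1) by fastforce
  show "((\<lambda>z. - (Y_x (?\<theta> z) t / Y_p (?\<theta> z) t)) \<longlongrightarrow> hess_xx (lift t z0)) (at z0)"
    using nz tendsto_minus[OF tendsto_divide[OF slice_tendsto[OF assms continuous_sensitivities(1)] slice_tendsto[OF assms continuous_sensitivities(3)]]]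
    by (simp add: hess_xx_def)
  show "((\<lambda>z. 1 / Y_p (?\<theta> z) t) \<longlongrightarrow> hess_xy (lift t z0)) (at z0)"
    using nz tendsto_divide[OF tendsto_const slice_tendsto[OF assms continuous_sensitivities(3)], of 1]
    by (simp add: hess_xy_def)
qed

lemma momentum_derivative:
  assumes "t < T" "z0 \<in> slice t"
  shows "((\<lambda>z. - P (final_state (lift t z)) t) has_derivative
    (\<lambda>h. hess_xy (lift t z0) * fst h + hess_yy (lift t z0) * snd h)) (at z0)"
proof (rule has_derivative_of_secant_slopes)
  let ?\<theta> = "\<lambda>z. (final_state (lift t z), final_state (lift t z0))"
  let ?\<alpha> = "\<lambda>z. - (Y_x (?\<theta> z) t / Y_p (?\<theta> z) t)" and ?\<beta> = "\<lambda>z. 1 / Y_p (?\<theta> z) t"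
  have "\<forall>\<^sub>F z in at z0. z \<in> slice t"
    using eventually_at_topological open_slice[OF assms(1)] assms(2) by blast
  then show "\<forall>\<^sub>F z in at z0. - P (final_state (lift t z)) t - - P (final_state (lift t z0)) t
      = - (P_x (?\<theta> z) t + P_p (?\<theta> z) t * ?\<alpha> z) * (fst z - fst z0) + - (P_p (?\<theta> z) t * ?\<beta> z) * (snd z - snd z0)"
  proof (rule eventually_mono)
    fix z assume z: "z \<in> slice t"
    have "P (final_state (lift t z)) t - P (final_state (lift t z0)) t
        = P_x (?\<theta> z) t * (fst z - fst z0) + P_p (?\<theta> z) t * (multiplier (lift t z) - multiplier (lift t z0))"
      using P_difference[of t "final_state (lift t z)" "final_state (lift t z0)"] assms(1) by simp
    also have "\<dots> = P_x (?\<theta> z) t * (fst z - fst z0) + P_p (?\<theta> z) t * (?\<alpha> z * (fst z - fst z0) + ?\<beta> z * (snd z - snd z0))"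
      by (simp only: multiplier_secant[OF assms(1) z assms(2)])
    finally show "- P (final_state (lift t z)) t - - P (final_state (lift t z0)) t
      = - (P_x (?\<theta> z) t + P_p (?\<theta> z) t * ?\<alpha> z) * (fst z - fst z0) + - (P_p (?\<theta> z) t * ?\<beta> z) * (snd z - snd z0)"
      by (simp add: algebra_simps)
  qed
  have nz: "Y_p (?\<theta> z0) t \<noteq> 0"
    using Y_p_neg[of t "?\<theta> z0"] multiplier(1) lift_slice[OF assms] assms(1) by fastforce
  have \<alpha>: "(?\<alpha> \<longlongrightarrow> hess_xx (lift t z0)) (at z0)"
    using nz tendsto_minus[OF tendsto_divide[OF slice_tendsto[OF assms continuous_sensitivities(1)] slice_tendsto[OF assms continuous_sensitivities(3)]]]
    by (simp add: hess_xx_def)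
  have \<beta>: "(?\<beta> \<longlongrightarrow> hess_xy (lift t z0)) (at z0)"
    using nz tendsto_divide[OF tendsto_const slice_tendsto[OF assms continuous_sensitivities(3)], of 1]
    by (simp add: hess_xy_def)
  show "((\<lambda>z. - (P_x (?\<theta> z) t + P_p (?\<theta> z) t * ?\<alpha> z)) \<longlongrightarrow> hess_xy (lift t z0)) (at z0)"
    using tendsto_minus[OF tendsto_add[OF slice_tendsto[OF assms continuous_sensitivities(2)]
        tendsto_mult[OF slice_tendsto[OF assms continuous_sensitivities(4)] \<alpha>]]]
    hess_symmetric[OF lift_slice[OF assms]] by simp
  show "((\<lambda>z. - (P_p (?\<theta> z) t * ?\<beta> z)) \<longlongrightarrow> hess_yy (lift t z0)) (at z0)"
    using tendsto_minus[OF tendsto_mult[OF slice_tendsto[OF assms continuous_sensitivities(4)] \<beta>]]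
    by (simp add: hess_yy_def)
qed

text \<open>The subgradients at \<open>z0\<close> and at \<open>z\<close> bound the remainder from both sides by the increment of the subgradient
times the distance, and the subgradient is continuous.\<close>
lemma q_derivative:
  assumes "t < T" "z0 \<in> slice t"
  shows "((\<lambda>z. q b T (fst z) (snd z) t) has_derivative
    (\<lambda>h. multiplier (lift t z0) * fst h + (- P (final_state (lift t z0)) t) * snd h)) (at z0)"
proof (rule has_derivative_of_error_bound)
  let ?m = "\<lambda>z. multiplier (lift t z)" and ?p = "\<lambda>z. - P (final_state (lift t z)) t"
  have sub: "q b T (fst z) (snd z) t + ?m z * (fst w - fst z) + ?p z * (snd w - snd z) \<le> q b T (fst w) (snd w) t"
    if "z \<in> slice t" for z w
    using q_subgradient[OF assms(1), of "final_state (lift t z)" "fst w" "snd w"]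
      multiplier[of "fst z" "snd z" t] lift_slice[OF assms(1) that] by simp
  have "\<forall>\<^sub>F z in at z0. z \<in> slice t"
    using eventually_at_topological open_slice[OF assms(1)] assms(2) by blast
  then show "\<forall>\<^sub>F z in at z0. \<bar>q b T (fst z) (snd z) t - q b T (fst z0) (snd z0) t
      - (?m z0 * (fst z - fst z0) + ?p z0 * (snd z - snd z0))\<bar> \<le> (\<bar>?m z - ?m z0\<bar> + \<bar>?p z - ?p z0\<bar>) * norm (z - z0)"
  proof (rule eventually_mono)
    fix z assume z: "z \<in> slice t"
    let ?D = "q b T (fst z) (snd z) t - q b T (fst z0) (snd z0) t - (?m z0 * (fst z - fst z0) + ?p z0 * (snd z - snd z0))"
    have prod: "a * d \<le> \<bar>a\<bar> * n" if "\<bar>d\<bar> \<le> n" for a d n :: real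
      using mult_left_mono[OF that, of "\<bar>a\<bar>"] abs_ge_self[of "a * d"] by (simp add: abs_mult)
    have "0 \<le> ?D" using sub[OF assms(2), of z] by simp
    moreover have "?D \<le> (?m z - ?m z0) * (fst z - fst z0) + (?p z - ?p z0) * (snd z - snd z0)"
      using sub[OF z, of z0] by (simp add: algebra_simps)
    moreover have "(?m z - ?m z0) * (fst z - fst z0) \<le> \<bar>?m z - ?m z0\<bar> * norm (z - z0)"
      "(?p z - ?p z0) * (snd z - snd z0) \<le> \<bar>?p z - ?p z0\<bar> * norm (z - z0)"
      using abs_components_le_norm[of "z - z0"] by (intro prod; simp)+
    ultimately show "\<bar>?D\<bar> \<le> (\<bar>?m z - ?m z0\<bar> + \<bar>?p z - ?p z0\<bar>) * norm (z - z0)"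
      unfolding distrib_right by linarith
  qed
  have "(?m \<longlongrightarrow> ?m z0) (at z0)" "(?p \<longlongrightarrow> ?p z0) (at z0)"
    using has_derivative_continuous[OF multiplier_derivative[OF assms]] has_derivative_continuous[OF momentum_derivative[OF assms]]
    by (auto simp: isCont_def)
  then have "((\<lambda>z. \<bar>?m z - ?m z0\<bar> + \<bar>?p z - ?p z0\<bar>) \<longlongrightarrow> \<bar>?m z0 - ?m z0\<bar> + \<bar>?p z0 - ?p z0\<bar>) (at z0)"
    by (intro tendsto_add tendsto_rabs tendsto_diff tendsto_const)
  then show "((\<lambda>z. \<bar>?m z - ?m z0\<bar> + \<bar>?p z - ?p z0\<bar>) \<longlongrightarrow> 0) (at z0)" by simp
qed

lemma q_partials:
  assumes "t < T" "(x, y) \<in> slice t"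
  shows "partial1 (\<lambda>x y. q b T x y t) x y = multiplier (x, y, t)"
    and "partial2 (\<lambda>x y. q b T x y t) x y = - P (x, multiplier (x, y, t)) t"
  using partial_derivatives_of_has_derivative[OF q_derivative[OF assms]]
  by (auto simp: partial1_def partial2_def intro!: DERIV_imp_deriv)

text \<open>The gradient is known on an open neighbourhood, hence its own partial derivatives can be read off.\<close>
lemma q_second_partials:
  assumes "t < T" "(x, y) \<in> slice t"
  shows "q_xx b T x y t = hess_xx (x, y, t)" "q_xy b T x y t = hess_xy (x, y, t)"
    "q_yx b T x y t = hess_xy (x, y, t)" "q_yy b T x y t = hess_yy (x, y, t)"
proof -
  have "open ((\<lambda>u. (u, y)) -` slice t)" "open ((\<lambda>v. (x, v)) -` slice t)"
    using open_slice[OF assms(1)] by (auto intro!: open_vimage continuous_intros)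
  then have ev: "\<forall>\<^sub>F u in nhds x. (u, y) \<in> slice t" "\<forall>\<^sub>F v in nhds y. (x, v) \<in> slice t"
    using assms(2) by (auto simp: eventually_nhds vimage_def)
  note m = partial_derivatives_of_has_derivative[OF multiplier_derivative[OF assms]]
  note p = partial_derivatives_of_has_derivative[OF momentum_derivative[OF assms]]
  have "q_xx b T x y t = deriv (\<lambda>u. multiplier (u, y, t)) x"
    unfolding partial1_def[of "partial1 _"] by (intro deriv_cong_ev eventually_mono[OF ev(1)] q_partials assms refl)
  also have "\<dots> = hess_xx (x, y, t)" using m(1) by (auto intro: DERIV_imp_deriv)
  finally show "q_xx b T x y t = hess_xx (x, y, t)" .
  have "q_xy b T x y t = deriv (\<lambda>u. - P (u, multiplier (u, y, t)) t) x"
    unfolding partial1_def[of "partial2 _"] by (intro deriv_cong_ev eventually_mono[OF ev(1)] q_partials assms refl)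
  also have "\<dots> = hess_xy (x, y, t)" using p(1) by (auto intro: DERIV_imp_deriv)
  finally show "q_xy b T x y t = hess_xy (x, y, t)" .
  have "q_yx b T x y t = deriv (\<lambda>v. multiplier (x, v, t)) y"
    unfolding partial2_def[of "partial1 _"] by (intro deriv_cong_ev eventually_mono[OF ev(2)] q_partials assms refl)
  also have "\<dots> = hess_xy (x, y, t)" using m(2) by (auto intro: DERIV_imp_deriv)
  finally show "q_yx b T x y t = hess_xy (x, y, t)" .
  have "q_yy b T x y t = deriv (\<lambda>v. - P (x, multiplier (x, v, t)) t) y"
    unfolding partial2_def[of "partial2 _"] by (intro deriv_cong_ev eventually_mono[OF ev(2)] q_partials assms refl)
  also have "\<dots> = hess_yy (x, y, t)" using p(2) by (auto intro: DERIV_imp_deriv)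
  finally show "q_yy b T x y t = hess_yy (x, y, t)" .
qed

lemma U_eq: "U b T = {(x, y, t). t < T \<and> (x, y) \<in> slice t}"
  by (auto simp: U_def slice_def F_eq)

lemma U_subset_region: "U b T \<subseteq> region"
  by (auto simp: U_eq region_def slice_def)

text \<open>Times are cut off at \<open>T\<close> in the defining inequality because extremals are controlled only up to \<open>T\<close>; the
inequality is then closed on the whole space.\<close>
lemma frontier_U_region:
  assumes "(x, y, t) \<in> frontier (U b T)" "t < T"
  shows "(x, y, t) \<in> region"
proof -
  let ?S = "{c :: real \<times> real \<times> real. fst (snd c) \<le> Y (fst c, 0) (min (snd (snd c)) T)}"
  have "closed ?S"
    by (intro closed_Collect_le continuous_Y_compose continuous_intros) auto
  moreover have "U b T \<subseteq> ?S" by (auto simp: U_eq slice_def)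
  ultimately have "closure (U b T) \<subseteq> ?S" by (simp add: closure_minimal)
  moreover have "(x, y, t) \<in> closure (U b T)" using assms(1) by (simp add: frontier_def)
  ultimately show ?thesis using assms(2) by (auto simp: region_def)
qed

lemma q_twice_differentiable:
  assumes "t < T" "z0 \<in> slice t"
  shows "twice_differentiable_at (\<lambda>(x, y). q b T x y t) z0"
proof -
  define g' where "g' z = multiplier (lift t z) *\<^sub>R fst_blinfun + (- P (final_state (lift t z)) t) *\<^sub>R (snd_blinfun :: (real \<times> real) \<Rightarrow>\<^sub>L real)" for z
  have "((\<lambda>(x, y). q b T x y t) has_derivative blinfun_apply (g' z)) (at z)" if "z \<in> slice t" for z
  proof -
    have "blinfun_apply (g' z) = (\<lambda>h. multiplier (lift t z) * fst h + (- P (final_state (lift t z)) t) * snd h)"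
      by (rule ext) (simp add: g'_def blinfun.add_left blinfun.diff_left blinfun.minus_left blinfun.scaleR_left)
    with q_derivative[OF assms(1) that] show ?thesis by (simp only: case_prod_unfold)
  qed
  moreover have "\<forall>\<^sub>F z in nhds z0. z \<in> slice t"
    using open_slice[OF assms(1)] assms(2) by (rule eventually_nhds_in_open)
  ultimately have "\<forall>\<^sub>F z in nhds z0. ((\<lambda>(x, y). q b T x y t) has_derivative blinfun_apply (g' z)) (at z)"
    by (auto elim: eventually_mono)
  moreover have "(\<lambda>z. multiplier (lift t z)) differentiable (at z0)" "(\<lambda>z. - P (final_state (lift t z)) t) differentiable (at z0)"
    using multiplier_derivative[OF assms] momentum_derivative[OF assms] by (auto simp: differentiable_def)
  then have "g' differentiable (at z0)"
    unfolding g'_def[abs_def] by (intro differentiable_add differentiable_scaleR differentiable_const)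
  ultimately show ?thesis by (auto simp: twice_differentiable_at_def)
qed

lemma hess_limit:
  assumes g: "continuous_on region g" and eq: "\<And>c. c \<in> U b T \<Longrightarrow> h c = g c" and "c0 \<in> region"
  shows "(h \<longlongrightarrow> g c0) (at c0 within U b T)"
proof -
  have "(g \<longlongrightarrow> g c0) (at c0 within U b T)"
    using g assms(3) U_subset_region by (auto simp: continuous_on_def intro: tendsto_within_subset)
  moreover have "\<forall>\<^sub>F c in at c0 within U b T. g c = h c" by (auto simp: eventually_at_filter eq)
  ultimately show ?thesis by (rule Lim_transform_eventually)
qed

theorem q_hessian:
  shows "\<forall>(x, y, t) \<in> U b T. twice_differentiable_at (\<lambda>(x, y). q b T x y t) (x, y)"
    and "continuous_on (U b T) (\<lambda>(x, y, t). q_xx b T x y t)"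
    and "continuous_on (U b T) (\<lambda>(x, y, t). q_xy b T x y t)"
    and "continuous_on (U b T) (\<lambda>(x, y, t). q_yx b T x y t)"
    and "continuous_on (U b T) (\<lambda>(x, y, t). q_yy b T x y t)"
    and "\<forall>(x, y, t) \<in> U b T. q_xx b T x y t > 0 \<and> q_yy b T x y t > 0 \<and> q_xy b T x y t < 0"
    and "\<forall>(x0, y0, t0) \<in> frontier (U b T). t0 < T \<longrightarrow>
       (\<exists>L>0. ((\<lambda>(x, y, t). q_xx b T x y t) \<longlongrightarrow> L) (at (x0, y0, t0) within U b T)) \<and>
       (\<exists>L>0. ((\<lambda>(x, y, t). q_yy b T x y t) \<longlongrightarrow> L) (at (x0, y0, t0) within U b T))"
proof -
  have xx: "(\<lambda>(x, y, t). q_xx b T x y t) c = hess_xx c" and xy: "(\<lambda>(x, y, t). q_xy b T x y t) c = hess_xy c"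
    and yx: "(\<lambda>(x, y, t). q_yx b T x y t) c = hess_xy c" and yy: "(\<lambda>(x, y, t). q_yy b T x y t) c = hess_yy c"
    if "c \<in> U b T" for c
    using that q_second_partials by (auto simp: U_eq)
  note cont = continuous_on_subset[OF _ U_subset_region]
  show "\<forall>(x, y, t) \<in> U b T. twice_differentiable_at (\<lambda>(x, y). q b T x y t) (x, y)"
    using q_twice_differentiable by (auto simp: U_eq)
  show "continuous_on (U b T) (\<lambda>(x, y, t). q_xx b T x y t)"
    by (rule continuous_on_eq[OF cont[OF hess_continuous(1)] xx[symmetric]])
  show "continuous_on (U b T) (\<lambda>(x, y, t). q_xy b T x y t)"
    by (rule continuous_on_eq[OF cont[OF hess_continuous(2)] xy[symmetric]])
  show "continuous_on (U b T) (\<lambda>(x, y, t). q_yx b T x y t)"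
    by (rule continuous_on_eq[OF cont[OF hess_continuous(2)] yx[symmetric]])
  show "continuous_on (U b T) (\<lambda>(x, y, t). q_yy b T x y t)"
    by (rule continuous_on_eq[OF cont[OF hess_continuous(3)] yy[symmetric]])
  show "\<forall>(x, y, t) \<in> U b T. q_xx b T x y t > 0 \<and> q_yy b T x y t > 0 \<and> q_xy b T x y t < 0"
  proof clarify
    fix x y t assume c: "(x, y, t) \<in> U b T"
    then have "(x, y, t) \<in> region" using U_subset_region by blast
    then show "q_xx b T x y t > 0 \<and> q_yy b T x y t > 0 \<and> q_xy b T x y t < 0"
      using hess_signs[of "(x, y, t)"] xx[OF c] xy[OF c] yy[OF c] by simp
  qed
  show "\<forall>(x0, y0, t0) \<in> frontier (U b T). t0 < T \<longrightarrow>
       (\<exists>L>0. ((\<lambda>(x, y, t). q_xx b T x y t) \<longlongrightarrow> L) (at (x0, y0, t0) within U b T)) \<and>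
       (\<exists>L>0. ((\<lambda>(x, y, t). q_yy b T x y t) \<longlongrightarrow> L) (at (x0, y0, t0) within U b T))"
  proof clarify
    fix x0 y0 t0 assume "(x0, y0, t0) \<in> frontier (U b T)" "t0 < T"
    then have c0: "(x0, y0, t0) \<in> region" by (rule frontier_U_region)
    show "(\<exists>L>0. ((\<lambda>(x, y, t). q_xx b T x y t) \<longlongrightarrow> L) (at (x0, y0, t0) within U b T)) \<and>
       (\<exists>L>0. ((\<lambda>(x, y, t). q_yy b T x y t) \<longlongrightarrow> L) (at (x0, y0, t0) within U b T))"
      using hess_signs[OF c0] hess_limit[OF hess_continuous(1) xx c0] hess_limit[OF hess_continuous(3) yy c0]
      by blast
  qed
qed

end

theorem proposition2p3:
  fixes T A :: real and b :: "real \<Rightarrow> real \<Rightarrow> real"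
  assumes "T > 0" and "A \<ge> 0"
    and "continuous_on (UNIV \<times> {..T}) (\<lambda>(y, s). b y s)"
    and "\<forall>y. \<forall>s\<le>T. (\<lambda>y. b y s) differentiable (at y)"
    and "continuous_on (UNIV \<times> {..T}) (\<lambda>(y, s). partial1 b y s)"
    and "\<forall>y. \<forall>s\<le>T. \<bar>partial1 b y s\<bar> \<le> A"
    and "\<forall>s\<le>T. concave_on UNIV (\<lambda>y. b y s)"
  shows "(\<forall>t<T. convex_on UNIV (\<lambda>(x, y). q b T x y t)) \<and>
    ((\<forall>y. \<forall>s\<le>T. (\<lambda>y. partial1 b y s) differentiable (at y)) \<and>
     continuous_on (UNIV \<times> {..T}) (\<lambda>(y, s). partial1 (partial1 b) y s) \<longrightarrow>
      (\<forall>(x, y, t) \<in> U b T. twice_differentiable_at (\<lambda>(x, y). q b T x y t) (x, y)) \<and>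
      continuous_on (U b T) (\<lambda>(x, y, t). q_xx b T x y t) \<and>
      continuous_on (U b T) (\<lambda>(x, y, t). q_xy b T x y t) \<and>
      continuous_on (U b T) (\<lambda>(x, y, t). q_yx b T x y t) \<and>
      continuous_on (U b T) (\<lambda>(x, y, t). q_yy b T x y t) \<and>
      (\<forall>(x, y, t) \<in> U b T.
         q_xx b T x y t > 0 \<and> q_yy b T x y t > 0 \<and> q_xy b T x y t < 0) \<and>
      (\<forall>(x0, y0, t0) \<in> frontier (U b T). t0 < T \<longrightarrow>
         (\<exists>L>0. ((\<lambda>(x, y, t). q_xx b T x y t) \<longlongrightarrow> L) (at (x0, y0, t0) within U b T)) \<and>
         (\<exists>L>0. ((\<lambda>(x, y, t). q_yy b T x y t) \<longlongrightarrow> L) (at (x0, y0, t0) within U b T))))"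
proof -
  interpret concave_drift b "partial1 b" T A
  proof
    fix y s assume "s \<le> T"
    with assms(4) show "((\<lambda>y. b y s) has_real_derivative partial1 b y s) (at y)"
      unfolding partial1_def by (simp add: DERIV_deriv_iff_real_differentiable)
  qed (use assms in auto)
  show ?thesis
  proof (intro conjI impI allI)
    fix t assume "t < T"
    then show "convex_on UNIV (\<lambda>(x, y). q b T x y t)" by (rule q_convex)
  next
    assume smooth: "(\<forall>y. \<forall>s\<le>T. (\<lambda>y. partial1 b y s) differentiable (at y)) \<and>
       continuous_on (UNIV \<times> {..T}) (\<lambda>(y, s). partial1 (partial1 b) y s)"
    interpret smooth_concave_drift b "partial1 b" T A "partial1 (partial1 b)"
    proof
      fix y s assume "s \<le> T"
      with smooth show "((\<lambda>y. partial1 b y s) has_real_derivative partial1 (partial1 b) y s) (at y)"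
        unfolding partial1_def[of "partial1 b"] by (simp add: DERIV_deriv_iff_real_differentiable)
    qed (use smooth in auto)
    show "\<forall>(x, y, t) \<in> U b T. twice_differentiable_at (\<lambda>(x, y). q b T x y t) (x, y)"
      "continuous_on (U b T) (\<lambda>(x, y, t). q_xx b T x y t)"
      "continuous_on (U b T) (\<lambda>(x, y, t). q_xy b T x y t)"
      "continuous_on (U b T) (\<lambda>(x, y, t). q_yx b T x y t)"
      "continuous_on (U b T) (\<lambda>(x, y, t). q_yy b T x y t)"
      "\<forall>(x, y, t) \<in> U b T. q_xx b T x y t > 0 \<and> q_yy b T x y t > 0 \<and> q_xy b T x y t < 0"
      "\<forall>(x0, y0, t0) \<in> frontier (U b T). t0 < T \<longrightarrow>
         (\<exists>L>0. ((\<lambda>(x, y, t). q_xx b T x y t) \<longlongrightarrow> L) (at (x0, y0, t0) within U b T)) \<and>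
         (\<exists>L>0. ((\<lambda>(x, y, t). q_yy b T x y t) \<longlongrightarrow> L) (at (x0, y0, t0) within U b T))"
      by (fact q_hessian)+
  qed
qed

end
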